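(* Let $1\le d\le 4$ and $n=2$, in the unknown-variance Gaussian prediction model described in the context. Then the best equivariant predictive density $\hat p_R$ is inadmissible under the Kullback--Leibler risk. More precisely, there is a constant $\nu_*>0$ (depending only on $d$) such that for every $\nu$ with $0<\nu\le\nu_*$, the Bayesian predictive density $\hat p_{\mathrm{GM}}$ with respect to the prior $$\pi_{\mathrm{GM}}(\mu,\eta)=\int_0^1\phi\{\mu;0,\eta^{-1}\lambda^{-1}(1-\lambda)\}\,\eta^{a}\lambda^{a}f(\lambda)\,d\lambda,\qquad a=\nu-d/2-1,$$ with $f(\lambda)=(1-\lambda)^{(n-1)d/2-1}\{1-(n-1)\lambda/n\}^{-(n-2)d/2-\nu}=(1-\lambda)^{d/2-1}(1-\lambda/2)^{-\nu}$ for $\lambda\in(0,1)$, dominates $\hat p_R$ under the Kullback--Leibler risk.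
   Context: Model: $x_1,\dots,x_n,y$ are independent with $x_i\sim N_d(\mu,\eta^{-1}I_d)$ and $y\sim N_d(\mu,\eta^{-1}I_d)$, where $\mu\in\mathbb{R}^d$ and $\eta=1/\sigma^2>0$ are unknown; $\bar x_n=n^{-1}\sum_i x_i$, $s_n=\sum_i\|x_i-\bar x_n\|^2$. $\phi(\cdot;\theta,\tau)$ is the $N_d(\theta,\tau I_d)$ density and $\gamma(\cdot;k)$ the chi-square density with $k$ degrees of freedom. For a (possibly improper) prior density $\pi(\mu,\eta)$ on $\mathbb{R}^d\times(0,\infty)$, the Bayesian predictive density is $$\hat p_\pi(y\mid\bar x_n,s_n)=\frac{\iint \phi(y;\mu,\eta^{-1})\,\phi(\bar x_n;\mu,n^{-1}\eta^{-1})\,\eta\gamma\{\eta s_n;(n-1)d\}\,\pi(\mu,\eta)\,d\mu\,d\eta}{\iint \phi(\bar x_n;\mu,n^{-1}\eta^{-1})\,\eta\gamma\{\eta s_n;(n-1)d\}\,\pi(\mu,\eta)\,d\mu\,d\eta}.$$ The best equivariant predictive density is $\hat p_R(y\mid\bar x_n,s_n)=\frac{\Gamma(nd/2)}{\Gamma\{(n-1)d/2\}}\left(\frac{1}{\pi s_n}\frac{n}{n+1}\right)^{d/2}\left(1+\frac{1}{s_n}\frac{n}{n+1}\|y-\bar x_n\|^2\right)^{-nd/2}$. The Kullback--Leibler risk of a predictive density $\hat p$ is $R_{KL}\{(\mu,\eta),\hat p\}=E_{(\mu,\eta)}[\log\{\phi(y;\mu,\eta^{-1})/\hat p(y\mid\bar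 x_n,s_n)\}]$, the expectation being over $(y,\bar x_n,s_n)$. A predictive density $\hat p$ dominates $\hat p_R$ if $R_{KL}\{(\mu,\eta),\hat p\}\le R_{KL}\{(\mu,\eta),\hat p_R\}$ for all $(\mu,\eta)$, with strict inequality for some $(\mu,\eta)$; $\hat p_R$ is inadmissible if some predictive density dominates it. *)

theory Defs
  imports "HOL-Analysis.Analysis"
begin

definition phi :: "real^'d \<Rightarrow> real^'d \<Rightarrow> real \<Rightarrow> real" where
  "phi x theta tau = (2 * pi * tau) powr (- real CARD('d) / 2)
      * exp (- ((norm (x - theta))^2) / (2 * tau))"

definition chi2 :: "nat \<Rightarrow> real \<Rightarrow> real" where
  "chi2 k t = (if t > 0 then t powr (real k / 2 - 1) * exp (- t / 2)
                  / (2 powr (real k / 2) * Gamma (real k / 2)) else 0)"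

definition bayes_pred ::
  "nat \<Rightarrow> (real^'d \<Rightarrow> real \<Rightarrow> real) \<Rightarrow> real^'d \<Rightarrow> real^'d \<Rightarrow> real \<Rightarrow> real" where
  "bayes_pred n prior y xb s =
     enn2real (\<integral>\<^sup>+ eta \<in> {0<..}. (\<integral>\<^sup>+ mu. ennreal
         (phi y mu (1 / eta) * phi xb mu (1 / (real n * eta))
          * eta * chi2 ((n - 1) * CARD('d)) (eta * s) * prior mu eta) \<partial>lborel) \<partial>lborel)
   / enn2real (\<integral>\<^sup>+ eta \<in> {0<..}. (\<integral>\<^sup>+ mu. ennreal
         (phi xb mu (1 / (real n * eta))
          * eta * chi2 ((n - 1) * CARD('d)) (eta * s) * prior mu eta) \<partial>lborel) \<partial>lborel)"

definition p_R :: "nat \<Rightarrow> real^'d \<Rightarrow> real^'d \<Rightarrow> real \<Rightarrow> real" where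
  "p_R n y xb s =
     Gamma (real n * real CARD('d) / 2) / Gamma ((real n - 1) * real CARD('d) / 2)
     * (1 / (pi * s) * (real n / (real n + 1))) powr (real CARD('d) / 2)
     * (1 + 1 / s * (real n / (real n + 1)) * (norm (y - xb))^2)
         powr (- real n * real CARD('d) / 2)"

definition f_GM :: "nat \<Rightarrow> nat \<Rightarrow> real \<Rightarrow> real \<Rightarrow> real" where
  "f_GM d n nu lam = (1 - lam) powr ((real n - 1) * real d / 2 - 1)
       * (1 - (real n - 1) * lam / real n) powr (- (real n - 2) * real d / 2 - nu)"

definition prior_GM :: "nat \<Rightarrow> real \<Rightarrow> real^'d \<Rightarrow> real \<Rightarrow> real" where
  "prior_GM n nu mu eta =
     (let a = nu - real CARD('d) / 2 - 1 in
      (LBINT lam:{0<..<1}. phi mu 0 ((1 - lam) / (eta * lam))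
          * eta powr a * lam powr a * f_GM CARD('d) n nu lam))"

definition xbar2 :: "real^'d \<Rightarrow> real^'d \<Rightarrow> real^'d" where
  "xbar2 x1 x2 = (1/2) *\<^sub>R (x1 + x2)"

definition ss2 :: "real^'d \<Rightarrow> real^'d \<Rightarrow> real" where
  "ss2 x1 x2 = (norm (x1 - xbar2 x1 x2))^2 + (norm (x2 - xbar2 x1 x2))^2"

definition kl_integrand2 ::
  "(real^'d \<Rightarrow> real^'d \<Rightarrow> real \<Rightarrow> real) \<Rightarrow> real^'d \<Rightarrow> real
     \<Rightarrow> (real^'d) \<times> (real^'d) \<times> (real^'d) \<Rightarrow> real" where
  "kl_integrand2 p mu eta z = (case z of (x1, x2, y) \<Rightarrow>
      phi x1 mu (1 / eta) * phi x2 mu (1 / eta) * phi y mu (1 / eta)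
      * ln (phi y mu (1 / eta) / p y (xbar2 x1 x2) (ss2 x1 x2)))"

definition kl_risk2 ::
  "(real^'d \<Rightarrow> real^'d \<Rightarrow> real \<Rightarrow> real) \<Rightarrow> real^'d \<Rightarrow> real \<Rightarrow> real" where
  "kl_risk2 p mu eta = (\<integral>z. kl_integrand2 p mu eta z \<partial>lborel)"

definition dominates2 ::
  "(real^'d \<Rightarrow> real^'d \<Rightarrow> real \<Rightarrow> real) \<Rightarrow> (real^'d \<Rightarrow> real^'d \<Rightarrow> real \<Rightarrow> real) \<Rightarrow> bool" where
  "dominates2 p q \<longleftrightarrow>
     (\<forall>mu eta. eta > 0 \<longrightarrow>
        integrable lborel (kl_integrand2 p mu eta) \<and>
        integrable lborel (kl_integrand2 q mu eta) \<and>
        kl_risk2 p mu eta \<le> kl_risk2 q mu eta) \<and>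
     (\<exists>mu eta. eta > 0 \<and> kl_risk2 p mu eta < kl_risk2 q mu eta)"

end

theory Submission
  imports Defs "HOL-Probability.Distributions"
begin

text \<open>
  Write $T_2 = |x_1|^2 + |x_2|^2$, $T_3 = T_2 + |y|^2$ and let $S$ be the residual sum of squares of
  the three vectors $x_1, x_2, y$. Integrating out $\mu$ and $\eta$ and applying a Moebius
  substitution to the mixing variable $\lambda$, the ratio of the two predictive densities becomes
  $(3 T_2 / (2 T_3))^\nu$ times the mean, under a Beta$(\nu, d)$ law, of a function that is
  explicit in $\tau = S / T_3$. By Jensen's inequality this mean is at least
  $\exp(0.71 \, \nu \tau / d)$ for small $\nu$, so it suffices that
  $E \log (T_3 / T_2) \le \log (3/2) + (0.705/d) \, E (S / T_3)$ for all $(\mu, \eta)$.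
  With $\delta = \eta |\mu|^2$, the Frullani integral and the Laplace transforms of $T_2$ and $T_3$
  turn both expectations into Laplace transforms in $\delta$ of explicit functions on an interval,
  and the inequality follows because the decreasing weight $e^{-\delta r} (1 - r)^{d-1}$ is integrated
  against a function that dominates a decreasing cubic with positive integral.
\<close>

section \<open>Gaussian, Gamma and Beta integrals\<close>

text \<open>The lower bound for the logarithm of the ratio is linear in \<nu>, so \<nu> divides out
  of the risk comparison, and no limit \<nu> -> 0 uniform in (mu, eta) has to be justified; the size
  of \<nu> matters only for the exponent that Jensen's inequality reaches. To first order in \<nu>,
  a Beta(\<nu>, d) variable v has E(-ln (1 - v)) = \<nu> psi'(d), with psi' the trigamma function,
  which would give the exponent \<nu> \<tau> (d/2) psi'(d). For d = 1 the factor of \<nu> \<tau> is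
  pi^2/12 = 0.822...; the polynomial minorants of -ln (1 - v) used here leave 0.7118 for d = 1 and
  1/2 for d >= 2, in each case at least 0.71/d. The inequality between expectations is proved with
  0.705, and the gap to 0.71 makes the risk strictly smaller at every parameter. The factor (1 -
  \<lambda>/2)^(-\<nu>) of the prior makes the denominator of the predictive density an exact Beta
  integral, so that only the numerator has to be estimated.\<close>

lemma nn_integral_Gamma_scaled:
  fixes p b :: real
  assumes "p > 0" "b > 0"
  shows "(\<integral>\<^sup>+t\<in>{0<..}. ennreal (t powr (p - 1) * exp (- b * t)) \<partial>lborel)
    = ennreal (Gamma p / b powr p)"
proof -
  have "ennreal (Gamma p) = (\<integral>\<^sup>+t. ennreal (indicator {0..} t * t powr (p - 1) / exp t) \<partial>lborel)"
    using Gamma_conv_nn_integral_real[OF assms(1)] by simp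
  also have "\<dots> = ennreal \<bar>b\<bar> *
      (\<integral>\<^sup>+t. ennreal (indicator {0..} (0 + b * t) * (0 + b * t) powr (p - 1) / exp (0 + b * t)) \<partial>lborel)"
    by (rule nn_integral_real_affine) (use assms in auto)
  also have "\<dots> = ennreal b * (\<integral>\<^sup>+t. ennreal (b powr (p - 1)) *
      (ennreal (t powr (p - 1) * exp (- b * t)) * indicator {0<..} t) \<partial>lborel)"
    using assms
    by (intro arg_cong2[where f = "(*)"] nn_integral_cong_AE AE_I[of _ _ "{0}"])
       (auto simp: indicator_def powr_mult exp_minus divide_simps zero_le_mult_iff
          simp flip: ennreal_mult' split: if_splits)
  also have "\<dots> = ennreal (b powr p) *
      (\<integral>\<^sup>+t\<in>{0<..}. ennreal (t powr (p - 1) * exp (- b * t)) \<partial>lborel)"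
    using assms
    by (subst nn_integral_cmult)
       (auto simp flip: mult.assoc ennreal_mult' simp: powr_diff)
  finally have *: "ennreal (Gamma p) = ennreal (b powr p) *
      (\<integral>\<^sup>+t\<in>{0<..}. ennreal (t powr (p - 1) * exp (- b * t)) \<partial>lborel)" .
  have "ennreal (Gamma p / b powr p) = ennreal (Gamma p) * ennreal (1 / b powr p)"
    using assms by (simp flip: ennreal_mult' add: Gamma_real_pos less_imp_le)
  also have "\<dots> = ennreal (b powr p * (1 / b powr p)) *
      (\<integral>\<^sup>+t\<in>{0<..}. ennreal (t powr (p - 1) * exp (- b * t)) \<partial>lborel)"
    unfolding * using assms by (subst ennreal_mult') (simp_all add: ac_simps del: mult_cancel_left)
  finally show ?thesis
    using assms by simp
qed

lemma nn_integral_Beta: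
  fixes a b :: real
  assumes "a > 0" "b > 0"
  shows "(\<integral>\<^sup>+v\<in>{0<..<1}. ennreal (v powr (a - 1) * (1 - v) powr (b - 1)) \<partial>lborel)
    = ennreal (Beta a b)"
proof -
  have "((\<lambda>t. t powr (a - 1) * (1 - t) powr (b - 1)) has_integral Beta a b) {0<..<1}"
    using has_integral_Beta_real[OF assms] by (simp add: has_integral_Icc_iff_Ioo)
  from nn_integral_has_integral_lebesgue[OF _ this]
  show ?thesis
    unfolding nn_integral_set_ennreal by (simp add: mult_ac)
qed

text \<open>\<open>nn_integral_lborel_prod\<close> runs over basis vectors; the \<open>THE\<close>
  in \<open>g\<close> recovers the coordinate \<open>i\<close> from \<open>axis i 1\<close>, so that
  the product can be reindexed by coordinates.\<close>

lemma nn_integral_vec_prod: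
  fixes f :: "'d::finite \<Rightarrow> real \<Rightarrow> ennreal"
  assumes [measurable]: "\<And>i. f i \<in> borel_measurable borel"
  shows "(\<integral>\<^sup>+x. (\<Prod>i\<in>UNIV. f i (x $ i)) \<partial>lborel) = (\<Prod>i\<in>UNIV. \<integral>\<^sup>+t. f i t \<partial>lborel)"
proof -
  define g where "g b = f (THE i. b = axis i 1)" for b :: "real^'d"
  have g: "g (axis i 1) = f i" for i
    unfolding g_def by (simp add: axis_eq_axis)
  have B: "(Basis :: (real^'d) set) = (\<lambda>i. axis i 1) ` UNIV"
    by (auto simp: Basis_vec_def)
  have inj: "inj (\<lambda>i::'d. axis i (1::real))"
    by (auto simp: inj_on_def axis_eq_axis)
  have "(\<integral>\<^sup>+x. (\<Prod>b\<in>Basis. g b (x \<bullet> b)) \<partial>lborel) = (\<Prod>b\<in>Basis. \<integral>\<^sup>+t. g b t \<partial>lborel)"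
    by (rule nn_integral_lborel_prod) (auto simp: B g)
  then show ?thesis
    by (simp add: B prod.reindex[OF inj] g inner_axis)
qed

lemma nn_integral_gauss_real:
  fixes c m :: real
  assumes "c > 0"
  shows "(\<integral>\<^sup>+x. ennreal (exp (- c * (x - m)\<^sup>2)) \<partial>lborel) = ennreal (sqrt (pi / c))"
proof -
  define s where "s = sqrt (1 / (2 * c))"
  have s: "s > 0" "s\<^sup>2 = 1 / (2 * c)" using assms by (auto simp: s_def)
  have "has_bochner_integral lborel (\<lambda>x. normal_density m s x) 1"
    using normal_moment_even[OF s(1), of m 0] by simp
  then have "has_bochner_integral lborel (\<lambda>x. sqrt (pi / c) * normal_density m s x) (sqrt (pi / c) * 1)"
    by (rule has_bochner_integral_mult_right)
  also have "(\<lambda>x. sqrt (pi / c) * normal_density m s x) = (\<lambda>x. exp (- c * (x - m)\<^sup>2))"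
    using assms by (auto simp: normal_density_def s(2) fun_eq_iff)
  finally show ?thesis
    by (subst nn_integral_eq_integral) (auto simp: has_bochner_integral_iff)
qed

lemma nn_integral_gauss_moment_real:
  fixes c m a :: real
  assumes "c > 0"
  shows "(\<integral>\<^sup>+x. ennreal (exp (- c * (x - m)\<^sup>2) * (x - a)\<^sup>2) \<partial>lborel)
    = ennreal (sqrt (pi / c) * (1 / (2 * c) + (m - a)\<^sup>2))"
proof -
  define s where "s = sqrt (1 / (2 * c))"
  have s: "s > 0" "s\<^sup>2 = 1 / (2 * c)" using assms by (auto simp: s_def)
  have 0: "has_bochner_integral lborel (\<lambda>x. normal_density m s x) 1"
    using normal_moment_even[OF s(1), of m 0] by simp
  have 1: "has_bochner_integral lborel (\<lambda>x. normal_density m s x * (x - m)) 0"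
    using normal_moment_odd[OF s(1), of m 0] by simp
  have 2: "has_bochner_integral lborel (\<lambda>x. normal_density m s x * (x - m)\<^sup>2) (1 / (2 * c))"
    using normal_moment_even[OF s(1), of m 1] s by simp
  have "has_bochner_integral lborel (\<lambda>x. sqrt (pi / c) * (normal_density m s x * (x - m)\<^sup>2 +
      (2 * (m - a) * (normal_density m s x * (x - m)) + (m - a)\<^sup>2 * normal_density m s x)))
      (sqrt (pi / c) * (1 / (2 * c) + (2 * (m - a) * 0 + (m - a)\<^sup>2 * 1)))"
    by (intro has_bochner_integral_add has_bochner_integral_mult_right 0 1 2)
  also have "(\<lambda>x. sqrt (pi / c) * (normal_density m s x * (x - m)\<^sup>2 +
      (2 * (m - a) * (normal_density m s x * (x - m)) + (m - a)\<^sup>2 * normal_density m s x)))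
     = (\<lambda>x. (sqrt (pi / c) * normal_density m s x) * (x - a)\<^sup>2)"
    by (auto simp: fun_eq_iff power2_eq_square algebra_simps)
  also have "(\<lambda>x. sqrt (pi / c) * normal_density m s x) = (\<lambda>x. exp (- c * (x - m)\<^sup>2))"
    using assms by (auto simp: normal_density_def s(2) fun_eq_iff)
  finally show ?thesis
    by (subst nn_integral_eq_integral) (auto simp: has_bochner_integral_iff)
qed

lemma norm_vec_power2: "(norm (x :: real^'d))\<^sup>2 = (\<Sum>i\<in>UNIV. (x $ i)\<^sup>2)"
  by (simp add: norm_vec_def L2_set_def sum_nonneg)

lemma nn_integral_gauss_vec:
  fixes m :: "real^'d"
  assumes "c > 0"
  shows "(\<integral>\<^sup>+x. ennreal (exp (- c * (norm (x - m))\<^sup>2)) \<partial>lborel)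
    = ennreal ((pi / c) powr (real CARD('d) / 2))"
proof -
  have "(\<integral>\<^sup>+x. ennreal (exp (- c * (norm (x - m))\<^sup>2)) \<partial>lborel) =
     (\<integral>\<^sup>+x. (\<Prod>i\<in>UNIV. ennreal (exp (- c * (x $ i - m $ i)\<^sup>2))) \<partial>lborel)"
    by (simp add: norm_vec_power2 prod_ennreal sum_distrib_left exp_sum flip: sum_negf)
  also have "\<dots> = (\<Prod>i\<in>(UNIV::'d set). \<integral>\<^sup>+t. ennreal (exp (- c * (t - m $ i)\<^sup>2)) \<partial>lborel)"
    by (rule nn_integral_vec_prod[where f = "\<lambda>i t. ennreal (exp (- c * (t - m $ i)\<^sup>2))"]) simp
  also have "\<dots> = ennreal (sqrt (pi / c) ^ CARD('d))"
    using assms by (simp add: nn_integral_gauss_real[OF assms, simplified] ennreal_power)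
  also have "sqrt (pi / c) ^ CARD('d) = (pi / c) powr (real CARD('d) / 2)"
    using assms by (simp add: powr_half_sqrt[symmetric] powr_powr flip: powr_realpow)
  finally show ?thesis .
qed

text \<open>The squared distance is a sum over coordinates \<open>j\<close>, and each summand keeps
  the product form: the extra square sits in the factor \<open>i = j\<close>, all other factors are
  plain Gaussians.\<close>

lemma nn_integral_gauss_moment_vec:
  fixes m a :: "real^'d"
  assumes "c > 0"
  shows "(\<integral>\<^sup>+x. ennreal (exp (- c * (norm (x - m))\<^sup>2) * (norm (x - a))\<^sup>2) \<partial>lborel)
    = ennreal ((pi / c) powr (real CARD('d) / 2) * (real CARD('d) / (2 * c) + (norm (m - a))\<^sup>2))"
proof -
  define f where "f j i t = ennreal (exp (- c * (t - m $ i)\<^sup>2) * (if i = j then (t - a $ j)\<^sup>2 else 1))"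
    for i j :: 'd and t :: real
  have f: "ennreal (exp (- c * (norm (x - m))\<^sup>2) * (x $ j - a $ j)\<^sup>2) = (\<Prod>i\<in>UNIV. f j i (x $ i))"
    for x j
    by (simp add: f_def norm_vec_power2 prod_ennreal sum_distrib_left exp_sum prod.distrib flip: sum_negf)
  have fi: "(\<integral>\<^sup>+t. f j i t \<partial>lborel) =
      ennreal (sqrt (pi / c) * (if i = j then 1 / (2 * c) + (m $ j - a $ j)\<^sup>2 else 1))" for i j
    using nn_integral_gauss_real[OF assms] nn_integral_gauss_moment_real[OF assms]
    by (cases "i = j") (simp_all add: f_def)
  have "(\<integral>\<^sup>+x. ennreal (exp (- c * (norm (x - m))\<^sup>2) * (norm (x - a))\<^sup>2) \<partial>lborel) =
     (\<integral>\<^sup>+x. (\<Sum>j\<in>UNIV. \<Prod>i\<in>UNIV. f j i (x $ i)) \<partial>lborel)"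
    by (simp add: f[symmetric] norm_vec_power2[of "_ - a"] sum_distrib_left)
  also have "\<dots> = (\<Sum>j\<in>UNIV. \<integral>\<^sup>+x. (\<Prod>i\<in>UNIV. f j i (x $ i)) \<partial>lborel)"
    by (rule nn_integral_sum) (simp add: f_def)
  also have "\<dots> = (\<Sum>j\<in>UNIV. \<Prod>i\<in>UNIV. \<integral>\<^sup>+t. f j i t \<partial>lborel)"
    by (intro sum.cong refl nn_integral_vec_prod) (simp add: f_def)
  also have "\<dots> = (\<Sum>j\<in>UNIV. ennreal (sqrt (pi / c) ^ CARD('d) * (1 / (2 * c) + (m $ j - a $ j)\<^sup>2)))"
    using assms by (simp add: fi prod_ennreal prod.distrib)
  also have "\<dots> = ennreal (sqrt (pi / c) ^ CARD('d) * (real CARD('d) / (2 * c) + (norm (m - a))\<^sup>2))"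
    using assms by (simp add: norm_vec_power2 sum.distrib flip: sum_distrib_left)
  also have "sqrt (pi / c) ^ CARD('d) = (pi / c) powr (real CARD('d) / 2)"
    using assms by (simp add: powr_half_sqrt[symmetric] powr_powr flip: powr_realpow)
  finally show ?thesis .
qed

section \<open>The Laplace transform inequality\<close>

text \<open>
  Chosen so that $1 + r \, P(r) = (1 + \frac{47}{100} r) \, Q(r)$, where
  $Q(r) = 1 - r/3 - r^2/18 - \frac{17}{500} r^3 \le \sqrt{1 - 2r/3}$ on $[0,1]$. The constant $47/100$ is
  barely large enough for $\int_0^1 P \ge 0$, and $141/200 = \frac32 \cdot \frac{47}{100}$ below.
\<close>

definition cubic_minorant :: "real \<Rightarrow> real" where
  "cubic_minorant r = 41/300 - 191/900 * r - (17/500 + 47/1800) * r^2 - 799/50000 * r^3"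

lemma cubic_minorant_antimono:
  "0 \<le> r \<Longrightarrow> r \<le> r' \<Longrightarrow> cubic_minorant r' \<le> cubic_minorant r"
  unfolding cubic_minorant_def
  using power_mono[of r r' 2] power_mono[of r r' 3] by (intro diff_mono mult_left_mono) auto

lemma continuous_cubic_minorant [continuous_intros]: "continuous_on A cubic_minorant"
  unfolding cubic_minorant_def by (intro continuous_intros)

text \<open>Both \<open>w\<close> and the cubic decrease, and the cubic changes sign at
  \<open>r0\<close>. Replacing \<open>w r\<close> by the constant \<open>w r0\<close> can therefore
  only lower the integrand, on either side of \<open>r0\<close>, and what remains is a nonnegative
  multiple of the plain integral of the cubic, which is about 0.0065.\<close>

lemma integral_weighted_cubic_minorant_nonneg:
  fixes w :: "real \<Rightarrow> real"
  assumes w: "continuous_on {0..1} w" "\<And>r. r \<in> {0..1} \<Longrightarrow> 0 \<le> w r"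
    "\<And>r r'. 0 \<le> r \<Longrightarrow> r \<le> r' \<Longrightarrow> r' \<le> 1 \<Longrightarrow> w r' \<le> w r"
  shows "0 \<le> integral {0..1} (\<lambda>r. w r * cubic_minorant r)"
proof -
  have "\<exists>r\<ge>0. r \<le> 1 \<and> cubic_minorant r = 0"
    by (rule IVT2') (auto simp: cubic_minorant_def intro!: continuous_intros)
  then obtain r0 where r0: "0 \<le> r0" "r0 \<le> 1" "cubic_minorant r0 = 0" by blast
  have "((\<lambda>r. cubic_minorant r) has_integral
     ((\<lambda>r. 41/300 * r - 191/1800 * r^2 - (17/500 + 47/1800) * r^3 / 3 - 799/200000 * r^4) 1 -
      (\<lambda>r. 41/300 * r - 191/1800 * r^2 - (17/500 + 47/1800) * r^3 / 3 - 799/200000 * r^4) 0)) {0..1}"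
    by (rule fundamental_theorem_of_calculus)
       (auto simp: cubic_minorant_def simp flip: has_real_derivative_iff_has_vector_derivative
          intro!: derivative_eq_intros)
  then have P: "integral {0..1} cubic_minorant \<ge> 0"
    by (simp add: integral_unique)
  have "0 \<le> w r0 * integral {0..1} cubic_minorant"
    using P w(2) r0 by auto
  also have "\<dots> = integral {0..1} (\<lambda>r. w r0 * cubic_minorant r)"
    by simp
  also have "\<dots> \<le> integral {0..1} (\<lambda>r. w r * cubic_minorant r)"
  proof (intro integral_le integrable_continuous_real)
    fix r :: real assume r: "r \<in> {0..1}"
    show "w r0 * cubic_minorant r \<le> w r * cubic_minorant r"
    proof (cases "r \<le> r0")
      case True
      with r r0 w(3)[of r r0] cubic_minorant_antimono[of r r0] show ?thesis
        by (auto intro!: mult_right_mono)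
    next
      case False
      with r r0 w(3)[of r0 r] cubic_minorant_antimono[of r0 r] show ?thesis
        by (auto intro!: mult_right_mono_neg)
    qed
  qed (use w in \<open>auto intro!: continuous_intros\<close>)
  finally show ?thesis .
qed

text \<open>The Taylor polynomial of the square root, with the cubic coefficient 1/54 raised to
  17/500 so that it absorbs the whole tail of the series. At r = 1 the two sides are 0.5771 and
  0.5774.\<close>

lemma sqrt_minorant:
  fixes r :: real
  assumes "0 \<le> r" "r \<le> 1"
  shows "1 - r/3 - r^2/18 - 17/500 * r^3 \<le> sqrt (1 - 2 * r / 3)"
proof (rule real_le_rsqrt)
  have r: "r^3 * r \<le> r^3" "r^3 * r^2 \<le> r^3" "r^3 * r^3 \<le> r^3"
    using assms by (intro mult_left_le power_le_one zero_le_power; simp)+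
  have "(1 - r/3 - r^2/18 - 17/500 * r^3)^2 = 1 - 2 * r / 3 +
      (1/27 - 17/250) * r^3 + (1/324 + 17/750) * (r^3 * r) + 17/4500 * (r^3 * r^2) + 289/250000 * (r^3 * r^3)"
    by (simp add: power2_eq_square power3_eq_cube field_simps)
  \<comment> \<open>After all higher powers are bounded by r^3, the coefficients of r^3 add up to
    about -0.00028; 17/500 is thus close to the least value that this estimate allows.\<close>
  also have "\<dots> \<le> 1 - 2 * r / 3 +
      (1/27 - 17/250) * r^3 + (1/324 + 17/750) * r^3 + 17/4500 * r^3 + 289/250000 * r^3"
    using r by (intro add_mono[OF add_mono[OF add_mono[OF order.refl]]] mult_left_mono) auto
  also have "\<dots> \<le> 1 - 2 * r / 3"
    using assms by simp
  finally show "(1 - r/3 - r^2/18 - 17/500 * r^3)^2 \<le> 1 - 2 * r / 3" .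
qed

text \<open>With x = 1 - 2r/3, the bound (1 - r)^2 <= x^3 compares (1 - r)^(d-1) with
  (x^(3/2))^(d-1), and x^(3d/2 - 1) is the latter times sqrt x. The dimension thus drops out,
  leaving the case d = 1, which is \<open>sqrt_minorant\<close> multiplied by 1 + 47r/100. The
  argument 2r/3 is the one at which exp(-3\<delta>r/2) becomes exp(-\<delta>r).\<close>

lemma powr_minorant:
  fixes r :: real and d :: nat
  assumes "0 \<le> r" "r \<le> 1" "d > 0"
  shows "(1 - r) ^ (d - 1) * (1 + r * cubic_minorant r)
    \<le> (1 - 2 * r / 3) powr (3 * real d / 2 - 1) * (1 + 47/100 * r)"
proof -
  define x where "x = 1 - 2 * r / 3"
  have x: "x > 0" using assms by (simp add: x_def)
  have "(1 - r)^2 \<le> x ^ 3"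
  proof -
    have "x ^ 3 - (1 - r)^2 = r^2 * (1/3 - 8/27 * r)"
      by (simp add: x_def power2_eq_square power3_eq_cube field_simps)
    moreover have "\<dots> \<ge> 0" using assms by (intro mult_nonneg_nonneg) auto
    ultimately show ?thesis by linarith
  qed
  then have 1: "1 - r \<le> x powr (3/2)"
    using x assms by (auto simp: powr_half_sqrt_powr powr_numeral intro!: real_le_rsqrt)
  have eq: "x powr (3 * real d / 2 - 1) = (x powr (3/2)) ^ (d - 1) * sqrt x"
  proof -
    have "(x powr (3/2)) ^ (d - 1) = x powr (3/2 * (real d - 1))"
      using x assms by (subst powr_realpow[symmetric]) (auto simp: powr_powr of_nat_diff)
    then show ?thesis
      using x by (simp add: powr_half_sqrt[symmetric] powr_add[symmetric] field_simps)
  qed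
  have Q: "(1 - r/3 - r^2/18 - 17/500 * r^3) * (1 + 47/100 * r) = 1 + r * cubic_minorant r"
    by (simp add: cubic_minorant_def power2_eq_square power3_eq_cube field_simps)
  have "(1 - r) ^ (d - 1) * (1 - r/3 - r^2/18 - 17/500 * r^3) \<le> (x powr (3/2)) ^ (d - 1) * sqrt x"
    using 1 sqrt_minorant[of r] assms power_le_one[of r 2] power_le_one[of r 3]
    by (intro mult_mono power_mono) (auto simp: x_def)
  then have "(1 - r) ^ (d - 1) * (1 - r/3 - r^2/18 - 17/500 * r^3) * (1 + 47/100 * r)
      \<le> (x powr (3/2)) ^ (d - 1) * sqrt x * (1 + 47/100 * r)"
    using assms by (intro mult_right_mono) auto
  then show ?thesis
    unfolding Q[symmetric] x_def[symmetric] eq by (simp only: mult.assoc)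
qed

text \<open>Each half of the integrand alone has a singularity 1/r at 0, hence the cutoff. Rescaling
  r to 2r/3 in the half with \<open>B\<close> aligns the exponentials but moves its lower limit to
  3\<epsilon>/2. As in Frullani's integral, the mismatch between \<epsilon> and 3\<epsilon>/2 is
  what produces ln (3/2).\<close>

lemma laplace_log_ratio_cutoff:
  fixes d :: nat and \<delta> \<epsilon> :: real
  assumes d: "d > 0" and \<delta>: "\<delta> \<ge> 0" and \<epsilon>: "0 < \<epsilon>" "\<epsilon> < 1/2"
  defines "B \<equiv> \<lambda>r. (1 - r) powr (3 * real d / 2 - 1) * exp (- 3 * \<delta> * r / 2)"
  shows "integral {\<epsilon>..1} (\<lambda>r. ((1 - r) ^ (d - 1) * exp (- \<delta> * r) - B r) / r)
    \<le> ln (3/2) + 141/200 * integral {0..1} B + \<epsilon>"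
proof -
  define c :: real where "c = 47/100"
  define a where "a r = (1 - r) ^ (d - 1) * exp (- \<delta> * r)" for r :: real
  define b where "b r = B (2 * r / 3)" for r
  have ca: "continuous_on S a" for S unfolding a_def by (intro continuous_intros)
  have cB: "continuous_on S B" if "S \<subseteq> {..1}" for S unfolding B_def 
    using d that by (intro continuous_on_mult continuous_on_powr' continuous_intros) (auto simp: field_simps)
  have cb: "continuous_on S b" if "S \<subseteq> {..3/2}" for S unfolding b_def
    using that by (intro continuous_on_compose2[OF cB[of "{..1}"]] continuous_intros) auto
  have b01: "0 \<le> b r" "b r \<le> 1" if "0 \<le> r" "r \<le> 3/2" for r
    using that \<delta> d by (auto simp: b_def B_def intro!: mult_le_one powr_le1)
  have img: "(\<lambda>x. x * 3 / 2) ` {u..v} = {u * 3 / 2..v * 3 / 2}" for u v :: real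
    by (auto simp: image_iff) (rule_tac x = "x * 2 / 3" in bexI; simp)
  have Bsub: "((\<lambda>r. (b r / r)) has_integral (integral {\<epsilon>..1} (\<lambda>r. B r / r))) {3/2 * \<epsilon>..3/2}"
  proof -
    have "((\<lambda>r. B r / r) has_integral integral {\<epsilon>..1} (\<lambda>r. B r / r)) (cbox \<epsilon> 1)"
      using \<epsilon> by (auto intro!: integrable_integral integrable_continuous_real continuous_intros cB)
    from has_integral_affinity[OF this, of "2/3" 0] \<epsilon>
    have "((\<lambda>r. b r / r * (3/2)) has_integral (3/2 * integral {\<epsilon>..1} (\<lambda>r. B r / r))) {3/2 * \<epsilon>..3/2}"
      by (simp add: b_def field_simps img)
    from has_integral_mult_left[OF this, of "2/3"] show ?thesis by simp
  qed
  have Bsub0: "integral {0..3/2} b = 3/2 * integral {0..1} B"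
  proof -
    have "(B has_integral integral {0..1} B) (cbox 0 1)"
      by (auto intro!: integrable_integral integrable_continuous_real continuous_intros cB)
    from has_integral_affinity[OF this, of "2/3" 0] 
    have "(b has_integral (3/2 * integral {0..1} B)) {0..3/2}"
      by (simp add: b_def[abs_def] img[of 0 1, simplified] mult.commute[of 3])
    then show ?thesis by (rule integral_unique)
  qed
  have ib: "(\<lambda>r. b r / r) integrable_on {x..y}" if "0 < x" "y \<le> 3/2" for x y
    using that by (auto intro!: integrable_continuous_real continuous_intros cb)
  have ibb: "b integrable_on {x..y}" if "y \<le> 3/2" for x y
    using that by (auto intro!: integrable_continuous_real continuous_intros cb)
  have ia: "(\<lambda>r. a r / r) integrable_on {\<epsilon>..1}"
    using \<epsilon> by (auto intro!: integrable_continuous_real continuous_intros ca)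
  have iB: "(\<lambda>r. B r / r) integrable_on {\<epsilon>..1}"
    using \<epsilon> by (auto intro!: integrable_continuous_real continuous_intros cB)
  have small: "integral {\<epsilon>..3/2 * \<epsilon>} (\<lambda>r. b r / r) \<le> ln (3/2)"
  proof -
    have "((\<lambda>r. 1 / r) has_integral (ln (3/2 * \<epsilon>) - ln \<epsilon>)) {\<epsilon>..3/2 * \<epsilon>}"
      using \<epsilon> by (intro fundamental_theorem_of_calculus)
        (auto simp flip: has_real_derivative_iff_has_vector_derivative intro!: derivative_eq_intros)
    moreover have "integral {\<epsilon>..3/2 * \<epsilon>} (\<lambda>r. b r / r) \<le> integral {\<epsilon>..3/2 * \<epsilon>} (\<lambda>r. 1 / r)"
      using \<epsilon> calculation
      by (intro integral_le ib) (auto intro!: divide_right_mono b01 simp: has_integral_integrable)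
    ultimately show ?thesis
      using \<epsilon> by (simp add: integral_unique ln_mult ln_div)
  qed
  have split1: "integral {\<epsilon>..3/2 * \<epsilon>} (\<lambda>r. b r / r) + integral {3/2 * \<epsilon>..3/2} (\<lambda>r. b r / r)
      = integral {\<epsilon>..3/2} (\<lambda>r. b r / r)"
    using \<epsilon> by (intro Henstock_Kurzweil_Integration.integral_combine ib) auto
  have split2: "integral {\<epsilon>..1} (\<lambda>r. b r / r) + integral {1..3/2} (\<lambda>r. b r / r)
      = integral {\<epsilon>..3/2} (\<lambda>r. b r / r)"
    using \<epsilon> by (intro Henstock_Kurzweil_Integration.integral_combine ib) auto
  have split3: "integral {0..\<epsilon>} b + integral {\<epsilon>..3/2} b = integral {0..3/2} b"
    using \<epsilon> by (intro Henstock_Kurzweil_Integration.integral_combine ibb) auto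
  have split4: "integral {\<epsilon>..1} b + integral {1..3/2} b = integral {\<epsilon>..3/2} b"
    using \<epsilon> by (intro Henstock_Kurzweil_Integration.integral_combine ibb) auto
  have split5: "integral {0..\<epsilon>} (\<lambda>r. a r * cubic_minorant r) + integral {\<epsilon>..1} (\<lambda>r. a r * cubic_minorant r)
      = integral {0..1} (\<lambda>r. a r * cubic_minorant r)"
    using \<epsilon> by (intro Henstock_Kurzweil_Integration.integral_combine integrable_continuous_real
        continuous_intros ca) auto
  have pos: "integral {0..1} (\<lambda>r. a r * cubic_minorant r) \<ge> 0"
    using \<delta> by (intro integral_weighted_cubic_minorant_nonneg ca)
      (auto simp: a_def intro!: mult_mono power_mono mult_left_mono)
  \<comment> \<open>Nonnegativity is known on all of [0, 1], while the comparison runs over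
    [\<epsilon>, 1]; the missing piece costs the summand \<epsilon> of the claim.\<close>
  have "integral {0..\<epsilon>} (\<lambda>r. a r * cubic_minorant r) \<le> integral {0..\<epsilon>} (\<lambda>r. 1)"
  proof (intro integral_le integrable_continuous_real continuous_intros ca)
    fix r assume r: "r \<in> {0..\<epsilon>}"
    have "cubic_minorant r \<le> 1"
      using cubic_minorant_antimono[of 0 r] r by (simp add: cubic_minorant_def)
    moreover have "0 \<le> a r" "a r \<le> 1"
      using r \<epsilon> \<delta> by (auto simp: a_def intro!: mult_le_one power_le_one)
    ultimately show "a r * cubic_minorant r \<le> 1"
      by (meson mult_left_le order_trans)
  qed
  then have small2: "integral {0..\<epsilon>} (\<lambda>r. a r * cubic_minorant r) \<le> \<epsilon>"
    using \<epsilon> by simp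
  have le1: "integral {\<epsilon>..1} (\<lambda>r. a r / r) \<le>
      integral {\<epsilon>..1} (\<lambda>r. b r / r + c * b r - a r * cubic_minorant r)"
  proof (intro integral_le ia)
    show "(\<lambda>r. b r / r + c * b r - a r * cubic_minorant r) integrable_on {\<epsilon>..1}"
      using \<epsilon> by (intro integrable_continuous_real continuous_intros ca cb) auto
    fix r assume r: "r \<in> {\<epsilon>..1}"
    then have r': "0 < r" "r \<le> 1" using \<epsilon> by auto
    have "(1 - r) ^ (d - 1) * (1 + r * cubic_minorant r) * exp (- \<delta> * r)
      \<le> (1 - 2 * r / 3) powr (3 * real d / 2 - 1) * (1 + 47/100 * r) * exp (- \<delta> * r)"
      using r' d by (intro mult_right_mono powr_minorant) auto
    then have "a r * (1 + r * cubic_minorant r) \<le> b r * (1 + c * r)"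
      by (simp add: a_def b_def B_def c_def mult_ac)
    then show "a r / r \<le> b r / r + c * b r - a r * cubic_minorant r"
      using r' by (simp add: field_simps)
  qed
  also have "\<dots> = integral {\<epsilon>..1} (\<lambda>r. b r / r) + c * integral {\<epsilon>..1} b
      - integral {\<epsilon>..1} (\<lambda>r. a r * cubic_minorant r)"
  proof -
    have "(\<lambda>r. a r * cubic_minorant r) integrable_on {\<epsilon>..1}"
      by (intro integrable_continuous_real continuous_intros ca)
    moreover have "(\<lambda>r. c * b r) integrable_on {\<epsilon>..1}"
      using integrable_on_cmult_left[OF ibb[of 1 \<epsilon>], of c] by simp
    ultimately show ?thesis
      using \<epsilon> ib[of \<epsilon> 1] by (simp add: integral_diff integral_add integrable_add)
  qed
  finally have main: "integral {\<epsilon>..1} (\<lambda>r. a r / r) \<le> integral {\<epsilon>..1} (\<lambda>r. b r / r)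
      + c * integral {\<epsilon>..1} b + \<epsilon>"
    using split5 pos small2 by linarith
  \<comment> \<open>The rescaled range of \<open>B\<close> reaches up to 3/2. The part of b(r)/r
    beyond 1 enters with a favourable sign and is dropped; the part of b beyond 1 is added to
    complete the integral to that of \<open>B\<close> over [0, 1].\<close>
  have nn: "integral {1..3/2} (\<lambda>r. b r / r) \<ge> 0" "integral {1..3/2} b \<ge> 0" "integral {0..\<epsilon>} b \<ge> 0"
    using \<epsilon> b01 by (auto intro!: integral_nonneg ib ibb divide_nonneg_nonneg)
  have "c * integral {\<epsilon>..1} b \<le> c * integral {0..3/2} b"
    using split3 split4 nn by (intro mult_left_mono) (auto simp: c_def)
  also have "\<dots> = 141/200 * integral {0..1} B"
    by (simp add: Bsub0 c_def)
  finally have cb2: "c * integral {\<epsilon>..1} b \<le> 141/200 * integral {0..1} B" .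
  have "integral {\<epsilon>..1} (\<lambda>r. (a r - B r) / r) = integral {\<epsilon>..1} (\<lambda>r. a r / r) - integral {\<epsilon>..1} (\<lambda>r. B r / r)"
    using ia iB by (simp add: diff_divide_distrib integral_diff)
  also have "integral {\<epsilon>..1} (\<lambda>r. B r / r) = integral {3/2 * \<epsilon>..3/2} (\<lambda>r. b r / r)"
    using Bsub by (simp add: integral_unique)
  also have "integral {\<epsilon>..1} (\<lambda>r. a r / r) - integral {3/2 * \<epsilon>..3/2} (\<lambda>r. b r / r)
     \<le> ln (3/2) + 141/200 * integral {0..1} B + \<epsilon>"
    using main cb2 split1 split2 nn small by linarith
  finally show ?thesis by (simp add: a_def)
qed

text \<open>Monotone convergence as the cutoff tends to 0. The integrand must be nonnegative, since
  \<open>ennreal\<close> would truncate it otherwise; it is, because 3d/2 - 1 >= d - 1 and the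
  exponential in \<open>B\<close> decays faster.\<close>

lemma laplace_log_ratio_bound:
  fixes d :: nat and \<delta> :: real
  assumes d: "d > 0" and \<delta>: "\<delta> \<ge> 0" 
  defines "B \<equiv> \<lambda>r. (1 - r) powr (3 * real d / 2 - 1) * exp (- 3 * \<delta> * r / 2)"
  shows "(\<integral>\<^sup>+r\<in>{0<..<1}. ennreal (((1 - r) ^ (d - 1) * exp (- \<delta> * r) - B r) / r) \<partial>lborel)
    \<le> ennreal (ln (3/2)) + ennreal (141/200) * (\<integral>\<^sup>+r\<in>{0<..<1}. ennreal (B r) \<partial>lborel)"
proof -
  define f where "f r = ((1 - r) ^ (d - 1) * exp (- \<delta> * r) - B r) / r" for r
  have cB: "continuous_on S B" if "S \<subseteq> {..1}" for S unfolding B_def 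
    using d that by (intro continuous_on_mult continuous_on_powr' continuous_intros) (auto simp: field_simps)
  have B0: "B r \<ge> 0" for r by (simp add: B_def)
  have "(B has_integral integral {0..1} B) {0..1}"
    by (auto intro!: integrable_integral integrable_continuous_real continuous_intros cB)
  then have "(B has_integral integral {0..1} B) {0<..<1}"
    by (simp add: has_integral_Icc_iff_Ioo)
  from nn_integral_has_integral_lebesgue[OF _ this]
  have nB: "(\<integral>\<^sup>+r\<in>{0<..<1}. ennreal (B r) \<partial>lborel) = ennreal (integral {0..1} B)"
    unfolding nn_integral_set_ennreal by (simp add: B0 mult_ac)
  have iB: "integral {0..1} B \<ge> 0" by (intro integral_nonneg integrable_continuous_real cB) (auto simp: B0)
  have f0: "f r \<ge> 0" if "0 < r" "r \<le> 1" for r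
  proof -
    have "B r \<le> (1 - r) ^ (d - 1) * exp (- \<delta> * r)"
    \<comment> \<open>At r = 1 and d = 1 the conversion between \<open>powr\<close> and
      \<open>^\<close> fails, since \<open>0 powr 0\<close> is 0 and \<open>0 ^ 0\<close> is 1; but
      \<open>B 1\<close> is 0 there.\<close>
    proof (cases "r = 1")
      case False
      have "B r \<le> (1 - r) powr (real (d - 1)) * exp (- \<delta> * r)"
        unfolding B_def using that False \<delta> d
        by (intro mult_mono powr_mono') (auto simp: of_nat_diff field_simps)
      then show ?thesis using that False by (simp add: powr_realpow)
    qed (simp add: B_def)
    then show ?thesis using that by (simp add: f_def)
  qed
  have [measurable]: "f \<in> borel_measurable borel" unfolding f_def B_def by measurable
  define e :: "nat \<Rightarrow> real" where "e n = 1 / (real n + 3)" for n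
  have e: "0 < e n" "e n < 1/2" for n by (auto simp: e_def field_simps)
  have bound: "(\<integral>\<^sup>+r. ennreal (f r) * indicator {e n..1} r \<partial>lborel)
      \<le> ennreal (ln (3/2) + 141/200 * integral {0..1} B + e n)" for n
  proof -
    have "(f has_integral integral {e n..1} f) {e n..1}"
      using e[of n] unfolding f_def
      by (intro integrable_integral integrable_continuous_real continuous_intros cB) auto
    from nn_integral_has_integral_lebesgue[OF _ this]
    have "(\<integral>\<^sup>+r. ennreal (f r) * indicator {e n..1} r \<partial>lborel) = ennreal (integral {e n..1} f)"
      unfolding nn_integral_set_ennreal using e[of n] f0 by (simp add: mult_ac)
    also have "\<dots> \<le> ennreal (ln (3/2) + 141/200 * integral {0..1} B + e n)"
      using laplace_log_ratio_cutoff[OF d \<delta> e[of n]] by (intro ennreal_leI) (simp add: f_def[abs_def] B_def)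
    finally show ?thesis .
  qed
  have "(\<lambda>n. \<integral>\<^sup>+r. ennreal (f r) * indicator {e n..1} r \<partial>lborel) \<longlonglongrightarrow>
      (\<integral>\<^sup>+r. ennreal (f r) * indicator {0<..1} r \<partial>lborel)"
  proof (rule nn_integral_LIMSEQ)
    show "incseq (\<lambda>n r. ennreal (f r) * indicator {e n..1} r)"
      by (auto simp: incseq_def le_fun_def e_def indicator_def intro!: divide_left_mono)
         (smt (verit) frac_le of_nat_0_le_iff of_nat_mono)
    show "(\<lambda>n. ennreal (f r) * indicator {e n..1} r) \<longlonglongrightarrow> ennreal (f r) * indicator {0<..1} r" for r
    proof (cases "0 < r")
      case True
      have "e \<longlonglongrightarrow> 0" unfolding e_def by real_asymp
      then have "eventually (\<lambda>n. e n < r) sequentially" using True by (simp add: order_tendstoD)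
      then have "eventually (\<lambda>n. ennreal (f r) * indicator {0<..1} r = ennreal (f r) * indicator {e n..1} r) sequentially"
        by eventually_elim (use True in \<open>auto simp: indicator_def\<close>)
      then show ?thesis by (rule Lim_transform_eventually[OF tendsto_const])
    next
      case False
      then have "ennreal (f r) * indicator {e n..1} r = ennreal (f r) * indicator {0<..1} r" for n
        using e(1)[of n] by (auto simp: indicator_def)
      then show ?thesis by simp
    qed
  qed simp
  moreover have "(\<lambda>n. ennreal (ln (3/2) + 141/200 * integral {0..1} B + e n)) \<longlonglongrightarrow>
      ennreal (ln (3/2) + 141/200 * integral {0..1} B + 0)"
    unfolding e_def by (intro tendsto_ennrealI tendsto_add tendsto_const) real_asymp
  ultimately have "(\<integral>\<^sup>+r. ennreal (f r) * indicator {0<..1} r \<partial>lborel)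
      \<le> ennreal (ln (3/2) + 141/200 * integral {0..1} B + 0)"
    using bound by (intro LIMSEQ_le) auto
  also have "\<dots> = ennreal (ln (3/2)) + ennreal (141/200) * (\<integral>\<^sup>+r\<in>{0<..<1}. ennreal (B r) \<partial>lborel)"
    unfolding nB using iB by (subst ennreal_mult'[symmetric]) (simp_all add: ennreal_plus)
  finally have "(\<integral>\<^sup>+r. ennreal (f r) * indicator {0<..1} r \<partial>lborel) \<le> \<dots>" .
  moreover have "(\<integral>\<^sup>+r. ennreal (f r) * indicator {0<..<1} r \<partial>lborel) \<le>
     (\<integral>\<^sup>+r. ennreal (f r) * indicator {0<..1} r \<partial>lborel)"
    by (intro nn_integral_mono) (auto simp: indicator_def)
  ultimately show ?thesis by (simp add: f_def)
qed

section \<open>Marginalizing the prior\<close>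

text \<open>The part of the prior's integrand that depends on neither \<open>mu\<close> nor
  \<open>eta\<close>. The exponent -1 of 1 - l arises as -d/2 from the normal density plus d/2 - 1
  from \<open>f_GM\<close>; it is not integrable at l = 1, so the prior is finite only through the
  exponential factor in |mu|^2.\<close>

definition gm_kernel :: "nat \<Rightarrow> real \<Rightarrow> real \<Rightarrow> real" where
  "gm_kernel d \<nu> l = (2 * pi) powr (- real d / 2) * l powr (\<nu> - 1) * (1 - l) powr (-1) * (1 - l / 2) powr (- \<nu>)"

lemma gm_kernel_measurable [measurable]: "gm_kernel d \<nu> \<in> borel_measurable borel"
  unfolding gm_kernel_def by measurable

lemma gm_kernel_nonneg: "0 \<le> gm_kernel d \<nu> l"
  by (simp add: gm_kernel_def)

lemma prior_GM_integrand:
  fixes mu :: "real^'d"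
  assumes "eta > 0" "0 < l" "l < 1"
  shows "phi mu 0 ((1 - l) / (eta * l)) * eta powr (nu - real CARD('d) / 2 - 1)
      * l powr (nu - real CARD('d) / 2 - 1) * f_GM CARD('d) 2 nu l
    = gm_kernel CARD('d) nu l * eta powr (nu - 1) * exp (- (eta / 2) * (l / (1 - l) * (norm mu)\<^sup>2))"
  using assms
  by (simp add: phi_def f_GM_def gm_kernel_def powr_def ln_mult ln_div flip: exp_add)
     (simp add: field_simps)

text \<open>\<open>prior_GM\<close> is a Bochner integral, which has the default value 0 when the
  integrand is not integrable, as happens at mu = 0. For mu \<noteq> 0 the exponential is at most (1
  - l)/c and cancels the pole of \<open>gm_kernel\<close>, so a Beta(\<nu>, 1) integrand dominates
  and both kinds of integral agree.\<close>

lemma prior_GM_eq_nn_integral: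
  fixes mu :: "real^'d"
  assumes nu: "nu > 0" and eta: "eta > 0" and mu: "mu \<noteq> 0"
  shows "ennreal (prior_GM 2 nu mu eta) = (\<integral>\<^sup>+l\<in>{0<..<1}. ennreal (gm_kernel CARD('d) nu l
    * eta powr (nu - 1) * exp (- (eta / 2) * (l / (1 - l) * (norm mu)\<^sup>2))) \<partial>lborel)"
proof -
  define g where "g l = gm_kernel CARD('d) nu l
    * eta powr (nu - 1) * exp (- (eta / 2) * (l / (1 - l) * (norm mu)\<^sup>2))" for l
  have [measurable]: "g \<in> borel_measurable borel" unfolding g_def by measurable
  have g0: "g l \<ge> 0" for l by (simp add: g_def gm_kernel_nonneg)
  \<comment> \<open>The cap at 1 ensures 1 - l + c l >= c, which is what bounds the exponential by
    (1 - l)/c.\<close>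
  define c where "c = min 1 (eta / 2 * (norm mu)\<^sup>2)"
  have c: "c > 0" "c \<le> 1" using eta mu by (auto simp: c_def)
  define C where "C = (2 * pi) powr (- real CARD('d) / 2) * eta powr (nu - 1) * 2 powr nu / c"
  have C: "C \<ge> 0" using c by (simp add: C_def)
  have bound: "g l \<le> C * (l powr (nu - 1) * (1 - l) powr (1 - 1))" if "0 < l" "l < 1" for l
  proof -
    have "exp (- (eta / 2) * (l / (1 - l) * (norm mu)\<^sup>2)) \<le> exp (- (c * l / (1 - l)))"
    proof -
      have "c * (l / (1 - l)) \<le> (eta / 2 * (norm mu)\<^sup>2) * (l / (1 - l))"
        using that by (intro mult_right_mono) (auto simp: c_def)
      then show ?thesis by (simp add: algebra_simps)
    qed
    also have "\<dots> \<le> 1 / (1 + c * l / (1 - l))"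
      using that c exp_ge_add_one_self[of "c * l / (1 - l)"]
      by (auto simp: exp_minus divide_simps add_pos_nonneg mult.commute)
    also have "\<dots> \<le> (1 - l) / c"
    proof -
      have "c \<le> 1 - l + c * l"
        using that c mult_left_mono[of c 1 "1 - l"] by (simp add: algebra_simps)
      then show ?thesis
        using that c divide_left_mono[of c "1 - l + c * l" "1 - l"]
        by (simp add: divide_simps add_pos_pos split: if_splits)
    qed
    finally have 1: "exp (- (eta / 2) * (l / (1 - l) * (norm mu)\<^sup>2)) \<le> (1 - l) / c" .
    have 2: "(1 - l / 2) powr (- nu) \<le> 2 powr nu"
      using that nu powr_mono2[of nu "1 / (1 - l/2)" 2]
      by (simp add: powr_minus powr_divide divide_simps)
    have "g l = ((2 * pi) powr (- real CARD('d) / 2) * eta powr (nu - 1) * l powr (nu - 1))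
       * ((1 - l) powr (-1) * ((1 - l / 2) powr (- nu) * exp (- (eta / 2) * (l / (1 - l) * (norm mu)\<^sup>2))))"
      by (simp add: g_def gm_kernel_def mult_ac)
    also have "\<dots> \<le> ((2 * pi) powr (- real CARD('d) / 2) * eta powr (nu - 1) * l powr (nu - 1))
       * ((1 - l) powr (-1) * (2 powr nu * ((1 - l) / c)))"
      using 1 2 that by (intro mult_left_mono mult_mono) auto
    also have "\<dots> = C * (l powr (nu - 1) * (1 - l) powr (1 - 1))"
      using that c by (simp add: C_def powr_minus divide_simps)
    finally show ?thesis .
  qed
  have "(\<integral>\<^sup>+l. ennreal (indicator {0<..<1} l * g l) \<partial>lborel)
      \<le> (\<integral>\<^sup>+l. ennreal C * (ennreal (l powr (nu - 1) * (1 - l) powr (1 - 1)) * indicator {0<..<1} l) \<partial>lborel)"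
    using C bound by (intro nn_integral_mono) (auto simp: indicator_def simp flip: ennreal_mult'
       intro!: ennreal_leI)
  also have "\<dots> = ennreal C * ennreal (Beta nu 1)"
    using nn_integral_Beta[of nu 1] nu by (subst nn_integral_cmult) auto
  also have "\<dots> < \<infinity>" by (simp add: ennreal_mult_less_top)
  finally have fin: "(\<integral>\<^sup>+l. ennreal (indicator {0<..<1} l * g l) \<partial>lborel) < \<infinity>" .
  have "integrable lborel (\<lambda>l. indicator {0<..<1} l * g l)"
    by (rule integrableI_nonneg) (use fin g0 in auto)
  then have "(\<integral>\<^sup>+l. ennreal (indicator {0<..<1} l * g l) \<partial>lborel)
    = ennreal (\<integral>l. indicator {0<..<1} l * g l \<partial>lborel)"
    using g0 by (intro nn_integral_eq_integral) auto
  moreover have "prior_GM 2 nu mu eta = (\<integral>l. indicator {0<..<1} l * g l \<partial>lborel)"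
    unfolding prior_GM_def Let_def set_lebesgue_integral_def
  proof (intro Bochner_Integration.integral_cong refl)
    fix l :: real
    show "indicator {0<..<1} l *\<^sub>R (phi mu 0 ((1 - l) / (eta * l)) * eta powr (nu - real CARD('d) / 2 - 1)
      * l powr (nu - real CARD('d) / 2 - 1) * f_GM CARD('d) 2 nu l) = indicator {0<..<1} l * g l"
      using prior_GM_integrand[OF eta, of l mu nu] by (auto simp: indicator_def g_def)
  qed
  ultimately show ?thesis
    unfolding nn_integral_set_ennreal by (simp add: g_def mult.commute[of "indicator _ _"])
qed

section \<open>Integrating out the mean, the precision and the scale of the mixing variable\<close>

lemma prior_GM_measurable [measurable]:
  "(\<lambda>(mu, eta). prior_GM n nu (mu :: real^'d) eta) \<in> borel_measurable (borel \<Otimes>\<^sub>M borel)"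
  unfolding prior_GM_def Let_def set_lebesgue_integral_def phi_def f_GM_def by measurable

lemma norm_diff_square_complete:
  fixes x z :: "'a::real_inner"
  assumes "m + k \<noteq> 0"
  shows "m * (norm (x - z))\<^sup>2 + k * (norm x)\<^sup>2
    = (m + k) * (norm (x - (m / (m + k)) *\<^sub>R z))\<^sup>2 + m * k / (m + k) * (norm z)\<^sup>2"
proof -
  define t c where "t = m + k" and "c = m / (m + k)"
  have mk: "m = t * c" "k = t * (1 - c)" and t: "t \<noteq> 0"
    using assms by (auto simp: c_def t_def field_simps)
  have "m * k / t = t * c * (1 - c)"
    using t by (simp add: mk)
  moreover have "m * (norm (x - z))\<^sup>2 + k * (norm x)\<^sup>2
      = t * (norm (x - c *\<^sub>R z))\<^sup>2 + t * c * (1 - c) * (norm z)\<^sup>2"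
    unfolding mk power2_norm_eq_inner
    by (simp add: inner_diff inner_commute[of z x] algebra_simps)
  ultimately show ?thesis
    by (simp add: t_def c_def)
qed

lemma nn_integral_two_gauss_vec:
  fixes z :: "real^'d"
  assumes "m > 0" "k \<ge> 0" "eta > 0"
  shows "(\<integral>\<^sup>+x. ennreal (exp (- (eta / 2) * (m * (norm (x - z))\<^sup>2 + k * (norm x)\<^sup>2))) \<partial>lborel)
    = ennreal ((2 * pi / (eta * (m + k))) powr (real CARD('d) / 2)
        * exp (- (eta / 2) * (m * k / (m + k) * (norm z)\<^sup>2)))"
proof -
  have mk: "m + k \<noteq> 0" using assms by simp
  have e: "exp (- (eta / 2) * ((m + k) * N + C)) = exp (- (eta / 2) * C) * exp (- (eta / 2 * (m + k)) * N)" for N C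
    by (simp add: field_simps flip: exp_add)
  have "(\<integral>\<^sup>+x. ennreal (exp (- (eta / 2) * (m * (norm (x - z))\<^sup>2 + k * (norm x)\<^sup>2))) \<partial>lborel)
     = (\<integral>\<^sup>+x. ennreal (exp (- (eta / 2) * (m * k / (m + k) * (norm z)\<^sup>2))) *
        ennreal (exp (- (eta / 2 * (m + k)) * (norm (x - (m / (m + k)) *\<^sub>R z))\<^sup>2)) \<partial>lborel)"
    unfolding norm_diff_square_complete[OF mk] e by (simp add: ennreal_mult')
  also have "\<dots> = ennreal (exp (- (eta / 2) * (m * k / (m + k) * (norm z)\<^sup>2))) *
      ennreal ((pi / (eta / 2 * (m + k))) powr (real CARD('d) / 2))"
    using assms by (subst nn_integral_cmult, simp) (subst nn_integral_gauss_vec, simp_all)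
  finally show ?thesis
    by (simp flip: ennreal_mult' add: mult_ac)
qed

text \<open>In the applications \<open>m\<close> counts the vectors (2 in the denominator of the
  predictive density, 3 in the numerator), \<open>z\<close> is their mean and \<open>A\<close> their
  residual sum of squares. By Tonelli's theorem the integral over \<open>mu\<close> becomes Gaussian
  with relative precision \<open>m + l / (1 - l)\<close>, and the one over \<open>eta\<close> a
  Gamma integral of shape \<open>P\<close>.\<close>

lemma marginal_GM:
  fixes z :: "real^'d"
  assumes nu: "nu > 0" and m: "m \<ge> 1" and A: "A > 0" and P: "P = p + nu - real CARD('d) / 2" "P > 0"
  shows "(\<integral>\<^sup>+eta\<in>{0<..}. (\<integral>\<^sup>+mu. ennreal (eta powr p * exp (- (eta / 2) * (m * (norm (mu - z))\<^sup>2 + A))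
      * prior_GM 2 nu mu eta) \<partial>lborel) \<partial>lborel)
    = ennreal (Gamma P * 2 powr P) * (\<integral>\<^sup>+l\<in>{0<..<1}. ennreal (l powr (nu - 1) * (1 - l) powr (real CARD('d) / 2 - 1)
      * (1 - l / 2) powr (- nu) * (m - (m - 1) * l) powr (- real CARD('d) / 2)
      * (A + m * l / (m - (m - 1) * l) * (norm z)\<^sup>2) powr (- P)) \<partial>lborel)" (is "?L = ?R")
proof -
  define q where "q = real CARD('d) / 2"
  define k :: "real \<Rightarrow> real" where "k l = l / (1 - l)" for l
  define E where "E l = m * k l / (m + k l) * (norm z)\<^sup>2 + A" for l
  have k: "k l > 0" if "0 < l" "l < 1" for l using that by (simp add: k_def)
  have E: "E l > 0" if "0 < l" "l < 1" for l
    using that k[OF that] m A by (simp add: E_def add_nonneg_pos)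
  have [measurable]: "k \<in> borel_measurable borel" "E \<in> borel_measurable borel"
    unfolding k_def E_def by measurable
  have inner: "(\<integral>\<^sup>+mu. ennreal (eta powr p * exp (- (eta / 2) * (m * (norm (mu - z))\<^sup>2 + A))
      * prior_GM 2 nu mu eta) \<partial>lborel)
    = (\<integral>\<^sup>+l\<in>{0<..<1}. ennreal (gm_kernel CARD('d) nu l * eta powr (p + nu - 1) * exp (- (eta / 2) * A)
        * (2 * pi / (eta * (m + k l))) powr q * exp (- (eta / 2) * (m * k l / (m + k l) * (norm z)\<^sup>2))) \<partial>lborel)"
    if eta: "eta > 0" for eta
  proof -
    define w where "w l = gm_kernel CARD('d) nu l * eta powr (p + nu - 1) * exp (- (eta / 2) * A)" for l
    have w: "w l \<ge> 0" for l by (simp add: w_def gm_kernel_nonneg)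
    have [measurable]: "w \<in> borel_measurable borel" unfolding w_def by measurable
    have "(\<integral>\<^sup>+mu. ennreal (eta powr p * exp (- (eta / 2) * (m * (norm (mu - z))\<^sup>2 + A))
        * prior_GM 2 nu mu eta) \<partial>lborel)
      = (\<integral>\<^sup>+mu. (\<integral>\<^sup>+l. ennreal (w l * exp (- (eta / 2) * (m * (norm (mu - z))\<^sup>2 + k l * (norm mu)\<^sup>2)))
          * indicator {0<..<1} l \<partial>lborel) \<partial>lborel)"
    \<comment> \<open>The nonnegative integral form of the prior is available for mu \<noteq> 0,
      that is, outside a null set.\<close>
    proof (intro nn_integral_cong_AE eventually_mono[OF AE_lborel_singleton[of 0]])
      fix mu :: "real^'d" assume mu: "mu \<noteq> 0"
      define h where "h = eta powr p * exp (- (eta / 2) * (m * (norm (mu - z))\<^sup>2 + A))"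
      have h: "h \<ge> 0" by (simp add: h_def)
      have "ennreal (h * prior_GM 2 nu mu eta) = ennreal h * ennreal (prior_GM 2 nu mu eta)"
        using h by (rule ennreal_mult')
      also have "\<dots> = (\<integral>\<^sup>+l. ennreal h * (ennreal (gm_kernel CARD('d) nu l
          * eta powr (nu - 1) * exp (- (eta / 2) * (l / (1 - l) * (norm mu)\<^sup>2))) * indicator {0<..<1} l) \<partial>lborel)"
        unfolding prior_GM_eq_nn_integral[OF nu eta mu] by (rule nn_integral_cmult[symmetric]) measurable
      also have "\<dots> = (\<integral>\<^sup>+l. ennreal (w l * exp (- (eta / 2) * (m * (norm (mu - z))\<^sup>2 + k l * (norm mu)\<^sup>2)))
          * indicator {0<..<1} l \<partial>lborel)"
      proof (intro nn_integral_cong)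
        fix l :: real
        have "h * (gm_kernel CARD('d) nu l * eta powr (nu - 1) * exp (- (eta / 2) * (k l * (norm mu)\<^sup>2)))
          = w l * exp (- (eta / 2) * (m * (norm (mu - z))\<^sup>2 + k l * (norm mu)\<^sup>2))"
          using eta by (simp add: h_def w_def powr_add powr_diff exp_add[symmetric] mult_ac)
            (simp add: algebra_simps exp_add[symmetric] exp_diff exp_minus divide_simps)
        then show "ennreal h * (ennreal (gm_kernel CARD('d) nu l
            * eta powr (nu - 1) * exp (- (eta / 2) * (l / (1 - l) * (norm mu)\<^sup>2))) * indicator {0<..<1} l)
          = ennreal (w l * exp (- (eta / 2) * (m * (norm (mu - z))\<^sup>2 + k l * (norm mu)\<^sup>2))) * indicator {0<..<1} l"
          unfolding k_def[symmetric] using h by (simp flip: mult.assoc ennreal_mult')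
      qed
      finally show "ennreal (eta powr p * exp (- (eta / 2) * (m * (norm (mu - z))\<^sup>2 + A)) * prior_GM 2 nu mu eta)
        = (\<integral>\<^sup>+l. ennreal (w l * exp (- (eta / 2) * (m * (norm (mu - z))\<^sup>2 + k l * (norm mu)\<^sup>2)))
          * indicator {0<..<1} l \<partial>lborel)"
        by (simp add: h_def)
    qed
    also have "\<dots> = (\<integral>\<^sup>+l. (\<integral>\<^sup>+mu. ennreal (w l * exp (- (eta / 2) * (m * (norm (mu - z))\<^sup>2 + k l * (norm mu)\<^sup>2)))
          * indicator {0<..<1} l \<partial>lborel) \<partial>lborel)"
      by (rule lborel_pair.Fubini') measurable
    also have "\<dots> = (\<integral>\<^sup>+l\<in>{0<..<1}. ennreal (w l
        * (2 * pi / (eta * (m + k l))) powr q * exp (- (eta / 2) * (m * k l / (m + k l) * (norm z)\<^sup>2))) \<partial>lborel)"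
    proof (intro nn_integral_cong)
      fix l :: real
      show "(\<integral>\<^sup>+mu. ennreal (w l * exp (- (eta / 2) * (m * (norm (mu - z))\<^sup>2 + k l * (norm mu)\<^sup>2)))
          * indicator {0<..<1} l \<partial>lborel) = ennreal (w l
        * (2 * pi / (eta * (m + k l))) powr q * exp (- (eta / 2) * (m * k l / (m + k l) * (norm z)\<^sup>2))) * indicator {0<..<1} l"
      proof (cases "0 < l \<and> l < 1")
        case True
        have "(\<integral>\<^sup>+mu. ennreal (w l * exp (- (eta / 2) * (m * (norm (mu - z))\<^sup>2 + k l * (norm mu)\<^sup>2))) \<partial>lborel)
          = (\<integral>\<^sup>+mu. ennreal (w l) * ennreal (exp (- (eta / 2) * (m * (norm (mu - z))\<^sup>2 + k l * (norm mu)\<^sup>2))) \<partial>lborel)"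
          using w by (intro nn_integral_cong ennreal_mult') auto
        also have "\<dots> = ennreal (w l) * ennreal ((2 * pi / (eta * (m + k l))) powr q
            * exp (- (eta / 2) * (m * k l / (m + k l) * (norm z)\<^sup>2)))"
          unfolding q_def using m k[of l] eta True
          by (subst nn_integral_cmult, measurable) (subst nn_integral_two_gauss_vec, auto)
        finally show ?thesis using True w by (simp flip: ennreal_mult' add: mult.assoc)
      qed auto
    qed
    finally show ?thesis unfolding w_def .
  qed
  have "?L = (\<integral>\<^sup>+eta. (\<integral>\<^sup>+l. ennreal (gm_kernel CARD('d) nu l * eta powr (p + nu - 1) * exp (- (eta / 2) * A)
        * (2 * pi / (eta * (m + k l))) powr q * exp (- (eta / 2) * (m * k l / (m + k l) * (norm z)\<^sup>2)))
        * indicator {0<..<1} l * indicator {0<..} eta \<partial>lborel) \<partial>lborel)"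
    proof (intro nn_integral_cong)
    fix eta :: real
    show "(\<integral>\<^sup>+mu. ennreal (eta powr p * exp (- (eta / 2) * (m * (norm (mu - z))\<^sup>2 + A))
        * prior_GM 2 nu mu eta) \<partial>lborel) * indicator {0<..} eta =
      (\<integral>\<^sup>+l. ennreal (gm_kernel CARD('d) nu l * eta powr (p + nu - 1) * exp (- (eta / 2) * A)
        * (2 * pi / (eta * (m + k l))) powr q * exp (- (eta / 2) * (m * k l / (m + k l) * (norm z)\<^sup>2)))
        * indicator {0<..<1} l * indicator {0<..} eta \<partial>lborel)"
      by (cases "eta > 0") (simp_all only: inner, simp_all)
  qed
  also have "\<dots> = (\<integral>\<^sup>+l. (\<integral>\<^sup>+eta. ennreal (gm_kernel CARD('d) nu l * eta powr (p + nu - 1) * exp (- (eta / 2) * A)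
        * (2 * pi / (eta * (m + k l))) powr q * exp (- (eta / 2) * (m * k l / (m + k l) * (norm z)\<^sup>2)))
        * indicator {0<..<1} l * indicator {0<..} eta \<partial>lborel) \<partial>lborel)"
    by (rule lborel_pair.Fubini') measurable
  also have "\<dots> = (\<integral>\<^sup>+l. ennreal (Gamma P * 2 powr P) * (ennreal (l powr (nu - 1) * (1 - l) powr (real CARD('d) / 2 - 1)
      * (1 - l / 2) powr (- nu) * (m - (m - 1) * l) powr (- real CARD('d) / 2)
      * (A + m * l / (m - (m - 1) * l) * (norm z)\<^sup>2) powr (- P)) * indicator {0<..<1} l) \<partial>lborel)"
  proof (intro nn_integral_cong)
    fix l :: real
    show "(\<integral>\<^sup>+eta. ennreal (gm_kernel CARD('d) nu l * eta powr (p + nu - 1) * exp (- (eta / 2) * A)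
        * (2 * pi / (eta * (m + k l))) powr q * exp (- (eta / 2) * (m * k l / (m + k l) * (norm z)\<^sup>2)))
        * indicator {0<..<1} l * indicator {0<..} eta \<partial>lborel) =
      ennreal (Gamma P * 2 powr P) * (ennreal (l powr (nu - 1) * (1 - l) powr (real CARD('d) / 2 - 1)
      * (1 - l / 2) powr (- nu) * (m - (m - 1) * l) powr (- real CARD('d) / 2)
      * (A + m * l / (m - (m - 1) * l) * (norm z)\<^sup>2) powr (- P)) * indicator {0<..<1} l)"
    proof (cases "0 < l \<and> l < 1")
      case True
      then have l: "0 < l" "l < 1" by auto
      define w where "w = gm_kernel CARD('d) nu l * (2 * pi / (m + k l)) powr q"
      have w: "w \<ge> 0" by (simp add: w_def gm_kernel_nonneg)
      have mk: "m + k l > 0" using m k[OF l] by simp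
      have "(\<integral>\<^sup>+eta. ennreal (gm_kernel CARD('d) nu l * eta powr (p + nu - 1) * exp (- (eta / 2) * A)
          * (2 * pi / (eta * (m + k l))) powr q * exp (- (eta / 2) * (m * k l / (m + k l) * (norm z)\<^sup>2)))
          * indicator {0<..<1} l * indicator {0<..} eta \<partial>lborel)
        = (\<integral>\<^sup>+eta. ennreal w * (ennreal (eta powr (P - 1) * exp (- (E l / 2) * eta)) * indicator {0<..} eta) \<partial>lborel)"
      proof (intro nn_integral_cong)
        fix eta :: real
        have "gm_kernel CARD('d) nu l * eta powr (p + nu - 1) * exp (- (eta / 2) * A)
          * (2 * pi / (eta * (m + k l))) powr q * exp (- (eta / 2) * (m * k l / (m + k l) * (norm z)\<^sup>2))
          = w * (eta powr (P - 1) * exp (- (E l / 2) * eta))" if "eta > 0"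
        proof -
          have e0: "exp (- (eta / 2) * A) * exp (- (eta / 2) * Y) = exp (- ((Y + A) / 2) * eta)" for Y
            by (simp add: field_simps flip: exp_add)
          have e: "exp (- (eta / 2) * A) * exp (- (eta / 2) * (m * k l / (m + k l) * (norm z)\<^sup>2)) = exp (- (E l / 2) * eta)"
            unfolding E_def by (rule e0)
          have "eta powr (p + nu - 1) * (2 * pi / (eta * (m + k l))) powr q
            = (2 * pi / (m + k l)) powr q * eta powr (P - 1)"
            using that mk by (simp add: P q_def powr_divide powr_mult powr_diff powr_add mult_ac)
          with e have "gm_kernel CARD('d) nu l * (eta powr (p + nu - 1) * (2 * pi / (eta * (m + k l))) powr q)
             * (exp (- (eta / 2) * A) * exp (- (eta / 2) * (m * k l / (m + k l) * (norm z)\<^sup>2)))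
            = w * (eta powr (P - 1) * exp (- (E l / 2) * eta))"
            unfolding w_def by (simp only:)
          then show ?thesis by (simp only: mult_ac)
        qed
        then show "ennreal (gm_kernel CARD('d) nu l * eta powr (p + nu - 1) * exp (- (eta / 2) * A)
          * (2 * pi / (eta * (m + k l))) powr q * exp (- (eta / 2) * (m * k l / (m + k l) * (norm z)\<^sup>2)))
          * indicator {0<..<1} l * indicator {0<..} eta =
          ennreal w * (ennreal (eta powr (P - 1) * exp (- (E l / 2) * eta)) * indicator {0<..} eta)"
          using l w by (auto simp: indicator_def simp flip: ennreal_mult')
      qed
      also have "\<dots> = ennreal w * ennreal (Gamma P / (E l / 2) powr P)"
        using P E[OF l] by (subst nn_integral_cmult, measurable) (subst nn_integral_Gamma_scaled, auto)
      also have "\<dots> = ennreal (w * (Gamma P / (E l / 2) powr P))"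
        using w by (rule ennreal_mult'[symmetric])
      also have "w * (Gamma P / (E l / 2) powr P) = (Gamma P * 2 powr P) * (l powr (nu - 1) * (1 - l) powr (real CARD('d) / 2 - 1)
        * (1 - l / 2) powr (- nu) * (m - (m - 1) * l) powr (- real CARD('d) / 2)
        * (A + m * l / (m - (m - 1) * l) * (norm z)\<^sup>2) powr (- P))"
      proof -
        have M: "m - (m - 1) * l > 0"
        proof -
          have "(m - 1) * l \<le> (m - 1) * 1" using m l by (intro mult_left_mono) auto
          then show ?thesis by simp
        qed
        \<comment> \<open>Raised to the power -d/2, this quotient contributes (1 - l)^(d/2), which
          turns the pole of \<open>gm_kernel\<close> at l = 1 into the integrable (1 - l)^(d/2 -
          1).\<close>
        have mk2: "m + k l = (m - (m - 1) * l) / (1 - l)"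
          using l by (simp add: k_def field_simps)
        have "m * k l / (m + k l) = m * l / (m - (m - 1) * l)"
          unfolding mk2 using l M by (simp add: k_def)
        then have El: "E l = A + m * l / (m - (m - 1) * l) * (norm z)\<^sup>2" by (simp add: E_def)
        have "w = l powr (nu - 1) * (1 - l) powr (q - 1) * (1 - l / 2) powr (- nu) * (m - (m - 1) * l) powr (- q)"
        proof -
          define M' where "M' = m - (m - 1) * l"
          have "M' > 0" using M by (simp add: M'_def)
          then show ?thesis
            unfolding w_def gm_kernel_def mk2 M'_def[symmetric] q_def using l
            by (simp add: powr_def ln_mult ln_div flip: exp_add) (simp add: field_simps)
        qed
        then show ?thesis
          unfolding El[symmetric] using E[OF l]
          by (simp add: powr_divide powr_minus q_def divide_simps)
      qed
      also have "ennreal \<dots> = ennreal (Gamma P * 2 powr P) * ennreal (l powr (nu - 1) * (1 - l) powr (real CARD('d) / 2 - 1)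
        * (1 - l / 2) powr (- nu) * (m - (m - 1) * l) powr (- real CARD('d) / 2)
        * (A + m * l / (m - (m - 1) * l) * (norm z)\<^sup>2) powr (- P))"
        using P by (intro ennreal_mult') (auto simp: Gamma_real_pos less_imp_le)
      finally show ?thesis using l by simp
    qed auto
  qed
  also have "\<dots> = ?R"
    by (rule nn_integral_cmult) measurable
  finally show ?thesis .
qed

text \<open>The substitution multiplies odds by a constant: l/(1 - l) = \<theta> v/(1 - v). It is an
  increasing bijection of the unit interval.\<close>

lemma nn_integral_moebius:
  fixes h :: "real \<Rightarrow> real"
  assumes [measurable]: "h \<in> borel_measurable borel" and \<theta>: "\<theta> > 0"
  shows "(\<integral>\<^sup>+l\<in>{0<..<1}. ennreal (h l) \<partial>lborel)
    = (\<integral>\<^sup>+v\<in>{0<..<1}. ennreal (h (\<theta> * v / (1 - v + \<theta> * v)) * (\<theta> / (1 - v + \<theta> * v)\<^sup>2)) \<partial>lborel)"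
proof -
  define g where "g v = \<theta> * v / (1 - v + \<theta> * v)" for v
  define g' where "g' v = \<theta> / (1 - v + \<theta> * v)\<^sup>2" for v
  have pos: "1 - v + \<theta> * v > 0" if "v \<in> {0..1}" for v
    using that \<theta> by (cases "v = 1") (auto intro!: add_pos_nonneg)
  have g01: "g v \<in> {0<..<1} \<longleftrightarrow> v \<in> {0<..<1}" if "v \<in> {0..1}" for v
    using pos[OF that] that \<theta> by (auto simp: g_def divide_less_eq zero_less_divide_iff zero_less_mult_iff)
  have "(\<integral>\<^sup>+l\<in>{0<..<1}. ennreal (h l) \<partial>lborel) =
     (\<integral>\<^sup>+l. ennreal (indicator {0<..<1} l * h l * indicator {g 0..g 1} l) \<partial>lborel)"
    using \<theta> by (intro nn_integral_cong) (auto simp: indicator_def g_def)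
  also have "\<dots> = (\<integral>\<^sup>+v. ennreal (indicator {0<..<1} (g v) * h (g v) * g' v * indicator {0..1} v) \<partial>lborel)"
  proof (rule nn_integral_substitution)
    show "set_borel_measurable borel {g 0..g 1} (\<lambda>l. indicator {0<..<1} l * h l)"
      unfolding set_borel_measurable_def by measurable
    show "(g has_real_derivative g' v) (at v)" if "v \<in> {0..1}" for v
      unfolding g_def g'_def using pos[OF that]
      by (auto intro!: derivative_eq_intros simp: field_simps power2_eq_square)
    show "continuous_on {0..1} g'"
      unfolding g'_def using pos by (intro continuous_intros) fastforce
    show "0 \<le> g' v" for v using \<theta> by (simp add: g'_def)
  qed simp
  also have "\<dots> = (\<integral>\<^sup>+v\<in>{0<..<1}. ennreal (h (g v) * g' v) \<partial>lborel)"
    using g01 by (intro nn_integral_cong) (auto simp: indicator_def)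
  finally show ?thesis by (simp add: g_def g'_def)
qed

text \<open>The choice \<theta> = m\<tau> turns the factor that contains z into A/F with F = 1 - v +
  \<tau>v. The powers of the common denominator D = 1 - v + \<theta>v have exponents 1 - \<nu>, 1 -
  d/2, \<nu>, d/2 and, from the Jacobian, -2; they cancel. Inside the integral there remains a Beta
  weight free of the data, times a function of \<tau> and v.\<close>

lemma marginal_GM_mixing:
  fixes z :: "real^'d"
  assumes nu: "nu > 0" and m: "m \<ge> 1" and A: "A > 0" and P: "P = p + nu - real CARD('d) / 2" "P > 0"
  defines "\<tau> \<equiv> A / (A + m * (norm z)\<^sup>2)"
  shows "(\<integral>\<^sup>+eta\<in>{0<..}. (\<integral>\<^sup>+mu. ennreal (eta powr p * exp (- (eta / 2) * (m * (norm (mu - z))\<^sup>2 + A))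
      * prior_GM 2 nu mu eta) \<partial>lborel) \<partial>lborel)
    = ennreal (Gamma P * 2 powr P * (m * \<tau>) powr nu * m powr (- real CARD('d) / 2) * A powr (- P)) *
      (\<integral>\<^sup>+v\<in>{0<..<1}. ennreal (v powr (nu - 1) * (1 - v) powr (real CARD('d) / 2 - 1)
        * (1 - v + m * \<tau> * v / 2) powr (- nu) * (1 - v + \<tau> * v) powr (P - real CARD('d) / 2)) \<partial>lborel)"
proof -
  define q where "q = real CARD('d) / 2"
  define \<theta> where "\<theta> = m * \<tau>"
  have den: "A + m * (norm z)\<^sup>2 > 0" using A m by (simp add: add_pos_nonneg)
  have \<tau>: "\<tau> > 0" "\<theta> > 0" using A den m by (auto simp: \<tau>_def \<theta>_def)
  have z: "m * (norm z)\<^sup>2 = A / \<tau> - A" using A den by (simp add: \<tau>_def)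
  define h where "h l = l powr (nu - 1) * (1 - l) powr (q - 1)
      * (1 - l / 2) powr (- nu) * (m - (m - 1) * l) powr (- q)
      * (A + m * l / (m - (m - 1) * l) * (norm z)\<^sup>2) powr (- P)" for l
  have [measurable]: "h \<in> borel_measurable borel" unfolding h_def by measurable
  have h: "h (\<theta> * v / (1 - v + \<theta> * v)) * (\<theta> / (1 - v + \<theta> * v)\<^sup>2) =
     (\<theta> powr nu * m powr (- q) * A powr (- P)) *
     (v powr (nu - 1) * (1 - v) powr (q - 1) * (1 - v + \<theta> * v / 2) powr (- nu) * (1 - v + \<tau> * v) powr (P - q))"
    if v: "0 < v" "v < 1" for v
  proof -
    define D where "D = 1 - v + \<theta> * v"
    define F where "F = 1 - v + \<tau> * v"
    define H where "H = 1 - v + \<theta> * v / 2"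
    have pos: "D > 0" "F > 0" "H > 0" "1 - v > 0" using v \<tau> by (auto simp: D_def F_def H_def add_pos_pos)
    have 1: "1 - \<theta> * v / D = (1 - v) / D" using pos by (simp add: D_def field_simps)
    have 2: "1 - \<theta> * v / D / 2 = H / D" using pos by (simp add: D_def H_def field_simps)
    have 3: "m - (m - 1) * (\<theta> * v / D) = m * F / D"
      using pos by (simp add: divide_simps) (simp add: D_def F_def \<theta>_def algebra_simps)
    have "A + m * (\<theta> * v / D) / (m * F / D) * (norm z)\<^sup>2 = A + (m * (norm z)\<^sup>2) * (\<tau> * v / F)"
      using pos m by (simp add: \<theta>_def)
    also have "\<dots> = A / F"
      unfolding z using pos \<tau> by (simp add: divide_simps) (simp add: F_def algebra_simps)
    finally have 4: "A + m * (\<theta> * v / D) / (m * F / D) * (norm z)\<^sup>2 = A / F" .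
    have dd: "\<theta> / D\<^sup>2 = exp (ln \<theta> - 2 * ln D)"
      using pos \<tau> by (simp add: exp_diff exp_double)
    show ?thesis
      unfolding D_def[symmetric] F_def[symmetric] H_def[symmetric] h_def 1 2 3 4 dd
      using pos \<tau> m A v
      by (simp add: powr_def ln_mult ln_div flip: exp_add) (simp add: algebra_simps)
  qed
  have "(\<integral>\<^sup>+eta\<in>{0<..}. (\<integral>\<^sup>+mu. ennreal (eta powr p * exp (- (eta / 2) * (m * (norm (mu - z))\<^sup>2 + A))
      * prior_GM 2 nu mu eta) \<partial>lborel) \<partial>lborel)
    = ennreal (Gamma P * 2 powr P) * (\<integral>\<^sup>+l\<in>{0<..<1}. ennreal (h l) \<partial>lborel)"
    unfolding h_def q_def using marginal_GM[OF nu m A P, of z] by simp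
  also have "(\<integral>\<^sup>+l\<in>{0<..<1}. ennreal (h l) \<partial>lborel) = 
    (\<integral>\<^sup>+v. ennreal (\<theta> powr nu * m powr (- q) * A powr (- P)) *
     (ennreal (v powr (nu - 1) * (1 - v) powr (q - 1) * (1 - v + \<theta> * v / 2) powr (- nu) * (1 - v + \<tau> * v) powr (P - q))
       * indicator {0<..<1} v) \<partial>lborel)"
  proof (subst nn_integral_moebius[OF _ \<tau>(2)], measurable, intro nn_integral_cong)
    fix v :: real
    show "ennreal (h (\<theta> * v / (1 - v + \<theta> * v)) * (\<theta> / (1 - v + \<theta> * v)\<^sup>2)) * indicator {0<..<1} v =
      ennreal (\<theta> powr nu * m powr (- q) * A powr (- P)) *
     (ennreal (v powr (nu - 1) * (1 - v) powr (q - 1) * (1 - v + \<theta> * v / 2) powr (- nu) * (1 - v + \<tau> * v) powr (P - q))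
       * indicator {0<..<1} v)"
    proof (cases "0 < v \<and> v < 1")
      case True
      then show ?thesis
        by (subst h) (auto simp flip: ennreal_mult')
    qed auto
  qed
  also have "\<dots> = ennreal (\<theta> powr nu * m powr (- q) * A powr (- P)) *
    (\<integral>\<^sup>+v\<in>{0<..<1}. ennreal (v powr (nu - 1) * (1 - v) powr (q - 1) * (1 - v + \<theta> * v / 2) powr (- nu) * (1 - v + \<tau> * v) powr (P - q)) \<partial>lborel)"
    by (rule nn_integral_cmult) measurable
  also have "ennreal (Gamma P * 2 powr P) * (ennreal (\<theta> powr nu * m powr (- q) * A powr (- P)) * X) =
     ennreal (Gamma P * 2 powr P * \<theta> powr nu * m powr (- q) * A powr (- P)) * X" for X
    using P by (subst mult.assoc[symmetric], subst ennreal_mult'[symmetric])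
      (auto simp: Gamma_real_pos less_imp_le mult_ac)
  finally show ?thesis by (simp add: q_def \<theta>_def)
qed

section \<open>The Bayesian predictive density relative to the equivariant one\<close>

definition mixing_integral :: "nat \<Rightarrow> real \<Rightarrow> real \<Rightarrow> ennreal" where
  "mixing_integral d \<nu> \<tau> = (\<integral>\<^sup>+v\<in>{0<..<1}. ennreal (v powr (\<nu> - 1) * (1 - v) powr (real d / 2 - 1)
      * (1 - v + 3 * \<tau> * v / 2) powr (- \<nu>) * (1 - v + \<tau> * v) powr (real d / 2 + \<nu>)) \<partial>lborel)"

text \<open>For m = 2 the factor 1 - v + m\<tau>v/2 equals 1 - v + \<tau>v, and its exponents -\<nu>
  and \<nu> cancel, so the denominator is exactly Beta(\<nu>, d/2). For m = 3 they do not cancel,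
  and \<open>mixing_integral\<close> is what is left of the numerator.\<close>

lemma bayes_pred_GM:
  fixes y xb :: "real^'d"
  assumes nu: "nu > 0" and s: "s > 0"
  defines "T2 \<equiv> s + 2 * (norm xb)\<^sup>2" and "T3 \<equiv> s + 2 * (norm xb)\<^sup>2 + (norm y)\<^sup>2"
    and "S \<equiv> s + 2/3 * (norm (y - xb))\<^sup>2"
  shows "bayes_pred 2 (prior_GM 2 nu) y xb s
    = p_R 2 y xb s * ((3 * T2 / (2 * T3)) powr nu * enn2real (mixing_integral CARD('d) nu (S / T3))
        / Beta nu (real CARD('d)))"
proof -
  define d where "d = real CARD('d)"
  have d: "d > 0" by (simp add: d_def)
  define K2 where "K2 = pi powr (- d / 2) * s powr (d / 2 - 1) / (2 powr (d / 2) * Gamma (d / 2))"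
  define K3 where "K3 = (2 * pi) powr (- d / 2) * K2"
  have G: "Gamma x > 0" if "x > 0" for x :: real using that by (rule Gamma_real_pos)
  have K: "K2 > 0" "K3 > 0" using G[of "d/2"] d s by (auto simp: K2_def K3_def)
  \<comment> \<open>When \<open>xb\<close> and \<open>s\<close> are the mean and the residual sum of
    squares of two vectors, \<open>z\<close> and \<open>S\<close> are those of the two vectors
    together with \<open>y\<close>.\<close>
  define z where "z = (1/3) *\<^sub>R (y + 2 *\<^sub>R xb)"
  have S: "S > 0" using s by (simp add: S_def add_pos_nonneg)
  have T: "T2 > 0" "T3 > 0" using s by (auto simp: T2_def T3_def add_pos_nonneg)
  have zT: "S + 3 * (norm z)\<^sup>2 = T3"
    unfolding S_def z_def T3_def power2_norm_eq_inner by (simp add: inner_commute algebra_simps) (simp add: field_simps)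
  have quad: "(norm (y - mu))\<^sup>2 + 2 * (norm (xb - mu))\<^sup>2 + s = 3 * (norm (mu - z))\<^sup>2 + S" for mu
    unfolding S_def z_def power2_norm_eq_inner by (simp add: inner_commute algebra_simps) (simp add: field_simps)
  have lik2: "phi xb mu (1 / (real 2 * eta)) * eta * chi2 ((2 - 1) * CARD('d)) (eta * s)
      = K2 * (eta powr d * exp (- (eta / 2) * (2 * (norm (mu - xb))\<^sup>2 + s)))" if eta: "eta > 0" for mu eta
  proof -
    have "phi xb mu (1 / (real 2 * eta)) = pi powr (- d / 2) * eta powr (d / 2) * exp (- (eta / 2) * (2 * (norm (mu - xb))\<^sup>2))"
      using eta by (simp add: phi_def norm_minus_commute[of mu] powr_divide powr_minus divide_simps flip: d_def)
    moreover have "eta * chi2 ((2 - 1) * CARD('d)) (eta * s)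
        = eta powr (d / 2) * s powr (d / 2 - 1) / (2 powr (d / 2) * Gamma (d / 2)) * exp (- (eta / 2) * s)"
      using eta s by (simp add: chi2_def powr_mult powr_diff flip: d_def)
    ultimately have "phi xb mu (1 / (real 2 * eta)) * (eta * chi2 ((2 - 1) * CARD('d)) (eta * s))
      = K2 * ((eta powr (d / 2) * eta powr (d / 2)) * (exp (- (eta / 2) * (2 * (norm (mu - xb))\<^sup>2)) * exp (- (eta / 2) * s)))"
      by (simp add: K2_def)
    also have "\<dots> = K2 * (eta powr d * exp (- (eta / 2) * (2 * (norm (mu - xb))\<^sup>2 + s)))"
      unfolding powr_add[symmetric] exp_add[symmetric] by (simp add: algebra_simps)
    finally show ?thesis by (simp only: mult.assoc)
  qed
  have lik3: "phi y mu (1 / eta) * phi xb mu (1 / (real 2 * eta)) * eta * chi2 ((2 - 1) * CARD('d)) (eta * s)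
      = K3 * (eta powr (3 * d / 2) * exp (- (eta / 2) * (3 * (norm (mu - z))\<^sup>2 + S)))" if eta: "eta > 0" for mu eta
  proof -
    have "phi y mu (1 / eta) * phi xb mu (1 / (real 2 * eta)) * eta * chi2 ((2 - 1) * CARD('d)) (eta * s)
      = phi y mu (1 / eta) * (K2 * (eta powr d * exp (- (eta / 2) * (2 * (norm (mu - xb))\<^sup>2 + s))))"
      using lik2[OF eta, of mu] by (simp only: mult.assoc)
    also have "\<dots> = K3 * (eta powr (3 * d / 2) * exp (- (eta / 2) * ((norm (y - mu))\<^sup>2 + 2 * (norm (xb - mu))\<^sup>2 + s)))"
    proof -
      have "phi y mu (1 / eta) = (2 * pi) powr (- d / 2) * eta powr (d / 2) * exp (- (eta / 2) * (norm (y - mu))\<^sup>2)"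
        using eta by (simp add: phi_def powr_divide powr_mult powr_minus divide_simps flip: d_def)
      then have "phi y mu (1 / eta) * (K2 * (eta powr d * exp (- (eta / 2) * (2 * (norm (mu - xb))\<^sup>2 + s))))
        = K3 * ((eta powr (d / 2) * eta powr d) * (exp (- (eta / 2) * (norm (y - mu))\<^sup>2)
            * exp (- (eta / 2) * (2 * (norm (mu - xb))\<^sup>2 + s))))"
        by (simp only: K3_def mult_ac)
      then show ?thesis
        unfolding powr_add[symmetric] exp_add[symmetric] 
        by (simp add: algebra_simps norm_minus_commute[of mu])
    qed
    finally show ?thesis unfolding quad .
  qed
  have pull: "(\<integral>\<^sup>+eta\<in>{0<..}. (\<integral>\<^sup>+mu. ennreal (L mu eta * prior_GM 2 nu mu eta) \<partial>lborel) \<partial>lborel)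
      = ennreal K * (\<integral>\<^sup>+eta\<in>{0<..}. (\<integral>\<^sup>+mu. ennreal (G mu eta * prior_GM 2 nu mu eta) \<partial>lborel) \<partial>lborel)"
    if "K \<ge> 0" "\<And>mu eta. eta > 0 \<Longrightarrow> L mu eta = K * G mu eta"
      and [measurable]: "(\<lambda>(mu, eta). G mu eta) \<in> borel_measurable (borel \<Otimes>\<^sub>M borel)"
    for K :: real and L G :: "real^'d \<Rightarrow> real \<Rightarrow> real"
  proof -
    have "(\<integral>\<^sup>+mu. ennreal (L mu eta * prior_GM 2 nu mu eta) \<partial>lborel) * indicator {0<..} eta
        = ennreal K * ((\<integral>\<^sup>+mu. ennreal (G mu eta * prior_GM 2 nu mu eta) \<partial>lborel) * indicator {0<..} eta)" for eta
    proof (cases "eta > 0")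
      case True
      have "(\<integral>\<^sup>+mu. ennreal (L mu eta * prior_GM 2 nu mu eta) \<partial>lborel)
        = (\<integral>\<^sup>+mu. ennreal K * ennreal (G mu eta * prior_GM 2 nu mu eta) \<partial>lborel)"
        using that(1) by (simp add: that(2)[OF True] mult.assoc ennreal_mult')
      also have "\<dots> = ennreal K * (\<integral>\<^sup>+mu. ennreal (G mu eta * prior_GM 2 nu mu eta) \<partial>lborel)"
        by (rule nn_integral_cmult) measurable
      finally show ?thesis using True by simp
    qed simp
    then show ?thesis
      by (simp only:) (rule nn_integral_cmult, measurable)
  qed
  have den: "(\<integral>\<^sup>+eta\<in>{0<..}. (\<integral>\<^sup>+mu. ennreal (phi xb mu (1 / (real 2 * eta)) * eta * chi2 ((2 - 1) * CARD('d)) (eta * s)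
      * prior_GM 2 nu mu eta) \<partial>lborel) \<partial>lborel)
    = ennreal K2 * (ennreal (Gamma (d / 2 + nu) * 2 powr (d / 2 + nu) * (2 * (s / T2)) powr nu * 2 powr (- d / 2) * s powr (- (d / 2 + nu)))
      * ennreal (Beta nu (d / 2)))"
  proof -
    have "(\<integral>\<^sup>+eta\<in>{0<..}. (\<integral>\<^sup>+mu. ennreal (phi xb mu (1 / (real 2 * eta)) * eta * chi2 ((2 - 1) * CARD('d)) (eta * s)
        * prior_GM 2 nu mu eta) \<partial>lborel) \<partial>lborel)
      = ennreal K2 * (\<integral>\<^sup>+eta\<in>{0<..}. (\<integral>\<^sup>+mu. ennreal (eta powr d * exp (- (eta / 2) * (2 * (norm (mu - xb))\<^sup>2 + s))
        * prior_GM 2 nu mu eta) \<partial>lborel) \<partial>lborel)"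
      by (rule pull[OF less_imp_le[OF K(1)]]) (rule lik2, assumption, measurable)
    also have "\<dots> = ennreal K2 * (ennreal (Gamma (d / 2 + nu) * 2 powr (d / 2 + nu) * (2 * (s / T2)) powr nu * 2 powr (- d / 2) * s powr (- (d / 2 + nu)))
      * (\<integral>\<^sup>+v\<in>{0<..<1}. ennreal (v powr (nu - 1) * (1 - v) powr (d / 2 - 1)
        * (1 - v + 2 * (s / T2) * v / 2) powr (- nu) * (1 - v + s / T2 * v) powr (d / 2 + nu - d / 2)) \<partial>lborel))"
      using marginal_GM_mixing[OF nu _ s, of 2 "d / 2 + nu" d xb] nu d by (simp add: d_def T2_def)
    \<comment> \<open>Here \<open>P - d / 2\<close> is \<nu>, so the two remaining powers of the
      same base are inverse to each other.\<close>
    also have "(\<integral>\<^sup>+v\<in>{0<..<1}. ennreal (v powr (nu - 1) * (1 - v) powr (d / 2 - 1)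
        * (1 - v + 2 * (s / T2) * v / 2) powr (- nu) * (1 - v + s / T2 * v) powr (d / 2 + nu - d / 2)) \<partial>lborel)
      = (\<integral>\<^sup>+v\<in>{0<..<1}. ennreal (v powr (nu - 1) * (1 - v) powr (d / 2 - 1)) \<partial>lborel)"
    proof (intro nn_integral_cong)
      fix v :: real
      have "1 - v + s / T2 * v > 0" if "0 < v" "v < 1"
        using that s T by (intro add_pos_pos) auto
      then show "ennreal (v powr (nu - 1) * (1 - v) powr (d / 2 - 1)
        * (1 - v + 2 * (s / T2) * v / 2) powr (- nu) * (1 - v + s / T2 * v) powr (d / 2 + nu - d / 2)) * indicator {0<..<1} v
        = ennreal (v powr (nu - 1) * (1 - v) powr (d / 2 - 1)) * indicator {0<..<1} v"
        by (auto simp: indicator_def powr_minus)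
    qed
    also have "\<dots> = ennreal (Beta nu (d / 2))"
      using nu d by (intro nn_integral_Beta) auto
    finally show ?thesis .
  qed
  have num: "(\<integral>\<^sup>+eta\<in>{0<..}. (\<integral>\<^sup>+mu. ennreal (phi y mu (1 / eta) * phi xb mu (1 / (real 2 * eta)) * eta * chi2 ((2 - 1) * CARD('d)) (eta * s)
      * prior_GM 2 nu mu eta) \<partial>lborel) \<partial>lborel)
    = ennreal K3 * (ennreal (Gamma (d + nu) * 2 powr (d + nu) * (3 * (S / T3)) powr nu * 3 powr (- d / 2) * S powr (- (d + nu)))
      * mixing_integral CARD('d) nu (S / T3))"
  proof -
    have "(\<integral>\<^sup>+eta\<in>{0<..}. (\<integral>\<^sup>+mu. ennreal (phi y mu (1 / eta) * phi xb mu (1 / (real 2 * eta)) * eta * chi2 ((2 - 1) * CARD('d)) (eta * s)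
        * prior_GM 2 nu mu eta) \<partial>lborel) \<partial>lborel)
      = ennreal K3 * (\<integral>\<^sup>+eta\<in>{0<..}. (\<integral>\<^sup>+mu. ennreal (eta powr (3 * d / 2) * exp (- (eta / 2) * (3 * (norm (mu - z))\<^sup>2 + S))
        * prior_GM 2 nu mu eta) \<partial>lborel) \<partial>lborel)"
      by (rule pull[OF less_imp_le[OF K(2)]]) (rule lik3, assumption, measurable)
    then show ?thesis
      using marginal_GM_mixing[OF nu _ S, of 3 "d + nu" "3 * d / 2" z] nu d
      by (simp add: mixing_integral_def zT d_def algebra_simps)
  qed
  have pr: "p_R 2 y xb s = Gamma d / Gamma (d / 2) * (2 / (3 * pi * s)) powr (d / 2) * (S / s) powr (- d)"
  proof -
    have "S / s = 1 + 1 / s * (2 / 3) * (norm (y - xb))\<^sup>2" "2 / (3 * pi * s) = 1 / (pi * s) * (2 / 3)"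
      using s by (simp_all add: S_def field_simps)
    then show ?thesis by (simp add: p_R_def d_def mult_ac)
  qed
  define I where "I = enn2real (mixing_integral CARD('d) nu (S / T3))"
  \<comment> \<open>Both sides are products of real powers of positive quantities, so after taking
    logarithms the identity is linear in those logarithms.\<close>
  have fac: "(2 * pi) powr (- d / 2) * (2 powr (d + nu) * (3 * (S / T3)) powr nu * 3 powr (- d / 2) * S powr (- (d + nu)))
    = ((2 / (3 * pi * s)) powr (d / 2) * (S / s) powr (- d) * (3 * T2 / (2 * T3)) powr nu)
      * (2 powr (d / 2 + nu) * (2 * (s / T2)) powr nu * 2 powr (- d / 2) * s powr (- (d / 2 + nu)))"
    using S T s by (simp add: powr_def ln_mult ln_div flip: exp_add) (simp add: field_simps)
  define X3 X2 Y where "X3 = 2 powr (d + nu) * (3 * (S / T3)) powr nu * 3 powr (- d / 2) * S powr (- (d + nu))"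
    and "X2 = 2 powr (d / 2 + nu) * (2 * (s / T2)) powr nu * 2 powr (- d / 2) * s powr (- (d / 2 + nu))"
    and "Y = (2 / (3 * pi * s)) powr (d / 2) * (S / s) powr (- d) * (3 * T2 / (2 * T3)) powr nu"
  have X2: "X2 > 0" using s T by (simp add: X2_def)
  have fac': "(2 * pi) powr (- d / 2) * X3 = Y * X2"
    using fac by (simp only: X3_def X2_def Y_def)
  have "bayes_pred 2 (prior_GM 2 nu) y xb s
     = (K3 * (Gamma (d + nu) * X3 * I)) / (K2 * (Gamma (d / 2 + nu) * X2 * Beta nu (d / 2)))"
  proof -
    have "Gamma (d + nu) * 2 powr (d + nu) * (3 * (S / T3)) powr nu * 3 powr (- d / 2) * S powr (- (d + nu)) = Gamma (d + nu) * X3"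
      "Gamma (d / 2 + nu) * 2 powr (d / 2 + nu) * (2 * (s / T2)) powr nu * 2 powr (- d / 2) * s powr (- (d / 2 + nu)) = Gamma (d / 2 + nu) * X2"
      by (simp_all only: X3_def X2_def mult.assoc)
    moreover have "X3 \<ge> 0" by (simp add: X3_def)
    moreover have "Beta nu (d / 2) \<ge> 0"
      using G[of nu] G[of "d/2"] G[of "nu + d/2"] nu d by (simp add: Beta_def)
    ultimately show ?thesis
      unfolding bayes_pred_def num den using K X2 G[of "d + nu"] G[of "d/2 + nu"] nu d
      by (simp only: enn2real_mult I_def[symmetric]) simp
  qed
  also have "\<dots> = ((2 * pi) powr (- d / 2) * X3) * (Gamma (d + nu) * I) / (Gamma (d / 2 + nu) * X2 * Beta nu (d / 2))"
    using K by (simp add: K3_def mult_ac)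
  \<comment> \<open>The shapes d + \<nu> and d/2 + \<nu> of the two Gamma integrals combine with
    Beta(\<nu>, d/2) into Gamma(d)/Gamma(d/2), the constant of \<open>p_R\<close>, divided by
    Beta(\<nu>, d), the norming constant of the law used in Jensen's inequality.\<close>
  also have "\<dots> = Gamma d / Gamma (d / 2) * Y * I / Beta nu d"
  proof -
    define g1 g2 g3 g4 g5 where "g1 = Gamma (d + nu)" and "g2 = Gamma (d / 2 + nu)" and "g3 = Gamma (d / 2)"
      and "g4 = Gamma d" and "g5 = Gamma nu"
    have g: "g1 > 0" "g2 > 0" "g3 > 0" "g4 > 0" "g5 > 0"
      using nu d by (auto simp: g1_def g2_def g3_def g4_def g5_def intro!: G)
    have B: "Beta nu d = g5 * g4 / g1" "Beta nu (d / 2) = g5 * g3 / g2"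
      by (simp_all add: Beta_def g1_def g2_def g3_def g4_def g5_def add.commute)
    show ?thesis
      unfolding fac' B g1_def[symmetric] g2_def[symmetric] g3_def[symmetric] g4_def[symmetric]
      using g X2 by (simp add: field_simps)
  qed
  finally show ?thesis
    unfolding pr by (simp add: Y_def I_def d_def mult_ac)
qed

section \<open>Bounds on the mixing integral\<close>

text \<open>A crude bound from F <= H and F <= 1. It serves for finiteness, and for an upper
  envelope that makes the logarithm of the ratio integrable.\<close>

lemma mixing_integral_le:
  assumes "\<nu> > 0" "d > 0" "0 < \<tau>" "\<tau> \<le> 1"
  shows "mixing_integral d \<nu> \<tau> \<le> ennreal (Beta \<nu> (real d / 2))"
proof -
  have "mixing_integral d \<nu> \<tau> \<le>
      (\<integral>\<^sup>+v\<in>{0<..<1}. ennreal (v powr (\<nu> - 1) * (1 - v) powr (real d / 2 - 1)) \<partial>lborel)"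
    unfolding mixing_integral_def
  proof (intro nn_integral_mono)
    fix v :: real
    define F H where "F = 1 - v + \<tau> * v" and "H = 1 - v + 3 * \<tau> * v / 2"
    show "ennreal (v powr (\<nu> - 1) * (1 - v) powr (real d / 2 - 1)
      * (1 - v + 3 * \<tau> * v / 2) powr (- \<nu>) * (1 - v + \<tau> * v) powr (real d / 2 + \<nu>)) * indicator {0<..<1} v
      \<le> ennreal (v powr (\<nu> - 1) * (1 - v) powr (real d / 2 - 1)) * indicator {0<..<1} v"
    proof (cases "0 < v \<and> v < 1")
      case True
      then have FH: "0 < F" "F \<le> H" "F \<le> 1"
        using assms mult_right_mono[of \<tau> 1 v] by (auto simp: F_def H_def add_pos_pos)
      have "H powr (- \<nu>) * F powr (real d / 2 + \<nu>) = (F powr \<nu> / H powr \<nu>) * F powr (real d / 2)"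
        by (simp add: powr_minus powr_add field_simps flip: powr_add)
      also have "\<dots> \<le> 1"
        using FH assms by (intro mult_le_one) (auto intro!: powr_le1 powr_mono2)
      finally have "v powr (\<nu> - 1) * (1 - v) powr (real d / 2 - 1) * (H powr (- \<nu>) * F powr (real d / 2 + \<nu>))
        \<le> v powr (\<nu> - 1) * (1 - v) powr (real d / 2 - 1) * 1"
        by (intro mult_left_mono) auto
      then show ?thesis
        using True by (auto simp: F_def H_def mult.assoc intro!: ennreal_leI)
    qed auto
  qed
  also have "\<dots> = ennreal (Beta \<nu> (real d / 2))"
    using assms by (intro nn_integral_Beta) auto
  finally show ?thesis .
qed

lemma nn_integral_Beta_poly:
  fixes a :: "nat \<Rightarrow> real"
  assumes "\<nu> > 0" "b > 0" and a: "\<And>k. k \<in> A \<Longrightarrow> a k \<ge> 0" and "finite A"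
  shows "(\<integral>\<^sup>+v\<in>{0<..<1}. ennreal (v powr (\<nu> - 1) * (1 - v) powr (b - 1) * (\<Sum>k\<in>A. a k * v ^ k)) \<partial>lborel)
    = ennreal (\<Sum>k\<in>A. a k * Beta (\<nu> + real k) b)"
proof -
  have "(\<integral>\<^sup>+v\<in>{0<..<1}. ennreal (v powr (\<nu> - 1) * (1 - v) powr (b - 1) * (\<Sum>k\<in>A. a k * v ^ k)) \<partial>lborel)
    = (\<integral>\<^sup>+v. (\<Sum>k\<in>A. ennreal (a k) * (ennreal (v powr (\<nu> + real k - 1) * (1 - v) powr (b - 1)) * indicator {0<..<1} v)) \<partial>lborel)"
  proof (intro nn_integral_cong)
    fix v :: real
    show "ennreal (v powr (\<nu> - 1) * (1 - v) powr (b - 1) * (\<Sum>k\<in>A. a k * v ^ k)) * indicator {0<..<1} v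
      = (\<Sum>k\<in>A. ennreal (a k) * (ennreal (v powr (\<nu> + real k - 1) * (1 - v) powr (b - 1)) * indicator {0<..<1} v))"
    proof (cases "0 < v \<and> v < 1")
      case True
      have "v powr (\<nu> - 1) * (1 - v) powr (b - 1) * (\<Sum>k\<in>A. a k * v ^ k)
          = (\<Sum>k\<in>A. a k * (v powr (\<nu> + real k - 1) * (1 - v) powr (b - 1)))"
        unfolding sum_distrib_left using True
        by (intro sum.cong refl) (simp add: powr_add powr_diff powr_realpow)
      also have "ennreal \<dots> = (\<Sum>k\<in>A. ennreal (a k) * ennreal (v powr (\<nu> + real k - 1) * (1 - v) powr (b - 1)))"
        using a by (subst sum_ennreal[symmetric]) (auto intro!: sum.cong simp: ennreal_mult')
      finally show ?thesis using True by simp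
    qed auto
  qed
  also have "\<dots> = (\<Sum>k\<in>A. ennreal (a k) * (\<integral>\<^sup>+v\<in>{0<..<1}. ennreal (v powr (\<nu> + real k - 1) * (1 - v) powr (b - 1)) \<partial>lborel))"
    by (simp add: nn_integral_sum nn_integral_cmult)
  also have "\<dots> = (\<Sum>k\<in>A. ennreal (a k) * ennreal (Beta (\<nu> + real k) b))"
    using assms by (intro sum.cong refl arg_cong2[where f = "(*)"] nn_integral_Beta) auto
  also have "\<dots> = (\<Sum>k\<in>A. ennreal (a k * Beta (\<nu> + real k) b))"
    using a by (intro sum.cong refl ennreal_mult'[symmetric]) auto
  also have "\<dots> = ennreal (\<Sum>k\<in>A. a k * Beta (\<nu> + real k) b)"
    using assms by (intro sum_ennreal) (auto simp: Beta_def Gamma_real_pos intro!: mult_nonneg_nonneg divide_nonneg_pos Gamma_real_nonneg)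
  finally show ?thesis .
qed

text \<open>Four terms of the series are the fewest that suffice for d = 1: half of the partial sum
  of 1/k^2 is 0.7118 with four terms, but 0.6806 with three, which lies below 0.705.\<close>

lemma neg_ln_one_minus_ge:
  fixes v :: real
  assumes "0 \<le> v" "v < 1"
  shows "v + v^2/2 + v^3/3 + v^4/4 \<le> - ln (1 - v)"
proof -
  have "(\<lambda>v. - ln (1 - v) - (v + v^2/2 + v^3/3 + v^4/4)) 0 \<le> (\<lambda>v. - ln (1 - v) - (v + v^2/2 + v^3/3 + v^4/4)) v"
  proof (rule DERIV_nonneg_imp_nondecreasing[OF assms(1)])
    fix x assume x: "0 \<le> x" "x \<le> v"
    have "((\<lambda>v. - ln (1 - v) - (v + v^2/2 + v^3/3 + v^4/4)) has_real_derivative 1 / (1 - x) - (1 + x + x^2 + x^3)) (at x)"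
      using x assms by (auto intro!: derivative_eq_intros simp: field_simps)
    moreover have "1 / (1 - x) - (1 + x + x^2 + x^3) = x^4 / (1 - x)"
      using x assms by (simp add: field_simps power2_eq_square power3_eq_cube power4_eq_xxxx)
    moreover have "x^4 / (1 - x) \<ge> 0" using x assms by auto
    ultimately show "\<exists>y. ((\<lambda>v. - ln (1 - v) - (v + v^2/2 + v^3/3 + v^4/4)) has_real_derivative y) (at x) \<and> y \<ge> 0"
      by (intro exI[of _ "1 / (1 - x) - (1 + x + x^2 + x^3)"] conjI) simp_all
  qed
  then show ?thesis by simp
qed

text \<open>Put G = ln F - ln (1 - v). Relative to (1 - v)^(d/2), the logarithm of the right-hand
  side is (d/2) G - \<nu> (ln H - ln F). Since ln H - ln F <= G/2, this is at least ((d - \<nu>)/2)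
  G, and concavity of the logarithm, applied to F as a mean of 1 - v and 1, gives G >= -\<tau> ln (1
  - v).\<close>

lemma mixing_integrand_ge:
  fixes v \<tau> \<nu> :: real and d :: nat
  assumes v: "0 < v" "v < 1" and \<tau>: "0 < \<tau>" "\<tau> \<le> 1" and \<nu>: "0 < \<nu>" "\<nu> \<le> real d" and L: "L \<le> - ln (1 - v)"
  shows "exp ((real d - \<nu>) / 2 * \<tau> * L) * (1 - v) powr (real d / 2)
    \<le> (1 - v + 3 * \<tau> * v / 2) powr (- \<nu>) * (1 - v + \<tau> * v) powr (real d / 2 + \<nu>)"
proof -
  define F H where "F = 1 - v + \<tau> * v" and "H = 1 - v + 3 * \<tau> * v / 2"
  have FH: "F > 0" "H > 0" using v \<tau> by (auto simp: F_def H_def add_pos_pos)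
  have conc: "(1 - \<tau>) * ln (1 - v) \<le> ln F"
    using concave_onD[OF ln_concave, of \<tau> "1 - v" 1] v \<tau> by (simp add: F_def algebra_simps)
  \<comment> \<open>With u = \<tau>v/F one has H/F = 1 + u/2 and (1 - v)/F = 1 - u, so the claim is
    the chain ln (1 + u/2) <= u/2 <= -ln (1 - u)/2.\<close>
  have HF: "ln H - ln F \<le> (ln F - ln (1 - v)) / 2"
  proof -
    have hf: "1 + \<tau> * v / F / 2 = H / F"
      using FH by (simp add: divide_simps) (simp add: F_def H_def)
    have "ln H - ln F = ln (1 + \<tau> * v / F / 2)"
      unfolding hf using FH by (simp add: ln_div)
    also have "\<dots> \<le> \<tau> * v / F / 2"
      using FH \<tau> v by (intro ln_add_one_self_le_self) auto
    also have "\<tau> * v / F \<le> - ln (1 - \<tau> * v / F)"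
    proof -
      have "1 - \<tau> * v / F > 0" using FH v by (simp add: F_def field_simps)
      then show ?thesis using ln_le_minus_one[of "1 - \<tau> * v / F"] by simp
    qed
    also have "1 - \<tau> * v / F = (1 - v) / F" using FH by (simp add: F_def field_simps)
    also have "- ln ((1 - v) / F) = ln F - ln (1 - v)" using FH v by (simp add: ln_div)
    finally show ?thesis by simp
  qed
  have "(real d - \<nu>) / 2 * (\<tau> * L) \<le> (real d - \<nu>) / 2 * (ln F - ln (1 - v))"
  proof (intro mult_left_mono)
    have "\<tau> * L \<le> \<tau> * (- ln (1 - v))" using \<tau> L by (intro mult_left_mono) auto
    then show "\<tau> * L \<le> ln F - ln (1 - v)" using conc by (simp add: algebra_simps)
  qed (use \<nu> in auto)
  moreover have "\<nu> * (ln H - ln F) \<le> \<nu> * ((ln F - ln (1 - v)) / 2)"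
    using HF \<nu> by (intro mult_left_mono) auto
  ultimately have "(real d - \<nu>) / 2 * \<tau> * L + real d / 2 * ln (1 - v) \<le> - \<nu> * ln H + (real d / 2 + \<nu>) * ln F"
    by (simp add: algebra_simps diff_divide_distrib)
  then have "exp ((real d - \<nu>) / 2 * \<tau> * L + real d / 2 * ln (1 - v)) \<le> exp (- \<nu> * ln H + (real d / 2 + \<nu>) * ln F)"
    by simp
  then show ?thesis
    unfolding F_def[symmetric] H_def[symmetric] exp_add using FH v by (simp add: powr_def)
qed

text \<open>
  Jensen's inequality in the form $e^{h} \ge e^{c} (1 + h - c)$, with $h$ a polynomial minorant of the
  logarithm of the integrand so that only Beta moments occur.
\<close>

lemma mixing_integral_ge_aux:
  fixes b :: "nat \<Rightarrow> real" and d n :: nat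
  assumes \<nu>: "0 < \<nu>" "\<nu> \<le> real d" and \<tau>: "0 < \<tau>" "\<tau> \<le> 1"
    and b: "\<And>k. b k \<ge> 0" "b 0 = 0" "\<And>v. 0 < v \<Longrightarrow> v < 1 \<Longrightarrow> (\<Sum>k\<le>n. b k * v ^ k) \<le> - ln (1 - v)"
    and c: "0 \<le> c" "c \<le> 1" "c * Beta \<nu> (real d) \<le> (real d - \<nu>) / 2 * (\<Sum>k\<le>n. b k * Beta (\<nu> + real k) (real d))"
  shows "ennreal (Beta \<nu> (real d) * exp (c * \<tau>)) \<le> mixing_integral d \<nu> \<tau>"
proof -
  have d: "real d > 0" using \<nu> by auto
  \<comment> \<open>Coefficients of the polynomial exp(c\<tau>) (1 + h - c\<tau>) in v. The constant
    one is nonnegative because c\<tau> <= 1, so the polynomial can be integrated term by term in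
    \<open>ennreal\<close>.\<close>
  define a where "a k = exp (c * \<tau>) * ((real d - \<nu>) / 2 * \<tau> * b k + (if k = 0 then 1 - c * \<tau> else 0))" for k
  have ct: "c * \<tau> \<le> 1" using c \<tau> by (simp add: mult_le_one)
  have a: "a k \<ge> 0" for k using b \<nu> \<tau> ct by (auto simp: a_def)
  have suma: "(\<Sum>k\<le>n. a k * x k) = exp (c * \<tau>) * ((1 - c * \<tau>) * x 0 + (real d - \<nu>) / 2 * \<tau> * (\<Sum>k\<le>n. b k * x k))" for x
  proof -
    have "(\<Sum>k\<le>n. a k * x k) = (\<Sum>k\<le>n. exp (c * \<tau>) * ((real d - \<nu>) / 2 * \<tau>) * (b k * x k)
        + (if k = 0 then exp (c * \<tau>) * (1 - c * \<tau>) * x 0 else 0))"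
      by (intro sum.cong) (auto simp: a_def algebra_simps)
    also have "\<dots> = exp (c * \<tau>) * ((real d - \<nu>) / 2 * \<tau>) * (\<Sum>k\<le>n. b k * x k) + exp (c * \<tau>) * (1 - c * \<tau>) * x 0"
      unfolding sum.distrib sum_distrib_left[symmetric] by simp
    finally show ?thesis
      by (simp only: distrib_left mult_ac add_ac)
  qed
  \<comment> \<open>The hypothesis on \<open>c\<close> says that c\<tau> is at most the Beta(\<nu>,
    d) mean of h, so the mean of 1 + h - c\<tau> is at least 1.\<close>
  have "Beta \<nu> (real d) * exp (c * \<tau>) \<le> (\<Sum>k\<le>n. a k * Beta (\<nu> + real k) (real d))"
  proof -
    have "exp (c * \<tau>) * (\<tau> * (c * Beta \<nu> (real d)))
        \<le> exp (c * \<tau>) * (\<tau> * ((real d - \<nu>) / 2 * (\<Sum>k\<le>n. b k * Beta (\<nu> + real k) (real d))))"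
      using c \<tau> by (intro mult_left_mono) auto
    then show ?thesis
      unfolding suma by (simp add: algebra_simps)
  qed
  then have "ennreal (Beta \<nu> (real d) * exp (c * \<tau>)) \<le> ennreal (\<Sum>k\<le>n. a k * Beta (\<nu> + real k) (real d))"
    by (rule ennreal_leI)
  also have "\<dots> = (\<integral>\<^sup>+v\<in>{0<..<1}. ennreal (v powr (\<nu> - 1) * (1 - v) powr (real d - 1) * (\<Sum>k\<le>n. a k * v ^ k)) \<partial>lborel)"
    using \<nu> d a by (intro nn_integral_Beta_poly[symmetric]) auto
  also have "\<dots> \<le> mixing_integral d \<nu> \<tau>"
    unfolding mixing_integral_def
  proof (intro nn_integral_mono)
    fix v :: real
    show "ennreal (v powr (\<nu> - 1) * (1 - v) powr (real d - 1) * (\<Sum>k\<le>n. a k * v ^ k)) * indicator {0<..<1} v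
      \<le> ennreal (v powr (\<nu> - 1) * (1 - v) powr (real d / 2 - 1)
      * (1 - v + 3 * \<tau> * v / 2) powr (- \<nu>) * (1 - v + \<tau> * v) powr (real d / 2 + \<nu>)) * indicator {0<..<1} v"
    proof (cases "0 < v \<and> v < 1")
      case True
      define h where "h = (real d - \<nu>) / 2 * \<tau> * (\<Sum>k\<le>n. b k * v ^ k)"
      have "(\<Sum>k\<le>n. a k * v ^ k) = exp (c * \<tau>) * (1 + (h - c * \<tau>))"
        unfolding suma by (simp add: h_def)
      also have "\<dots> \<le> exp (c * \<tau>) * exp (h - c * \<tau>)"
        by (intro mult_left_mono) auto
      also have "\<dots> = exp h" by (simp flip: exp_add)
      finally have "(1 - v) powr (real d / 2) * (\<Sum>k\<le>n. a k * v ^ k) \<le> (1 - v) powr (real d / 2) * exp h"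
        by (intro mult_left_mono) auto
      also have "\<dots> \<le> (1 - v + 3 * \<tau> * v / 2) powr (- \<nu>) * (1 - v + \<tau> * v) powr (real d / 2 + \<nu>)"
        using mixing_integrand_ge[OF _ _ \<tau> \<nu> b(3)[of v]] True by (simp add: h_def mult.commute)
      finally have "v powr (\<nu> - 1) * (1 - v) powr (real d / 2 - 1) * ((1 - v) powr (real d / 2) * (\<Sum>k\<le>n. a k * v ^ k))
        \<le> v powr (\<nu> - 1) * (1 - v) powr (real d / 2 - 1) *
        ((1 - v + 3 * \<tau> * v / 2) powr (- \<nu>) * (1 - v + \<tau> * v) powr (real d / 2 + \<nu>))"
        by (intro mult_left_mono) auto
      moreover have "(1 - v) powr (real d - 1) = (1 - v) powr (real d / 2 - 1) * (1 - v) powr (real d / 2)"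
        by (simp flip: powr_add)
      ultimately show ?thesis
        using True by (auto intro!: ennreal_leI simp: mult.assoc)
    qed auto
  qed
  finally show ?thesis .
qed

text \<open>For d >= 2 the minorant v of -ln (1 - v) is enough: its Beta(\<nu>, d) mean is
  \<nu>/(\<nu> + d), which gives an exponent close to \<nu>\<tau>/2. For d = 1 that falls short of
  0.71 \<nu>\<tau>, and four terms of the series are taken.\<close>

lemma mixing_integral_ge:
  fixes d :: nat
  assumes \<nu>: "0 < \<nu>" "\<nu> \<le> 1/1000" and \<tau>: "0 < \<tau>" "\<tau> \<le> 1" and d: "d > 0"
  shows "ennreal (Beta \<nu> (real d) * exp (\<nu> * (71/100 / real d) * \<tau>)) \<le> mixing_integral d \<nu> \<tau>"
proof (cases "d = 1")
  case True
  define b :: "nat \<Rightarrow> real" where "b k = (if k = 0 then 0 else 1 / real k)" for k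
  have sum4: "(\<Sum>k\<le>4. b k * x k) = x 1 + x 2 / 2 + x 3 / 3 + x 4 / 4" for x
    by (simp add: b_def eval_nat_numeral)
  have B: "Beta x 1 = 1 / x" if "x > 0" for x :: real
  proof -
    have "Gamma (x + 1) = x * Gamma x"
      using that by (intro Gamma_plus1) (auto dest: nonpos_Ints_nonpos)
    then show ?thesis using less_imp_neq[OF Gamma_real_pos[OF that]] that by (simp add: Beta_def)
  qed
  have "\<nu> * (71/100 / real d) * Beta \<nu> (real d) \<le> (real d - \<nu>) / 2 * (\<Sum>k\<le>4. b k * Beta (\<nu> + real k) (real d))"
  proof -
    have k: "1 / (\<nu> + k) \<ge> 1 / (1/1000 + k)" if "k > 0" for k
      using \<nu> that by (intro divide_left_mono) auto
    \<comment> \<open>Every factor decreases in \<nu>, so \<nu> = 1/1000 is the worst case; there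
      the right-hand side is about 0.7105. This is what limits the range of \<nu>.\<close>
    have "71/100 \<le> (1 - 1/1000) / 2 * (1 / (1/1000 + 1) + 1/2 * (1 / (1/1000 + 2)) + 1/3 * (1 / (1/1000 + 3)) + 1/4 * (1 / (1/1000 + 4)) :: real)"
      by simp
    also have "\<dots> \<le> (1 - \<nu>) / 2 * (1 / (\<nu> + 1) + 1/2 * (1 / (\<nu> + 2)) + 1/3 * (1 / (\<nu> + 3)) + 1/4 * (1 / (\<nu> + 4)))"
      using \<nu> by (intro mult_mono add_mono k) auto
    finally show ?thesis
      unfolding sum4 using True \<nu> by (simp add: B mult_ac)
  qed
  moreover have "(\<Sum>k\<le>4. b k * v ^ k) \<le> - ln (1 - v)" if "0 < v" "v < 1" for v :: real
    unfolding sum4 using neg_ln_one_minus_ge[of v] that by simp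
  moreover have "0 \<le> \<nu> * (71/100 / real d)" "\<nu> * (71/100 / real d) \<le> 1" "\<nu> \<le> real d"
    using \<nu> True by auto
  moreover have "0 \<le> b k" "b 0 = 0" for k by (auto simp: b_def)
  ultimately show ?thesis
    using \<nu> \<tau> by (intro mixing_integral_ge_aux[where b = b and n = 4])
next
  case False
  define b :: "nat \<Rightarrow> real" where "b k = (if k = 1 then 1 else 0)" for k
  have sum1: "(\<Sum>k\<le>1. b k * x k) = x 1" for x
    by (simp add: b_def)
  have d2: "real d \<ge> 2" using False d by linarith
  have Bpos: "Beta \<nu> (real d) > 0" using \<nu> d by (simp add: Beta_def Gamma_real_pos)
  \<comment> \<open>After multiplication by 2d this reads d (d - \<nu> - 142/100) >= 142\<nu>/100;
    for d >= 2 the left side is at least 1.\<close>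
  have "71/100 / real d * (\<nu> + real d) \<le> (real d - \<nu>) / 2"
  proof -
    have "142 * \<nu> \<le> 1" using \<nu> by simp
    moreover have "real d * (real d - \<nu> - 142/100) \<ge> 2 * (1/2)"
      using d2 \<nu> by (intro mult_mono) auto
    ultimately have "71/100 * (\<nu> + real d) \<le> (real d - \<nu>) / 2 * real d"
      by (simp add: field_simps)
    then show ?thesis using d2 by (simp add: field_simps)
  qed
  then have "71/100 / real d * (\<nu> + real d) * (\<nu> * Beta \<nu> (real d)) \<le> (real d - \<nu>) / 2 * (\<nu> * Beta \<nu> (real d))"
    using Bpos \<nu> by (intro mult_right_mono) auto
  moreover have "\<nu> * Beta \<nu> (real d) = (\<nu> + real d) * Beta (\<nu> + 1) (real d)"
    using \<nu> by (intro Beta_plus1_left[symmetric]) (auto dest: nonpos_Ints_nonpos)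
  ultimately have *: "(\<nu> + real d) * (71/100 / real d * (\<nu> * Beta \<nu> (real d))) \<le> (\<nu> + real d) * ((real d - \<nu>) / 2 * Beta (\<nu> + 1) (real d))"
    by (simp only: mult_ac)
  have "71/100 / real d * (\<nu> * Beta \<nu> (real d)) \<le> (real d - \<nu>) / 2 * Beta (\<nu> + 1) (real d)"
    by (rule mult_left_le_imp_le[OF *]) (use \<nu> d2 in auto)
  then have "\<nu> * (71/100 / real d) * Beta \<nu> (real d) \<le> (real d - \<nu>) / 2 * (\<Sum>k\<le>1. b k * Beta (\<nu> + real k) (real d))"
    unfolding sum1 of_nat_1 by (simp only: mult_ac)
  moreover have "(\<Sum>k\<le>1. b k * v ^ k) \<le> - ln (1 - v)" if "0 < v" "v < 1" for v :: real
    using ln_le_minus_one[of "1 - v"] that by (simp add: b_def)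
  moreover have "0 \<le> \<nu> * (71/100 / real d)" "\<nu> * (71/100 / real d) \<le> 1" "\<nu> \<le> real d"
    using \<nu> d2 by (auto simp: field_simps)
  moreover have "0 \<le> b k" "b 0 = 0" for k by (auto simp: b_def)
  ultimately show ?thesis
    using \<nu> \<tau> by (intro mixing_integral_ge_aux[where b = b and n = 1])
qed

section \<open>Frullani integral and exponentially tilted Gaussians\<close>

text \<open>In the variable u = r/(1 - r) this is the integral of exp(-c u) over the half line.
  Keeping r as the variable places the later Laplace transforms on the unit interval.\<close>

lemma nn_integral_exp_odds:
  fixes c :: real
  assumes c: "c > 0"
  shows "(\<integral>\<^sup>+r\<in>{0<..<1}. ennreal (exp (- c * (r / (1 - r))) / (1 - r)\<^sup>2) \<partial>lborel) = ennreal (1 / c)"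
proof -
  define f where "f r = exp (- c * (r / (1 - r))) / (1 - r)\<^sup>2" for r :: real
  define F where "F r = - exp (- c * (r / (1 - r))) / c" for r :: real
  have "(F \<longlongrightarrow> F 0) (at_right 0)"
    unfolding F_def by (intro tendsto_intros) (use c in auto)
  moreover have "(F \<longlongrightarrow> 0) (at_left 1)"
    unfolding F_def using c by real_asymp
  moreover have "DERIV F x :> f x" if "0 < x" "x < 1" for x
  proof -
    have D: "((\<lambda>r. r / (1 - r)) has_real_derivative 1 / (1 - x)\<^sup>2) (at x)"
      using that by (auto intro!: derivative_eq_intros simp: field_simps power2_eq_square)
    show ?thesis
      unfolding F_def f_def
      by (rule DERIV_cong[OF DERIV_cdivide[OF DERIV_minus[OF DERIV_fun_exp[OF DERIV_cmult[OF D]]]]]) (use c in simp)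
  qed
  moreover have "isCont f x" if "0 < x" "x < 1" for x
    unfolding f_def using that by (intro continuous_intros) auto
  moreover have "f x \<ge> 0" for x by (simp add: f_def)
  ultimately have FTC: "set_integrable lborel (einterval (ereal 0) (ereal 1)) f" "(LBINT x=ereal 0..ereal 1. f x) = 0 - F 0"
    by (intro interval_integral_FTC_nonneg[where F = F]; simp add: ereal_tendsto_simps zero_ereal_def one_ereal_def)+
  have "(\<integral>\<^sup>+r\<in>{0<..<1}. ennreal (f r) \<partial>lborel) = ennreal (LBINT x:{0<..<1}. f x)"
    using FTC(1) unfolding nn_integral_set_ennreal set_lebesgue_integral_def set_integrable_def
    by (subst nn_integral_eq_integral[symmetric]) (auto simp: f_def mult.commute)
  also have "(LBINT x:{0<..<1}. f x) = 1 / c"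
    using FTC(2) by (simp add: interval_lebesgue_integral_def F_def)
  finally show ?thesis by (simp add: f_def)
qed

text \<open>Integrate \<open>nn_integral_exp_odds\<close> over its parameter from a to b and
  exchange the integrals. Integration in the parameter divides by r/(1 - r), which changes the
  weight 1/(1 - r)^2 into 1/(r (1 - r)).\<close>

lemma nn_integral_frullani_odds:
  fixes a b :: real
  assumes a: "0 < a" "a \<le> b"
  shows "(\<integral>\<^sup>+r\<in>{0<..<1}. ennreal ((exp (- a * (r / (1 - r))) - exp (- b * (r / (1 - r)))) / (r * (1 - r))) \<partial>lborel)
    = ennreal (ln (b / a))"
proof -
  have "ennreal (ln b - ln a) = (\<integral>\<^sup>+x. ennreal (1 / x) * indicator {a..b} x \<partial>lborel)"
    using a by (intro nn_integral_FTC_Icc[symmetric])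
      (auto intro!: derivative_eq_intros simp: has_real_derivative_iff_has_vector_derivative[symmetric])
  also have "\<dots> = (\<integral>\<^sup>+x. (\<integral>\<^sup>+r. ennreal (exp (- x * (r / (1 - r))) / (1 - r)\<^sup>2) * indicator {0<..<1} r * indicator {a..b} x \<partial>lborel) \<partial>lborel)"
  proof (intro nn_integral_cong)
    fix x :: real
    show "ennreal (1 / x) * indicator {a..b} x =
      (\<integral>\<^sup>+r. ennreal (exp (- x * (r / (1 - r))) / (1 - r)\<^sup>2) * indicator {0<..<1} r * indicator {a..b} x \<partial>lborel)"
      using nn_integral_exp_odds[of x] a by (cases "x \<in> {a..b}") auto
  qed
  also have "\<dots> = (\<integral>\<^sup>+r. (\<integral>\<^sup>+x. ennreal (exp (- x * (r / (1 - r))) / (1 - r)\<^sup>2) * indicator {0<..<1} r * indicator {a..b} x \<partial>lborel) \<partial>lborel)"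
    by (rule lborel_pair.Fubini') measurable
  also have "\<dots> = (\<integral>\<^sup>+r\<in>{0<..<1}. ennreal ((exp (- a * (r / (1 - r))) - exp (- b * (r / (1 - r)))) / (r * (1 - r))) \<partial>lborel)"
  proof (intro nn_integral_cong)
    fix r :: real
    show "(\<integral>\<^sup>+x. ennreal (exp (- x * (r / (1 - r))) / (1 - r)\<^sup>2) * indicator {0<..<1} r * indicator {a..b} x \<partial>lborel)
      = ennreal ((exp (- a * (r / (1 - r))) - exp (- b * (r / (1 - r)))) / (r * (1 - r))) * indicator {0<..<1} r"
    proof (cases "0 < r \<and> r < 1")
      case True
      define \<rho> where "\<rho> = r / (1 - r)"
      have \<rho>: "\<rho> > 0" "\<rho> * (1 - r)\<^sup>2 = r * (1 - r)" using True by (auto simp: \<rho>_def power2_eq_square)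
      have "(\<integral>\<^sup>+x. ennreal (exp (- x * \<rho>) / (1 - r)\<^sup>2) * indicator {a..b} x \<partial>lborel)
        = ennreal (- exp (- b * \<rho>) / (\<rho> * (1 - r)\<^sup>2) - - exp (- a * \<rho>) / (\<rho> * (1 - r)\<^sup>2))"
        using a \<rho>(1) True
        by (intro nn_integral_FTC_Icc[where F = "\<lambda>x. - exp (- x * \<rho>) / (\<rho> * (1 - r)\<^sup>2)"])
           (auto intro!: derivative_eq_intros simp: has_real_derivative_iff_has_vector_derivative[symmetric] divide_simps)
      then show ?thesis
        using True unfolding \<rho>_def[symmetric] \<rho>(2) by (simp add: diff_divide_distrib)
    qed auto
  qed
  finally show ?thesis
    using a by (simp add: ln_div)
qed

section \<open>Gaussian vectors under exponential tilting\<close>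

lemma nn_integral_lborel_triple:
  fixes f :: "'a::euclidean_space \<times> 'b::euclidean_space \<times> 'c::euclidean_space \<Rightarrow> ennreal"
  assumes [measurable]: "f \<in> borel_measurable borel"
  shows "(\<integral>\<^sup>+z. f z \<partial>lborel) = (\<integral>\<^sup>+x. \<integral>\<^sup>+y. \<integral>\<^sup>+z. f (x, y, z) \<partial>lborel \<partial>lborel \<partial>lborel)"
proof -
  have eq: "lborel \<Otimes>\<^sub>M (lborel \<Otimes>\<^sub>M lborel) = (lborel :: ('a \<times> 'b \<times> 'c) measure)"
    by (simp add: lborel_prod)
  have m: "f \<in> borel_measurable (lborel \<Otimes>\<^sub>M (lborel \<Otimes>\<^sub>M lborel))"
    unfolding eq by simp
  have "(\<integral>\<^sup>+z. f z \<partial>lborel) = (\<integral>\<^sup>+z. f z \<partial>(lborel \<Otimes>\<^sub>M (lborel \<Otimes>\<^sub>M lborel)))"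
    by (simp only: eq)
  also have "\<dots> = (\<integral>\<^sup>+x. \<integral>\<^sup>+w. f (x, w) \<partial>(lborel \<Otimes>\<^sub>M lborel) \<partial>lborel)"
    using m by (subst sigma_finite_measure.nn_integral_fst[symmetric])
      (auto simp: lborel_prod intro: lborel.sigma_finite_measure_axioms)
  also have "\<dots> = (\<integral>\<^sup>+x. \<integral>\<^sup>+y. \<integral>\<^sup>+z. f (x, y, z) \<partial>lborel \<partial>lborel \<partial>lborel)"
  proof (intro nn_integral_cong)
    fix x :: 'a
    have "(\<lambda>w. f (x, w)) \<in> borel_measurable (lborel \<Otimes>\<^sub>M lborel)"
      using m by measurable
    then show "(\<integral>\<^sup>+w. f (x, w) \<partial>(lborel \<Otimes>\<^sub>M lborel)) = (\<integral>\<^sup>+y. \<integral>\<^sup>+z. f (x, y, z) \<partial>lborel \<partial>lborel)"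
      by (rule lborel.nn_integral_fst[symmetric])
  qed
  finally show ?thesis .
qed

text \<open>
  Throughout, $r \in [0,1)$ parametrizes the Laplace variable $\frac{\eta}{2} \cdot \frac{r}{1-r}$; in this
  parametrization the transform of a noncentral chi-square law is a power of $1 - r$ times $e^{-c r}$.
\<close>

definition tilt :: "real^'d \<Rightarrow> real \<Rightarrow> real \<Rightarrow> real^'d \<Rightarrow> real" where
  "tilt mu eta r x = phi x mu (1 / eta) * exp (- (eta / 2) * (r / (1 - r) * (norm x)\<^sup>2))"

definition mgf :: "real^'d \<Rightarrow> real \<Rightarrow> real \<Rightarrow> real" where
  "mgf mu eta r = (1 - r) powr (real CARD('d) / 2) * exp (- (eta / 2) * (r * (norm mu)\<^sup>2))"

lemma phi_measurable [measurable]: "(\<lambda>x. phi x (m::real^'d) t) \<in> borel_measurable borel"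
  unfolding phi_def by measurable

lemma tilt_measurable [measurable]: "tilt mu eta r \<in> borel_measurable borel"
  unfolding tilt_def[abs_def] by measurable

lemma tilt_nonneg: "tilt mu eta r x \<ge> 0"
  by (simp add: tilt_def phi_def)

lemma tilt_0: "tilt mu eta 0 x = phi x mu (1 / eta)"
  by (simp add: tilt_def)

lemma mgf_0: "mgf mu eta 0 = 1"
  by (simp add: mgf_def)

lemma mgf_pos: "r < 1 \<Longrightarrow> mgf mu eta r > 0"
  by (simp add: mgf_def)

context
  fixes mu :: "real^'d" and eta :: real
  assumes eta: "eta > 0"
begin

text \<open>The added precision is r/(1 - r) times the old one, and 1 + r/(1 - r) = 1/(1 - r).
  Tilting therefore keeps the Gaussian shape and shrinks both the mean and the variance by the
  factor 1 - r.\<close>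

lemma tilt_eq:
  assumes r: "0 \<le> r" "r < 1"
  shows "tilt mu eta r x = ((2 * pi / eta) powr (- real CARD('d) / 2) * exp (- (eta / 2) * (r * (norm mu)\<^sup>2)))
    * exp (- (eta / (2 * (1 - r))) * (norm (x - (1 - r) *\<^sub>R mu))\<^sup>2)"
proof -
  define \<rho> where "\<rho> = r / (1 - r)"
  have \<rho>: "1 + \<rho> = 1 / (1 - r)" using r by (simp add: \<rho>_def field_simps)
  have "(norm (x - mu))\<^sup>2 + \<rho> * (norm x)\<^sup>2
      = 1 / (1 - r) * (norm (x - (1 - r) *\<^sub>R mu))\<^sup>2 + r * (norm mu)\<^sup>2"
    using norm_diff_square_complete[of 1 \<rho> x mu] \<rho> r by (simp add: \<rho>_def)
  then have e: "(eta / 2) * ((norm (x - mu))\<^sup>2 + \<rho> * (norm x)\<^sup>2)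
      = (eta / 2) * (1 / (1 - r) * (norm (x - (1 - r) *\<^sub>R mu))\<^sup>2 + r * (norm mu)\<^sup>2)"
    by simp
  have "tilt mu eta r x = (2 * pi / eta) powr (- real CARD('d) / 2) * exp (- ((eta / 2) * ((norm (x - mu))\<^sup>2 + \<rho> * (norm x)\<^sup>2)))"
    by (simp add: tilt_def phi_def \<rho>_def algebra_simps flip: exp_add)
  also have "\<dots> = (2 * pi / eta) powr (- real CARD('d) / 2) *
     (exp (- (eta / 2) * (r * (norm mu)\<^sup>2)) * exp (- (eta / (2 * (1 - r))) * (norm (x - (1 - r) *\<^sub>R mu))\<^sup>2))"
    unfolding e exp_add[symmetric] by (simp add: algebra_simps)
  finally show ?thesis by (simp only: mult.assoc)
qed

lemma mgf_eq:
  assumes r: "0 \<le> r" "r < 1"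
  shows "((2 * pi / eta) powr (- real CARD('d) / 2) * exp (- (eta / 2) * (r * (norm mu)\<^sup>2)))
    * (pi / (eta / (2 * (1 - r)))) powr (real CARD('d) / 2) = mgf mu eta r"
proof -
  have "pi / (eta / (2 * (1 - r))) = (2 * pi / eta) * (1 - r)" using eta r by (simp add: field_simps)
  then have "(pi / (eta / (2 * (1 - r)))) powr (real CARD('d) / 2)
    = (2 * pi / eta) powr (real CARD('d) / 2) * (1 - r) powr (real CARD('d) / 2)"
    using eta r by (simp only:) (rule powr_mult)
  then show ?thesis
    using eta by (simp add: mgf_def powr_minus)
qed

lemma nn_integral_tilt:
  assumes r: "0 \<le> r" "r < 1"
  shows "(\<integral>\<^sup>+x. ennreal (tilt mu eta r x) \<partial>lborel) = ennreal (mgf mu eta r)"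
proof -
  have "(\<integral>\<^sup>+x. ennreal (tilt mu eta r x) \<partial>lborel) = 
     ennreal ((2 * pi / eta) powr (- real CARD('d) / 2) * exp (- (eta / 2) * (r * (norm mu)\<^sup>2))) *
     (\<integral>\<^sup>+x. ennreal (exp (- (eta / (2 * (1 - r))) * (norm (x - (1 - r) *\<^sub>R mu))\<^sup>2)) \<partial>lborel)"
    unfolding tilt_eq[OF r] by (subst nn_integral_cmult[symmetric]) (auto simp: ennreal_mult')
  also have "\<dots> = ennreal (mgf mu eta r)"
    using eta r by (subst nn_integral_gauss_vec) (simp_all add: mgf_eq[OF r, symmetric] ennreal_mult')
  finally show ?thesis .
qed

lemma nn_integral_tilt_moment:
  assumes r: "0 \<le> r" "r < 1"
  shows "(\<integral>\<^sup>+x. ennreal (tilt mu eta r x * (norm (x - a))\<^sup>2) \<partial>lborel)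
    = ennreal (mgf mu eta r * (real CARD('d) * (1 - r) / eta + (norm ((1 - r) *\<^sub>R mu - a))\<^sup>2))"
proof -
  define C where "C = (2 * pi / eta) powr (- real CARD('d) / 2) * exp (- (eta / 2) * (r * (norm mu)\<^sup>2))"
  have C: "C \<ge> 0" by (simp add: C_def)
  have "(\<integral>\<^sup>+x. ennreal (tilt mu eta r x * (norm (x - a))\<^sup>2) \<partial>lborel) = ennreal C *
     (\<integral>\<^sup>+x. ennreal (exp (- (eta / (2 * (1 - r))) * (norm (x - (1 - r) *\<^sub>R mu))\<^sup>2) * (norm (x - a))\<^sup>2) \<partial>lborel)"
    unfolding tilt_eq[OF r] C_def[symmetric] mult.assoc
    using C by (subst nn_integral_cmult[symmetric]) (auto simp: ennreal_mult')
  also have "\<dots> = ennreal C * ennreal ((pi / (eta / (2 * (1 - r)))) powr (real CARD('d) / 2) * (real CARD('d) / (2 * (eta / (2 * (1 - r)))) + (norm ((1 - r) *\<^sub>R mu - a))\<^sup>2))"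
    using eta r by (subst nn_integral_gauss_moment_vec) simp_all
  also have "\<dots> = ennreal ((C * (pi / (eta / (2 * (1 - r)))) powr (real CARD('d) / 2)) * (real CARD('d) / (2 * (eta / (2 * (1 - r)))) + (norm ((1 - r) *\<^sub>R mu - a))\<^sup>2))"
    unfolding mult.assoc by (rule ennreal_mult'[OF C, symmetric])
  also have "C * (pi / (eta / (2 * (1 - r)))) powr (real CARD('d) / 2) = mgf mu eta r"
    unfolding C_def by (rule mgf_eq[OF r])
  also have "real CARD('d) / (2 * (eta / (2 * (1 - r)))) = real CARD('d) * (1 - r) / eta"
    using eta r by (simp add: field_simps)
  finally show ?thesis .
qed

text \<open>Both tilted vectors have the same mean, so a difference has no bias term: the variance
  d(1 - r)/eta appears once for each vector, and \<open>mu\<close> enters only through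
  \<open>mgf\<close>.\<close>

lemma nn_integral_tilt_pair:
  assumes r: "0 \<le> r" "r < 1"
  shows "(\<integral>\<^sup>+x. \<integral>\<^sup>+y. ennreal (tilt mu eta r x * tilt mu eta r y * (norm (x - y))\<^sup>2) \<partial>lborel \<partial>lborel)
    = ennreal (2 * real CARD('d) * (1 - r) / eta * (mgf mu eta r)\<^sup>2)"
proof -
  define q where "q = real CARD('d) * (1 - r) / eta"
  have q: "q \<ge> 0" using eta r by (simp add: q_def)
  have m: "mgf mu eta r > 0" using r by (simp add: mgf_pos)
  have "(\<integral>\<^sup>+x. \<integral>\<^sup>+y. ennreal (tilt mu eta r x * tilt mu eta r y * (norm (x - y))\<^sup>2) \<partial>lborel \<partial>lborel)
    = (\<integral>\<^sup>+x. ennreal (tilt mu eta r x) * (\<integral>\<^sup>+y. ennreal (tilt mu eta r y * (norm (y - x))\<^sup>2) \<partial>lborel) \<partial>lborel)"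
    by (simp add: tilt_nonneg nn_integral_cmult[symmetric] ennreal_mult' mult.assoc norm_minus_commute)
  also have "\<dots> = (\<integral>\<^sup>+x. ennreal (mgf mu eta r) * (ennreal q * ennreal (tilt mu eta r x) + ennreal (tilt mu eta r x * (norm (x - (1 - r) *\<^sub>R mu))\<^sup>2)) \<partial>lborel)"
    unfolding nn_integral_tilt_moment[OF r] q_def[symmetric]
    using q m
    by (intro nn_integral_cong) (simp add: tilt_nonneg norm_minus_commute algebra_simps flip: ennreal_mult' ennreal_plus)
  also have "\<dots> = ennreal (mgf mu eta r) * (ennreal q * ennreal (mgf mu eta r) + ennreal (mgf mu eta r * q))"
    by (simp add: nn_integral_cmult nn_integral_add nn_integral_tilt[OF r] nn_integral_tilt_moment[OF r] q_def)
  also have "\<dots> = ennreal (mgf mu eta r * (q * mgf mu eta r + mgf mu eta r * q))"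
    using m q by (simp flip: ennreal_mult' ennreal_plus)
  finally show ?thesis
    by (simp add: q_def power2_eq_square mult_ac)
qed

end

section \<open>Expectations over the sample\<close>

type_synonym 'd sample = "(real^'d) \<times> (real^'d) \<times> (real^'d)"

definition sample_density :: "real^'d \<Rightarrow> real \<Rightarrow> 'd sample \<Rightarrow> real" where
  "sample_density mu eta = (\<lambda>(x1, x2, y). phi x1 mu (1 / eta) * phi x2 mu (1 / eta) * phi y mu (1 / eta))"

definition sumsq2 :: "'d::finite sample \<Rightarrow> real" where
  "sumsq2 = (\<lambda>(x1, x2, y). (norm x1)\<^sup>2 + (norm x2)\<^sup>2)"

definition sumsq3 :: "'d::finite sample \<Rightarrow> real" where
  "sumsq3 = (\<lambda>(x1, x2, y). (norm x1)\<^sup>2 + (norm x2)\<^sup>2 + (norm y)\<^sup>2)"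

definition resid2 :: "'d::finite sample \<Rightarrow> real" where
  "resid2 = (\<lambda>(x1, x2, y). (norm (x1 - x2))\<^sup>2 / 2)"

text \<open>The sum of squared deviations from the mean, written through pairwise differences: each
  pair then involves only two of the three independent vectors, and
  \<open>nn_integral_tilt_pair\<close> applies.\<close>

definition resid3 :: "'d::finite sample \<Rightarrow> real" where
  "resid3 = (\<lambda>(x1, x2, y). ((norm (x1 - x2))\<^sup>2 + (norm (x1 - y))\<^sup>2 + (norm (x2 - y))\<^sup>2) / 3)"

lemma sample_measurable [measurable]:
  fixes mu :: "real^'d"
  shows "sample_density mu eta \<in> borel_measurable borel"
    "(sumsq2 :: 'd sample \<Rightarrow> real) \<in> borel_measurable borel"
    "(sumsq3 :: 'd sample \<Rightarrow> real) \<in> borel_measurable borel"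
    "(resid2 :: 'd sample \<Rightarrow> real) \<in> borel_measurable borel"
    "(resid3 :: 'd sample \<Rightarrow> real) \<in> borel_measurable borel"
  unfolding sample_density_def sumsq2_def sumsq3_def resid2_def resid3_def borel_prod[symmetric] by measurable

lemma sample_nonneg: "0 \<le> sample_density mu eta z" "0 \<le> sumsq2 z" "0 \<le> sumsq3 z" "0 \<le> resid2 z" "0 \<le> resid3 z"
  by (auto simp: sample_density_def sumsq2_def sumsq3_def resid2_def resid3_def phi_def split: prod.splits)

lemma sumsq2_le_sumsq3: "sumsq2 z \<le> sumsq3 z"
  by (auto simp: sumsq2_def sumsq3_def split: prod.splits)

lemma resid2_le_sumsq2: "resid2 z \<le> sumsq2 z"
proof -
  obtain x1 x2 y where z: "z = (x1, x2, y)" by (cases z) auto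
  have "0 \<le> (norm (x1 + x2))\<^sup>2" by simp
  also have "\<dots> = 2 * (norm x1)\<^sup>2 + 2 * (norm x2)\<^sup>2 - (norm (x1 - x2))\<^sup>2"
    by (simp add: power2_norm_eq_inner inner_diff inner_add inner_commute)
  finally show ?thesis by (simp add: z sumsq2_def resid2_def)
qed

lemma resid2_le_resid3: "resid2 z \<le> resid3 z"
proof -
  obtain x1 x2 y where z: "z = (x1, x2, y)" by (cases z) auto
  define a b where "a = x1 - y" and "b = x2 - y"
  have "0 \<le> (norm (a + b))\<^sup>2" by simp
  also have "\<dots> = 2 * (norm a)\<^sup>2 + 2 * (norm b)\<^sup>2 - (norm (a - b))\<^sup>2"
    by (simp add: power2_norm_eq_inner inner_diff inner_add inner_commute)
  also have "a - b = x1 - x2" by (simp add: a_def b_def)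
  finally have "0 \<le> 2 * (norm (x1 - y))\<^sup>2 + 2 * (norm (x2 - y))\<^sup>2 - (norm (x1 - x2))\<^sup>2"
    by (simp add: a_def b_def)
  then show ?thesis by (simp add: z resid2_def resid3_def)
qed

lemma resid3_le_sumsq3: "resid3 z \<le> sumsq3 z"
proof -
  obtain x1 x2 y where z: "z = (x1, x2, y)" by (cases z) auto
  have "0 \<le> (norm (x1 + x2 + y))\<^sup>2 / 3" by simp
  also have "\<dots> = sumsq3 z - resid3 z"
    by (simp add: z sumsq3_def resid3_def power2_norm_eq_inner inner_diff inner_add inner_commute algebra_simps)
       (simp add: field_simps)
  finally show ?thesis by simp
qed

text \<open>If x1 = x2, then one fixed coordinate of x1 - x2 vanishes, which confines the sample to
  a hyperplane; \<open>undefined\<close> is just an arbitrary coordinate. This null set contains all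
  samples at which a denominator or the argument of a logarithm below is 0.\<close>

lemma AE_resid2_pos: "AE z in lborel. resid2 (z :: 'd::finite sample) > 0"
proof -
  define a :: "'d sample" where "a = (axis undefined 1, - axis undefined 1, 0)"
  have "a \<noteq> 0" by (simp add: a_def axis_eq_0_iff zero_prod_def)
  then have "negligible {z. a \<bullet> z = 0}" by (intro negligible_hyperplane) simp
  then have "{z. a \<bullet> z = 0} \<in> null_sets lebesgue" by (simp add: negligible_iff_null_sets)
  then have "AE z in lebesgue. a \<bullet> z \<noteq> 0" by (auto dest!: AE_not_in)
  then have "AE z in lborel. a \<bullet> z \<noteq> 0" by (simp add: AE_completion_iff)
  then show ?thesis
  proof (rule eventually_mono)
    fix z assume "a \<bullet> z \<noteq> 0"
    then show "resid2 z > 0"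
      by (auto simp: a_def resid2_def inner_diff_left inner_minus_left split: prod.splits)
  qed
qed

lemma nn_integral_sample_prod:
  fixes a b c :: "real^'d \<Rightarrow> real"
  assumes [measurable]: "a \<in> borel_measurable borel" "b \<in> borel_measurable borel" "c \<in> borel_measurable borel"
    and nn: "\<And>x. a x \<ge> 0" "\<And>x. b x \<ge> 0" "\<And>x. c x \<ge> 0" "A \<ge> 0" "B \<ge> 0" 
    and int: "(\<integral>\<^sup>+x. ennreal (a x) \<partial>lborel) = ennreal A" "(\<integral>\<^sup>+x. ennreal (b x) \<partial>lborel) = ennreal B"
      "(\<integral>\<^sup>+x. ennreal (c x) \<partial>lborel) = ennreal C"
  shows "(\<integral>\<^sup>+z. ennreal (case z of (x1, x2, y) \<Rightarrow> a x1 * b x2 * c y) \<partial>lborel) = ennreal (A * B * C)"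
proof -
  have "(\<integral>\<^sup>+z. ennreal (case z of (x1, x2, y) \<Rightarrow> a x1 * b x2 * c y) \<partial>lborel)
    = (\<integral>\<^sup>+x. \<integral>\<^sup>+y. \<integral>\<^sup>+z. ennreal (a x) * ennreal (b y) * ennreal (c z) \<partial>lborel \<partial>lborel \<partial>lborel)"
    using nn by (subst nn_integral_lborel_triple) (auto simp: borel_prod[symmetric] ennreal_mult')
  also have "\<dots> = ennreal A * ennreal B * ennreal C"
    by (simp add: nn_integral_cmult nn_integral_multc int)
  also have "\<dots> = ennreal (A * B * C)" using nn by (simp add: ennreal_mult')
  finally show ?thesis .
qed

context
  fixes mu :: "real^'d" and eta :: real
  assumes eta: "eta > 0"
begin

lemma nn_integral_sample_density: "(\<integral>\<^sup>+z. ennreal (sample_density mu eta z) \<partial>lborel) = 1"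
  using nn_integral_sample_prod[of "tilt mu eta 0" "tilt mu eta 0" "tilt mu eta 0" 1 1 1]
    nn_integral_tilt[OF eta, of 0 mu]
  by (simp add: mgf_0 tilt_0 sample_density_def phi_def)

lemma nn_integral_exp_sumsq2:
  assumes r: "0 \<le> r" "r < 1"
  shows "(\<integral>\<^sup>+z. ennreal (sample_density mu eta z * exp (- (eta / 2 * sumsq2 z) * (r / (1 - r)))) \<partial>lborel) = ennreal ((mgf mu eta r)\<^sup>2)"
proof -
  have "sample_density mu eta z * exp (- (eta / 2 * sumsq2 z) * (r / (1 - r))) =
     (case z of (x1, x2, y) \<Rightarrow> tilt mu eta r x1 * tilt mu eta r x2 * tilt mu eta 0 y)" for z
    by (auto simp: sample_density_def sumsq2_def tilt_def algebra_simps add_divide_distrib exp_add[symmetric] split: prod.splits)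
  then show ?thesis
    using nn_integral_sample_prod[of "tilt mu eta r" "tilt mu eta r" "tilt mu eta 0" "mgf mu eta r" "mgf mu eta r" 1]
      nn_integral_tilt[OF eta, of 0 mu] nn_integral_tilt[OF eta r, of mu] mgf_pos[of r mu eta] r
    by (simp add: tilt_nonneg mgf_0 power2_eq_square)
qed

lemma sample_density_tilt3:
  "sample_density mu eta z * exp (- (eta / 2 * sumsq3 z) * (r / (1 - r))) =
     (case z of (x1, x2, y) \<Rightarrow> tilt mu eta r x1 * tilt mu eta r x2 * tilt mu eta r y)"
  by (auto simp: sample_density_def sumsq3_def tilt_def algebra_simps add_divide_distrib exp_add[symmetric] split: prod.splits)

lemma nn_integral_exp_sumsq3:
  assumes r: "0 \<le> r" "r < 1"
  shows "(\<integral>\<^sup>+z. ennreal (sample_density mu eta z * exp (- (eta / 2 * sumsq3 z) * (r / (1 - r)))) \<partial>lborel) = ennreal ((mgf mu eta r) ^ 3)"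
  unfolding sample_density_tilt3
  using nn_integral_sample_prod[of "tilt mu eta r" "tilt mu eta r" "tilt mu eta r" "mgf mu eta r" "mgf mu eta r" "mgf mu eta r"]
    nn_integral_tilt[OF eta r, of mu] mgf_pos[of r mu eta] r
  by (simp add: tilt_nonneg power3_eq_cube)

text \<open>Each of the three pairs contributes the same value, and the vector outside the pair
  supplies the third factor \<open>mgf\<close>.\<close>

lemma nn_integral_resid3_exp_sumsq3:
  assumes r: "0 \<le> r" "r < 1"
  shows "(\<integral>\<^sup>+z. ennreal (sample_density mu eta z * resid3 z * exp (- (eta / 2 * sumsq3 z) * (r / (1 - r)))) \<partial>lborel)
    = ennreal (2 * real CARD('d) * (1 - r) / eta * (mgf mu eta r) ^ 3)"
proof -
  define t where "t = tilt mu eta r"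
  have [measurable]: "t \<in> borel_measurable borel" unfolding t_def by measurable
  have t: "t x \<ge> 0" for x unfolding t_def by (rule tilt_nonneg)
  define D where "D = 2 * real CARD('d) * (1 - r) / eta * (mgf mu eta r)\<^sup>2"
  have D: "D \<ge> 0" using eta r by (simp add: D_def)
  have m: "mgf mu eta r > 0" using mgf_pos[of r mu eta] r by simp
  have T: "(\<integral>\<^sup>+x. ennreal (t x) \<partial>lborel) = ennreal (mgf mu eta r)"
    unfolding t_def by (rule nn_integral_tilt[OF eta r])
  have P: "(\<integral>\<^sup>+x. \<integral>\<^sup>+y. ennreal (t x * t y * (norm (x - y))\<^sup>2) \<partial>lborel \<partial>lborel) = ennreal D"
    unfolding t_def D_def by (rule nn_integral_tilt_pair[OF eta r])
  have 1: "(\<integral>\<^sup>+x. \<integral>\<^sup>+y. \<integral>\<^sup>+z. ennreal (t x * t y * t z * (norm (x - y))\<^sup>2) \<partial>lborel \<partial>lborel \<partial>lborel) = ennreal (D * mgf mu eta r)"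
  proof -
    have "(\<integral>\<^sup>+x. \<integral>\<^sup>+y. \<integral>\<^sup>+z. ennreal (t x * t y * t z * (norm (x - y))\<^sup>2) \<partial>lborel \<partial>lborel \<partial>lborel)
      = (\<integral>\<^sup>+x. \<integral>\<^sup>+y. \<integral>\<^sup>+z. ennreal (t x * t y * (norm (x - y))\<^sup>2) * ennreal (t z) \<partial>lborel \<partial>lborel \<partial>lborel)"
      using t by (simp add: ennreal_mult'[symmetric] mult_ac)
    also have "\<dots> = ennreal D * ennreal (mgf mu eta r)"
      by (simp add: nn_integral_cmult nn_integral_multc T P)
    finally show ?thesis using D by (simp add: ennreal_mult')
  qed
  have 2: "(\<integral>\<^sup>+x. \<integral>\<^sup>+y. \<integral>\<^sup>+z. ennreal (t x * t y * t z * (norm (x - z))\<^sup>2) \<partial>lborel \<partial>lborel \<partial>lborel) = ennreal (D * mgf mu eta r)"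
  proof -
    have "(\<integral>\<^sup>+x. \<integral>\<^sup>+y. \<integral>\<^sup>+z. ennreal (t x * t y * t z * (norm (x - z))\<^sup>2) \<partial>lborel \<partial>lborel \<partial>lborel)
      = (\<integral>\<^sup>+x. \<integral>\<^sup>+y. \<integral>\<^sup>+z. ennreal (t y) * ennreal (t x * t z * (norm (x - z))\<^sup>2) \<partial>lborel \<partial>lborel \<partial>lborel)"
      using t by (simp add: ennreal_mult'[symmetric] mult_ac)
    also have "\<dots> = ennreal (mgf mu eta r) * ennreal D"
      by (simp add: nn_integral_cmult nn_integral_multc T P)
    finally show ?thesis using D m by (simp add: ennreal_mult' mult.commute)
  qed
  have 3: "(\<integral>\<^sup>+x. \<integral>\<^sup>+y. \<integral>\<^sup>+z. ennreal (t x * t y * t z * (norm (y - z))\<^sup>2) \<partial>lborel \<partial>lborel \<partial>lborel) = ennreal (D * mgf mu eta r)"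
  proof -
    have "(\<integral>\<^sup>+x. \<integral>\<^sup>+y. \<integral>\<^sup>+z. ennreal (t x * t y * t z * (norm (y - z))\<^sup>2) \<partial>lborel \<partial>lborel \<partial>lborel)
      = (\<integral>\<^sup>+x. \<integral>\<^sup>+y. \<integral>\<^sup>+z. ennreal (t x) * ennreal (t y * t z * (norm (y - z))\<^sup>2) \<partial>lborel \<partial>lborel \<partial>lborel)"
      using t by (simp add: ennreal_mult'[symmetric] mult_ac)
    also have "\<dots> = ennreal (mgf mu eta r) * ennreal D"
      by (simp add: nn_integral_cmult nn_integral_multc T P)
    finally show ?thesis using D m by (simp add: ennreal_mult' mult.commute)
  qed
  have "sample_density mu eta z * resid3 z * exp (- (eta / 2 * sumsq3 z) * (r / (1 - r))) =
      resid3 z * (sample_density mu eta z * exp (- (eta / 2 * sumsq3 z) * (r / (1 - r))))" for z by simp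
  also have "\<dots> z = (case z of (x1, x2, y) \<Rightarrow> t x1 * t x2 * t y * (((norm (x1 - x2))\<^sup>2 + (norm (x1 - y))\<^sup>2 + (norm (x2 - y))\<^sup>2) / 3))" for z
    unfolding sample_density_tilt3 t_def by (auto simp: resid3_def split: prod.splits)
  finally have "(\<integral>\<^sup>+z. ennreal (sample_density mu eta z * resid3 z * exp (- (eta / 2 * sumsq3 z) * (r / (1 - r)))) \<partial>lborel)
    = (\<integral>\<^sup>+z. ennreal (case z of (x1, x2, y) \<Rightarrow> t x1 * t x2 * t y * (((norm (x1 - x2))\<^sup>2 + (norm (x1 - y))\<^sup>2 + (norm (x2 - y))\<^sup>2) / 3)) \<partial>lborel)"
    by simp
  also have "\<dots> = (\<integral>\<^sup>+x. \<integral>\<^sup>+y. \<integral>\<^sup>+z. ennreal (1/3) * (ennreal (t x * t y * t z * (norm (x - y))\<^sup>2)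
      + ennreal (t x * t y * t z * (norm (x - z))\<^sup>2) + ennreal (t x * t y * t z * (norm (y - z))\<^sup>2)) \<partial>lborel \<partial>lborel \<partial>lborel)"
    using t by (subst nn_integral_lborel_triple)
      (auto simp: borel_prod[symmetric] algebra_simps add_divide_distrib simp flip: ennreal_mult' ennreal_plus)
  also have "\<dots> = ennreal (1/3) * (ennreal (D * mgf mu eta r) + ennreal (D * mgf mu eta r) + ennreal (D * mgf mu eta r))"
    by (simp add: nn_integral_cmult nn_integral_add 1 2 3)
  also have "\<dots> = ennreal (D * mgf mu eta r)"
    using D m by (simp flip: ennreal_mult' ennreal_plus)
  finally show ?thesis
    by (simp add: D_def power2_eq_square power3_eq_cube mult_ac)
qed

end

section \<open>Expectations as integrals over the unit interval\<close>

lemma mgf_square: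
  fixes mu :: "real^'d"
  assumes r: "r < 1"
  shows "(mgf mu eta r)\<^sup>2 = (1 - r) ^ (CARD('d) - 1) * exp (- (eta * (norm mu)\<^sup>2) * r) * (1 - r)"
proof -
  have "((1 - r) powr (real CARD('d) / 2))\<^sup>2 = (1 - r) ^ CARD('d)"
    using r by (simp add: power2_eq_square powr_realpow flip: powr_add)
  also have "\<dots> = (1 - r) ^ (CARD('d) - 1) * (1 - r)"
    by (subst power_Suc2[symmetric]) simp
  moreover have "(exp (- (eta / 2) * (r * (norm mu)\<^sup>2)))\<^sup>2 = exp (- (eta * (norm mu)\<^sup>2) * r)"
    by (simp add: power2_eq_square mult_ac flip: exp_add)
  ultimately show ?thesis
    by (simp only: mgf_def power_mult_distrib mult_ac)
qed

text \<open>As in \<open>mgf_square\<close>, one factor 1 - r is split off: it cancels the 1 - r in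
  the Frullani weight, and also the one that is left from 1/(1 - r)^2 in the expectation of
  resid3/sumsq3.\<close>

lemma mgf_cube:
  fixes mu :: "real^'d"
  assumes r: "r < 1"
  shows "(mgf mu eta r) ^ 3 = (1 - r) powr (3 * real CARD('d) / 2 - 1) * exp (- 3 * (eta * (norm mu)\<^sup>2) * r / 2) * (1 - r)"
proof -
  have "((1 - r) powr (real CARD('d) / 2)) ^ 3 = (1 - r) powr ((3 * real CARD('d) / 2 - 1) + 1)"
    by (simp add: power3_eq_cube flip: powr_add)
  also have "\<dots> = (1 - r) powr (3 * real CARD('d) / 2 - 1) * (1 - r)"
    unfolding powr_add using r by simp
  moreover have "(exp (- (eta / 2) * (r * (norm mu)\<^sup>2))) ^ 3 = exp (- 3 * (eta * (norm mu)\<^sup>2) * r / 2)"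
    by (simp add: power3_eq_cube mult_ac flip: exp_add)
  ultimately show ?thesis
    by (simp only: mgf_def power_mult_distrib mult_ac)
qed

context
  fixes mu :: "real^'d" and eta :: real
  assumes eta: "eta > 0"
begin

text \<open>Integrability of the logarithm is not known at this stage, so everything stays in
  nonnegative integrals: sumsq2 <= sumsq3 makes the Frullani integrand nonnegative, and Tonelli's
  theorem applies unconditionally. Only the difference of the two transforms needs finiteness, which
  holds for each fixed r.\<close>

lemma nn_integral_ln_sumsq_ratio:
  "(\<integral>\<^sup>+z. ennreal (sample_density mu eta z * ln (sumsq3 z / sumsq2 z)) \<partial>lborel)
    = (\<integral>\<^sup>+r\<in>{0<..<1}. ennreal (((1 - r) ^ (CARD('d) - 1) * exp (- (eta * (norm mu)\<^sup>2) * r)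
        - (1 - r) powr (3 * real CARD('d) / 2 - 1) * exp (- 3 * (eta * (norm mu)\<^sup>2) * r / 2)) / r) \<partial>lborel)"
proof -
  define e2 e3 where "e2 r z = sample_density mu eta z * exp (- (eta / 2 * sumsq2 z) * (r / (1 - r)))"
    and "e3 r z = sample_density mu eta z * exp (- (eta / 2 * sumsq3 z) * (r / (1 - r)))" for r and z :: "'d sample"
  have [measurable]: "(\<lambda>(r, z). e2 r z) \<in> borel_measurable (borel \<Otimes>\<^sub>M borel)"
      "(\<lambda>(r, z). e3 r z) \<in> borel_measurable (borel \<Otimes>\<^sub>M borel)"
    unfolding e2_def e3_def by measurable
  have e: "0 \<le> e3 r z" "e3 r z \<le> e2 r z" if "0 < r" "r < 1" for r z
  proof -
    have "eta / 2 * sumsq2 z * (r / (1 - r)) \<le> eta / 2 * sumsq3 z * (r / (1 - r))"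
      using that eta sumsq2_le_sumsq3[of z] by (intro mult_right_mono mult_left_mono) auto
    then show "e3 r z \<le> e2 r z"
      unfolding e2_def e3_def by (intro mult_left_mono sample_nonneg) simp
    show "0 \<le> e3 r z" by (simp add: e3_def sample_nonneg)
  qed
  have "(\<integral>\<^sup>+z. ennreal (sample_density mu eta z * ln (sumsq3 z / sumsq2 z)) \<partial>lborel)
    = (\<integral>\<^sup>+z. (\<integral>\<^sup>+r. ennreal ((e2 r z - e3 r z) / (r * (1 - r))) * indicator {0<..<1} r \<partial>lborel) \<partial>lborel)"
  proof (intro nn_integral_cong_AE eventually_mono[OF AE_resid2_pos])
    fix z :: "'d sample" assume "resid2 z > 0"
    then have T: "sumsq2 z > 0" "sumsq3 z > 0"
      using resid2_le_sumsq2[of z] sumsq2_le_sumsq3[of z] by auto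
    have "ennreal (sample_density mu eta z * ln (sumsq3 z / sumsq2 z))
        = ennreal (sample_density mu eta z) * ennreal (ln ((eta / 2 * sumsq3 z) / (eta / 2 * sumsq2 z)))"
      using eta by (subst ennreal_mult'[symmetric]) (auto simp: sample_nonneg)
    also have "\<dots> = ennreal (sample_density mu eta z) *
       (\<integral>\<^sup>+r. ennreal ((exp (- (eta / 2 * sumsq2 z) * (r / (1 - r))) - exp (- (eta / 2 * sumsq3 z) * (r / (1 - r)))) / (r * (1 - r)))
          * indicator {0<..<1} r \<partial>lborel)"
      using eta T sumsq2_le_sumsq3[of z] by (subst nn_integral_frullani_odds) auto
    also have "\<dots> = (\<integral>\<^sup>+r. ennreal ((e2 r z - e3 r z) / (r * (1 - r))) * indicator {0<..<1} r \<partial>lborel)"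
      by (subst nn_integral_cmult[symmetric], measurable)
         (simp add: e2_def e3_def sample_nonneg flip: mult.assoc ennreal_mult' right_diff_distrib)
    finally show "ennreal (sample_density mu eta z * ln (sumsq3 z / sumsq2 z))
      = (\<integral>\<^sup>+r. ennreal ((e2 r z - e3 r z) / (r * (1 - r))) * indicator {0<..<1} r \<partial>lborel)" .
  qed
  also have "\<dots> = (\<integral>\<^sup>+r. (\<integral>\<^sup>+z. ennreal ((e2 r z - e3 r z) / (r * (1 - r))) * indicator {0<..<1} r \<partial>lborel) \<partial>lborel)"
    by (rule lborel_pair.Fubini') measurable
  also have "\<dots> = (\<integral>\<^sup>+r\<in>{0<..<1}. ennreal (((1 - r) ^ (CARD('d) - 1) * exp (- (eta * (norm mu)\<^sup>2) * r)
        - (1 - r) powr (3 * real CARD('d) / 2 - 1) * exp (- 3 * (eta * (norm mu)\<^sup>2) * r / 2)) / r) \<partial>lborel)"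
  proof (intro nn_integral_cong)
    fix r :: real
    show "(\<integral>\<^sup>+z. ennreal ((e2 r z - e3 r z) / (r * (1 - r))) * indicator {0<..<1} r \<partial>lborel)
      = ennreal (((1 - r) ^ (CARD('d) - 1) * exp (- (eta * (norm mu)\<^sup>2) * r)
        - (1 - r) powr (3 * real CARD('d) / 2 - 1) * exp (- 3 * (eta * (norm mu)\<^sup>2) * r / 2)) / r) * indicator {0<..<1} r"
    proof (cases "0 < r \<and> r < 1")
      case True
      then have r: "0 < r" "r < 1" by auto
      define c where "c = 1 / (r * (1 - r))"
      have c: "c \<ge> 0" using r by (simp add: c_def)
      have m: "mgf mu eta r > 0" using r by (simp add: mgf_pos)
      have "(\<integral>\<^sup>+z. ennreal ((e2 r z - e3 r z) / (r * (1 - r))) \<partial>lborel) = (\<integral>\<^sup>+z. ennreal c * (ennreal (e2 r z) - ennreal (e3 r z)) \<partial>lborel)"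
        using c e[OF r] by (simp add: c_def ennreal_minus flip: ennreal_mult')
      also have "\<dots> = ennreal c * (\<integral>\<^sup>+z. ennreal (e2 r z) - ennreal (e3 r z) \<partial>lborel)"
        by (rule nn_integral_cmult) measurable
      also have "(\<integral>\<^sup>+z. ennreal (e2 r z) - ennreal (e3 r z) \<partial>lborel)
         = (\<integral>\<^sup>+z. ennreal (e2 r z) \<partial>lborel) - (\<integral>\<^sup>+z. ennreal (e3 r z) \<partial>lborel)"
        using r e[OF r] nn_integral_exp_sumsq3[OF eta, of r mu]
        by (intro nn_integral_diff) (auto simp: e3_def[abs_def] intro!: ennreal_leI)
      also have "\<dots> = ennreal ((mgf mu eta r)\<^sup>2) - ennreal ((mgf mu eta r) ^ 3)"
        unfolding e2_def e3_def using nn_integral_exp_sumsq2[OF eta, of r mu] nn_integral_exp_sumsq3[OF eta, of r mu] r by simp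
      also have "ennreal c * \<dots> = ennreal (c * ((mgf mu eta r)\<^sup>2 - (mgf mu eta r) ^ 3))"
        using m c by (subst ennreal_minus) (auto simp: ennreal_mult')
      also have "c * ((mgf mu eta r)\<^sup>2 - (mgf mu eta r) ^ 3) = ((1 - r) ^ (CARD('d) - 1) * exp (- (eta * (norm mu)\<^sup>2) * r)
        - (1 - r) powr (3 * real CARD('d) / 2 - 1) * exp (- 3 * (eta * (norm mu)\<^sup>2) * r / 2)) / r"
        unfolding mgf_square[OF r(2)] mgf_cube[OF r(2)] c_def using r
        by (simp add: divide_simps) (simp add: algebra_simps)
      finally show ?thesis using r by simp
    qed auto
  qed
  finally show ?thesis .
qed

text \<open>The reciprocal of sumsq3 is written as an integral of exponentials by
  \<open>nn_integral_exp_odds\<close>; each exponential tilts the sample, and under the tilt resid3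
  has an explicit mean.\<close>

lemma nn_integral_resid_ratio:
  "(\<integral>\<^sup>+z. ennreal (sample_density mu eta z * (resid3 z / sumsq3 z)) \<partial>lborel)
    = ennreal (real CARD('d)) * (\<integral>\<^sup>+r\<in>{0<..<1}. ennreal ((1 - r) powr (3 * real CARD('d) / 2 - 1) * exp (- 3 * (eta * (norm mu)\<^sup>2) * r / 2)) \<partial>lborel)"
proof -
  define g where "g r z = sample_density mu eta z * resid3 z * exp (- (eta / 2 * sumsq3 z) * (r / (1 - r)))" for r and z :: "'d sample"
  have [measurable]: "(\<lambda>(r, z). g r z) \<in> borel_measurable (borel \<Otimes>\<^sub>M borel)"
    unfolding g_def by measurable
  have g: "g r z \<ge> 0" for r z by (simp add: g_def sample_nonneg)
  have "(\<integral>\<^sup>+z. ennreal (sample_density mu eta z * (resid3 z / sumsq3 z)) \<partial>lborel)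
    = (\<integral>\<^sup>+z. (\<integral>\<^sup>+r. ennreal (eta / 2 / (1 - r)\<^sup>2 * g r z) * indicator {0<..<1} r \<partial>lborel) \<partial>lborel)"
  proof (intro nn_integral_cong_AE eventually_mono[OF AE_resid2_pos])
    fix z :: "'d sample" assume "resid2 z > 0"
    then have T: "sumsq3 z > 0"
      using resid2_le_sumsq2[of z] sumsq2_le_sumsq3[of z] by auto
    define C where "C = eta / 2 * (sample_density mu eta z * resid3 z)"
    have C: "C \<ge> 0" using eta by (simp add: C_def sample_nonneg)
    have "ennreal (sample_density mu eta z * (resid3 z / sumsq3 z)) = ennreal C * ennreal (1 / (eta / 2 * sumsq3 z))"
      using eta C by (subst ennreal_mult'[symmetric]) (auto simp: C_def)
    also have "\<dots> = ennreal C * (\<integral>\<^sup>+r. ennreal (exp (- (eta / 2 * sumsq3 z) * (r / (1 - r))) / (1 - r)\<^sup>2) * indicator {0<..<1} r \<partial>lborel)"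
      using eta T by (subst nn_integral_exp_odds) auto
    also have "\<dots> = (\<integral>\<^sup>+r. ennreal (eta / 2 / (1 - r)\<^sup>2 * g r z) * indicator {0<..<1} r \<partial>lborel)"
    proof (subst nn_integral_cmult[symmetric], measurable, intro nn_integral_cong)
      fix r :: real
      have "eta / 2 / (1 - r)\<^sup>2 * g r z = C * (exp (- (eta / 2 * sumsq3 z) * (r / (1 - r))) / (1 - r)\<^sup>2)"
        by (simp add: g_def C_def)
      then show "ennreal C * (ennreal (exp (- (eta / 2 * sumsq3 z) * (r / (1 - r))) / (1 - r)\<^sup>2) * indicator {0<..<1} r)
        = ennreal (eta / 2 / (1 - r)\<^sup>2 * g r z) * indicator {0<..<1} r"
        by (simp only: ennreal_mult'[OF C] mult.assoc)
    qed
    finally show "ennreal (sample_density mu eta z * (resid3 z / sumsq3 z))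
      = (\<integral>\<^sup>+r. ennreal (eta / 2 / (1 - r)\<^sup>2 * g r z) * indicator {0<..<1} r \<partial>lborel)" .
  qed
  also have "\<dots> = (\<integral>\<^sup>+r. (\<integral>\<^sup>+z. ennreal (eta / 2 / (1 - r)\<^sup>2 * g r z) * indicator {0<..<1} r \<partial>lborel) \<partial>lborel)"
    by (rule lborel_pair.Fubini') measurable
  also have "\<dots> = (\<integral>\<^sup>+r. ennreal (real CARD('d)) * (ennreal ((1 - r) powr (3 * real CARD('d) / 2 - 1) * exp (- 3 * (eta * (norm mu)\<^sup>2) * r / 2)) * indicator {0<..<1} r) \<partial>lborel)"
  proof (intro nn_integral_cong)
    fix r :: real
    show "(\<integral>\<^sup>+z. ennreal (eta / 2 / (1 - r)\<^sup>2 * g r z) * indicator {0<..<1} r \<partial>lborel)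
      = ennreal (real CARD('d)) * (ennreal ((1 - r) powr (3 * real CARD('d) / 2 - 1) * exp (- 3 * (eta * (norm mu)\<^sup>2) * r / 2)) * indicator {0<..<1} r)"
    proof (cases "0 < r \<and> r < 1")
      case True
      then have r: "0 < r" "r < 1" by auto
      have c: "eta / 2 / (1 - r)\<^sup>2 \<ge> 0" using eta by simp
      have "(\<integral>\<^sup>+z. ennreal (eta / 2 / (1 - r)\<^sup>2 * g r z) \<partial>lborel) = ennreal (eta / 2 / (1 - r)\<^sup>2) * (\<integral>\<^sup>+z. ennreal (g r z) \<partial>lborel)"
        unfolding ennreal_mult'[OF c] by (rule nn_integral_cmult) measurable
      also have "(\<integral>\<^sup>+z. ennreal (g r z) \<partial>lborel) = ennreal (2 * real CARD('d) * (1 - r) / eta * (mgf mu eta r) ^ 3)"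
        unfolding g_def using nn_integral_resid3_exp_sumsq3[OF eta, of r mu] r by simp
      also have "ennreal (eta / 2 / (1 - r)\<^sup>2) * \<dots> = ennreal (eta / 2 / (1 - r)\<^sup>2 * (2 * real CARD('d) * (1 - r) / eta * (mgf mu eta r) ^ 3))"
        by (rule ennreal_mult'[OF c, symmetric])
      also have "eta / 2 / (1 - r)\<^sup>2 * (2 * real CARD('d) * (1 - r) / eta * (mgf mu eta r) ^ 3)
        = real CARD('d) * ((1 - r) powr (3 * real CARD('d) / 2 - 1) * exp (- 3 * (eta * (norm mu)\<^sup>2) * r / 2))"
        unfolding mgf_cube[OF r(2)] using r eta by (simp add: power2_eq_square)
      finally show ?thesis using r by (simp add: ennreal_mult')
    qed auto
  qed
  also have "\<dots> = ennreal (real CARD('d)) * (\<integral>\<^sup>+r\<in>{0<..<1}. ennreal ((1 - r) powr (3 * real CARD('d) / 2 - 1) * exp (- 3 * (eta * (norm mu)\<^sup>2) * r / 2)) \<partial>lborel)"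
    by (rule nn_integral_cmult) measurable
  finally show ?thesis .
qed

lemma integrable_sample_density: "integrable lborel (sample_density mu eta)" "(\<integral>z. sample_density mu eta z \<partial>lborel) = 1"
proof -
  show i: "integrable lborel (sample_density mu eta)"
    using nn_integral_sample_density[OF eta, of mu] by (intro integrableI_nonneg) (auto simp: sample_nonneg)
  show "(\<integral>z. sample_density mu eta z \<partial>lborel) = 1"
    using nn_integral_sample_density[OF eta, of mu] nn_integral_eq_integral[OF i]
    by (simp add: sample_nonneg)
qed

lemma integrable_resid_ratio: "integrable lborel (\<lambda>z. sample_density mu eta z * (resid3 z / sumsq3 z))"
proof (rule Bochner_Integration.integrable_bound[OF integrable_sample_density(1)])
  have "resid3 z / sumsq3 z \<le> 1" for z :: "'d sample"
    using resid3_le_sumsq3[of z] sample_nonneg(3)[of z] by (auto simp: divide_le_eq_1)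
  then have "sample_density mu eta z * (resid3 z / sumsq3 z) \<le> sample_density mu eta z * 1" for z :: "'d sample"
    by (intro mult_left_mono sample_nonneg)
  then show "AE z in lborel. norm (sample_density mu eta z * (resid3 z / sumsq3 z)) \<le> norm (sample_density mu eta z)"
    by (simp add: sample_nonneg)
qed measurable

text \<open>This positivity turns the difference between 0.71 and 0.705 into a strict inequality of
  risks.\<close>

lemma integral_resid_ratio_pos: "0 < (\<integral>z. sample_density mu eta z * (resid3 z / sumsq3 z) \<partial>lborel)"
proof -
  have nn: "AE z in lborel. 0 \<le> sample_density mu eta z * (resid3 z / sumsq3 z)"
    by (simp add: sample_nonneg)
  have pos: "AE z in lborel. 0 < sample_density mu eta z * (resid3 z / sumsq3 z)"
  proof (rule eventually_mono[OF AE_resid2_pos])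
    fix z :: "'d sample" assume "resid2 z > 0"
    then show "0 < sample_density mu eta z * (resid3 z / sumsq3 z)"
      using resid2_le_resid3[of z] resid3_le_sumsq3[of z] eta
      by (auto simp: sample_density_def phi_def split: prod.splits)
  qed
  have "(\<integral>z. sample_density mu eta z * (resid3 z / sumsq3 z) \<partial>lborel) \<noteq> 0"
  proof
    assume "(\<integral>z. sample_density mu eta z * (resid3 z / sumsq3 z) \<partial>lborel) = 0"
    then have "AE z in lborel. sample_density mu eta z * (resid3 z / sumsq3 z) = 0"
      using integral_nonneg_eq_0_iff_AE[OF integrable_resid_ratio nn] by simp
    with pos have "AE z in (lborel :: 'd sample measure). False"
      by eventually_elim linarith
    then show False
      by (simp add: AE_iff_null null_sets_def)
  qed
  then show ?thesis
    using integral_nonneg_AE[OF nn] by simp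
qed

lemma ln_sumsq_ratio_bound:
  shows integrable_ln_sumsq_ratio: "integrable lborel (\<lambda>z. sample_density mu eta z * ln (sumsq3 z / sumsq2 z))" (is ?I)
    and integral_ln_sumsq_ratio_le: "(\<integral>z. sample_density mu eta z * ln (sumsq3 z / sumsq2 z) \<partial>lborel)
      \<le> ln (3/2) + 141/200 / real CARD('d) * (\<integral>z. sample_density mu eta z * (resid3 z / sumsq3 z) \<partial>lborel)" (is ?L)
proof -
  define J where "J = (\<integral>z. sample_density mu eta z * (resid3 z / sumsq3 z) \<partial>lborel)"
  define B where "B = (\<integral>\<^sup>+r\<in>{0<..<1}. ennreal ((1 - r) powr (3 * real CARD('d) / 2 - 1) * exp (- 3 * (eta * (norm mu)\<^sup>2) * r / 2)) \<partial>lborel)"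
  have J: "ennreal J = ennreal (real CARD('d)) * B"
    unfolding J_def B_def nn_integral_resid_ratio[symmetric]
    by (intro nn_integral_eq_integral[symmetric] integrable_resid_ratio) (simp add: sample_nonneg)
  have J0: "J > 0" unfolding J_def by (rule integral_resid_ratio_pos)
  have B: "B = ennreal (J / real CARD('d))"
  proof -
    have "ennreal (J / real CARD('d)) = ennreal (1 / real CARD('d)) * ennreal J"
      by (simp flip: ennreal_mult')
    also have "\<dots> = ennreal (1 / real CARD('d) * real CARD('d)) * B"
      unfolding J by (subst ennreal_mult') (simp_all only: mult.assoc, simp)
    finally show ?thesis by simp
  qed
  \<comment> \<open>Where sumsq2 vanishes, the quotient is 0 by the convention for division, and its
    logarithm is 0 as well.\<close>
  have nn: "0 \<le> sample_density mu eta z * ln (sumsq3 z / sumsq2 z)" for z :: "'d sample"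
  proof (cases "sumsq2 z = 0")
    case False
    then have "sumsq2 z > 0" using sample_nonneg(2)[of z] by auto
    then show ?thesis
      using sumsq2_le_sumsq3[of z] by (intro mult_nonneg_nonneg sample_nonneg ln_ge_zero) auto
  qed simp
  have le: "(\<integral>\<^sup>+z. ennreal (sample_density mu eta z * ln (sumsq3 z / sumsq2 z)) \<partial>lborel)
     \<le> ennreal (ln (3/2) + 141/200 / real CARD('d) * J)"
  proof -
    have "(\<integral>\<^sup>+z. ennreal (sample_density mu eta z * ln (sumsq3 z / sumsq2 z)) \<partial>lborel) \<le> ennreal (ln (3/2)) + ennreal (141/200) * B"
      unfolding nn_integral_ln_sumsq_ratio B_def using eta by (intro laplace_log_ratio_bound) auto
    also have "\<dots> = ennreal (ln (3/2) + 141/200 / real CARD('d) * J)"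
      unfolding B using J0 by (simp flip: ennreal_mult' ennreal_plus)
    finally show ?thesis .
  qed
  \<comment> \<open>The bound is finite, so the same estimate also yields integrability of the
    logarithm.\<close>
  show i: ?I
    by (rule integrableI_nonneg) (use nn le in \<open>auto intro: le_less_trans\<close>)
  have "(\<integral>\<^sup>+z. ennreal (sample_density mu eta z * ln (sumsq3 z / sumsq2 z)) \<partial>lborel)
      = ennreal (\<integral>z. sample_density mu eta z * ln (sumsq3 z / sumsq2 z) \<partial>lborel)"
    by (rule nn_integral_eq_integral[OF i]) (simp add: nn)
  with le have "ennreal (\<integral>z. sample_density mu eta z * ln (sumsq3 z / sumsq2 z) \<partial>lborel)
      \<le> ennreal (ln (3/2) + 141/200 / real CARD('d) * J)"
    by (simp only:)
  moreover have "0 \<le> ln (3/2) + 141/200 / real CARD('d) * J"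
    using J0 by (intro add_nonneg_nonneg) auto
  ultimately show ?L
    unfolding J_def[symmetric] by (simp only: ennreal_le_iff)
qed

end

section \<open>Integrability of the risks and domination\<close>

context
  fixes mu :: "real^'d" and eta :: real
  assumes eta: "eta > 0"
begin

text \<open>Controls how often x1 and x2 are close, which is where ln resid2 is singular. A normal
  density is bounded, so integrating over x2 gives (eta/\<rho>)^(d/2), while 1 is a trivial bound.
  The exponent 1/4 lies below d/2 for every d, so one of the two always implies the claim.\<close>

lemma nn_integral_exp_resid2_le:
  assumes \<rho>: "\<rho> > 0"
  shows "(\<integral>\<^sup>+z. ennreal (sample_density mu eta z * exp (- resid2 z * \<rho>)) \<partial>lborel) \<le> ennreal ((eta / \<rho>) powr (1/4))"
proof -
  define q where "q = real CARD('d) / 2"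
  have q: "q \<ge> 1/4"
    using zero_less_card_finite[where 'a = 'd] unfolding q_def by linarith
  have phi1: "(\<integral>\<^sup>+x. ennreal (phi x mu (1 / eta)) \<partial>lborel) = 1"
    using nn_integral_tilt[OF eta, of 0 mu] by (simp add: tilt_0 mgf_0)
  have le1: "(\<integral>\<^sup>+z. ennreal (sample_density mu eta z * exp (- resid2 z * \<rho>)) \<partial>lborel) \<le> 1"
  proof -
    have "(\<integral>\<^sup>+z. ennreal (sample_density mu eta z * exp (- resid2 z * \<rho>)) \<partial>lborel) \<le> (\<integral>\<^sup>+z. ennreal (sample_density mu eta z) \<partial>lborel)"
      using \<rho> by (intro nn_integral_mono ennreal_leI mult_left_le) (auto simp: sample_nonneg)
    then show ?thesis by (simp add: nn_integral_sample_density[OF eta])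
  qed
  have inner: "(\<integral>\<^sup>+y. ennreal (phi y mu (1 / eta) * exp (- \<rho> / 2 * (norm (y - x))\<^sup>2)) \<partial>lborel) \<le> ennreal ((eta / \<rho>) powr q)" for x
  proof -
    define C where "C = (2 * pi / eta) powr (- q)"
    have C: "C \<ge> 0" by (simp add: C_def)
    have "phi y mu (1 / eta) \<le> C" for y
      using eta unfolding phi_def C_def q_def by (intro order.trans[OF mult_left_le]) auto
    then have "(\<integral>\<^sup>+y. ennreal (phi y mu (1 / eta) * exp (- \<rho> / 2 * (norm (y - x))\<^sup>2)) \<partial>lborel)
      \<le> (\<integral>\<^sup>+y. ennreal C * ennreal (exp (- (\<rho> / 2) * (norm (y - x))\<^sup>2)) \<partial>lborel)"
      using C by (intro nn_integral_mono) (auto simp flip: ennreal_mult' intro!: ennreal_leI)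
    also have "\<dots> = ennreal C * ennreal ((pi / (\<rho> / 2)) powr q)"
      using \<rho> by (subst nn_integral_cmult, measurable) (subst nn_integral_gauss_vec, auto simp: q_def)
    also have "\<dots> = ennreal ((eta / \<rho>) powr q)"
    proof -
      have "C * (pi / (\<rho> / 2)) powr q = (eta / \<rho>) powr q"
        unfolding C_def using eta \<rho> by (simp add: powr_minus powr_divide powr_mult)
      then show ?thesis using C by (simp flip: ennreal_mult')
    qed
    finally show ?thesis .
  qed
  have le2: "(\<integral>\<^sup>+z. ennreal (sample_density mu eta z * exp (- resid2 z * \<rho>)) \<partial>lborel) \<le> ennreal ((eta / \<rho>) powr q)"
  proof -
    have nn: "phi x mu (1 / eta) \<ge> 0" for x by (simp add: phi_def)
    have "(\<integral>\<^sup>+z. ennreal (sample_density mu eta z * exp (- resid2 z * \<rho>)) \<partial>lborel)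
      = (\<integral>\<^sup>+x1. \<integral>\<^sup>+x2. \<integral>\<^sup>+y. ennreal (phi x1 mu (1 / eta)) * (ennreal (phi x2 mu (1 / eta) * exp (- \<rho> / 2 * (norm (x2 - x1))\<^sup>2))
          * ennreal (phi y mu (1 / eta))) \<partial>lborel \<partial>lborel \<partial>lborel)"
      by (subst nn_integral_lborel_triple, measurable)
         (auto simp: sample_density_def resid2_def nn norm_minus_commute mult_ac simp flip: ennreal_mult')
    also have "\<dots> = (\<integral>\<^sup>+x1. ennreal (phi x1 mu (1 / eta)) * (\<integral>\<^sup>+x2. ennreal (phi x2 mu (1 / eta) * exp (- \<rho> / 2 * (norm (x2 - x1))\<^sup>2)) \<partial>lborel) \<partial>lborel)"
      by (simp add: nn_integral_cmult nn_integral_multc phi1)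
    also have "\<dots> \<le> (\<integral>\<^sup>+x1. ennreal (phi x1 mu (1 / eta)) * ennreal ((eta / \<rho>) powr q) \<partial>lborel)"
      using inner by (intro nn_integral_mono mult_left_mono) auto
    also have "\<dots> = ennreal ((eta / \<rho>) powr q)"
      by (simp add: nn_integral_multc phi1)
    finally show ?thesis .
  qed
  show ?thesis
  proof (cases "eta / \<rho> \<le> 1")
    case True
    have "(eta / \<rho>) powr q \<le> (eta / \<rho>) powr (1/4)"
      using True eta \<rho> q by (intro powr_mono') auto
    then show ?thesis using le2 by (meson ennreal_leI order_trans)
  next
    case False
    then have "1 \<le> (eta / \<rho>) powr (1/4)"
      by (intro ge_one_powr_ge_zero) auto
    then have "ennreal 1 \<le> ennreal ((eta / \<rho>) powr (1/4))" by (rule ennreal_leI)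
    then show ?thesis using le1 by (simp add: order_trans)
  qed
qed

text \<open>ln ((1 + s)/s) stands in for |ln s| near 0: it is nonnegative and has a Frullani
  representation with parameters s and 1 + s. After Tonelli's theorem only the behaviour in r
  matters, which is bounded for r <= 1/2 and of order (1 - r)^(1/4 - 1) near 1.\<close>

lemma integrable_ln_resid2:
  "integrable lborel (\<lambda>z. sample_density mu eta z * ln ((1 + resid2 z) / resid2 z))"
proof (rule integrableI_nonneg)
  define f where "f r z = sample_density mu eta z * ((exp (- resid2 z * (r / (1 - r))) - exp (- (1 + resid2 z) * (r / (1 - r)))) / (r * (1 - r)))"
    for r and z :: "'d sample"
  have [measurable]: "(\<lambda>(r, z). f r z) \<in> borel_measurable (borel \<Otimes>\<^sub>M borel)"
    unfolding f_def by measurable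
  define C where "C = 2 * (2 * eta) powr (1/4)"
  have C: "C \<ge> 0" by (simp add: C_def)
  show "AE z in lborel. 0 \<le> sample_density mu eta z * ln ((1 + resid2 z) / resid2 z)"
    using AE_resid2_pos
    by (rule eventually_mono) (auto intro!: mult_nonneg_nonneg ln_ge_zero simp: sample_nonneg)
  have fle: "(\<integral>\<^sup>+z. ennreal (f r z) \<partial>lborel) \<le> ennreal (4 + C * (1 - r) powr (1/4 - 1))" if r: "0 < r" "r < 1" for r
  proof -
    define \<rho> where "\<rho> = r / (1 - r)"
    have \<rho>: "\<rho> > 0" using r by (simp add: \<rho>_def)
    have f: "f r z = sample_density mu eta z * exp (- resid2 z * \<rho>) * ((1 - exp (- \<rho>)) / (r * (1 - r)))" for z
    proof -
      have "exp (- (1 + resid2 z) * \<rho>) = exp (- resid2 z * \<rho>) * exp (- \<rho>)"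
        unfolding exp_add[symmetric] by (simp add: algebra_simps)
      then show ?thesis unfolding f_def \<rho>_def[symmetric] by (simp only:) (simp add: algebra_simps diff_divide_distrib)
    qed
    show ?thesis
    proof (cases "r \<le> 1/2")
      case True
      \<comment> \<open>For small r the factor 1 - exp(-\<rho>) <= \<rho> removes the pole at r =
        0.\<close>
      have "(1 - exp (- \<rho>)) / (r * (1 - r)) \<le> 4"
      proof -
        have "(1 - exp (- \<rho>)) / (r * (1 - r)) \<le> \<rho> / (r * (1 - r))"
          using r exp_ge_add_one_self[of "- \<rho>"] by (intro divide_right_mono) auto
        also have "\<dots> = 1 / (1 - r)\<^sup>2" using r by (simp add: \<rho>_def power2_eq_square)
        also have "\<dots> \<le> 1 / (1/2)\<^sup>2"
          using True by (intro divide_left_mono power_mono) auto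
        finally show ?thesis by (simp add: power2_eq_square)
      qed
      then have "f r z \<le> sample_density mu eta z * 1 * 4" for z
        unfolding f using r \<rho> by (intro mult_mono mult_left_mono) (auto simp: sample_nonneg)
      then have "(\<integral>\<^sup>+z. ennreal (f r z) \<partial>lborel) \<le> (\<integral>\<^sup>+z. ennreal (sample_density mu eta z) * ennreal 4 \<partial>lborel)"
        by (intro nn_integral_mono) (auto simp: sample_nonneg ennreal_mult'[symmetric] simp del: ennreal_numeral intro!: ennreal_leI)
      also have "\<dots> = ennreal 4"
        by (subst nn_integral_multc) (auto simp: nn_integral_sample_density[OF eta])
      also have "\<dots> \<le> ennreal (4 + C * (1 - r) powr (1/4 - 1))"
        using C by (intro ennreal_leI) simp
      finally show ?thesis .
    next
      case False
      have "(1 - exp (- \<rho>)) / (r * (1 - r)) \<le> 2 / (1 - r)"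
      proof -
        have "(1 - exp (- \<rho>)) / (r * (1 - r)) \<le> 1 / (r * (1 - r))"
          using r by (intro divide_right_mono) auto
        also have "\<dots> = (1 / r) / (1 - r)" by simp
        also have "\<dots> \<le> 2 / (1 - r)" using False r by (intro divide_right_mono) (auto simp: field_simps)
        finally show ?thesis .
      qed
      then have "f r z \<le> sample_density mu eta z * exp (- resid2 z * \<rho>) * (2 / (1 - r))" for z
        unfolding f by (intro mult_left_mono) (auto simp: sample_nonneg)
      then have "(\<integral>\<^sup>+z. ennreal (f r z) \<partial>lborel) \<le> (\<integral>\<^sup>+z. ennreal (sample_density mu eta z * exp (- resid2 z * \<rho>)) * ennreal (2 / (1 - r)) \<partial>lborel)"
        by (intro nn_integral_mono) (auto simp: sample_nonneg simp flip: ennreal_mult' intro!: ennreal_leI)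
      also have "\<dots> = (\<integral>\<^sup>+z. ennreal (sample_density mu eta z * exp (- resid2 z * \<rho>)) \<partial>lborel) * ennreal (2 / (1 - r))"
        by (rule nn_integral_multc) measurable
      also have "\<dots> \<le> ennreal ((eta / \<rho>) powr (1/4)) * ennreal (2 / (1 - r))"
        using nn_integral_exp_resid2_le[OF \<rho>] by (intro mult_right_mono) auto
      also have "\<dots> \<le> ennreal (((2 * eta) powr (1/4) * (1 - r) powr (1/4)) * (2 / (1 - r)))"
      proof -
        \<comment> \<open>For r > 1/2 the Laplace variable \<rho> is at least 1/(2 (1 - r)), so the
          transform decays like (1 - r)^(1/4) and softens the pole 1/(1 - r).\<close>
        have "eta / \<rho> \<le> (2 * eta) * (1 - r)"
        proof -
          have "1 / r \<le> 2" using False r by (simp add: field_simps)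
          then have "(eta * (1 - r)) * (1 / r) \<le> (eta * (1 - r)) * 2"
            using r eta by (intro mult_left_mono) auto
          then show ?thesis by (simp add: \<rho>_def mult_ac)
        qed
        then have "(eta / \<rho>) powr (1/4) \<le> ((2 * eta) * (1 - r)) powr (1/4)"
          using eta \<rho> by (intro powr_mono2) auto
        then have "(eta / \<rho>) powr (1/4) \<le> (2 * eta) powr (1/4) * (1 - r) powr (1/4)"
          by (simp only: powr_mult)
        then have "(eta / \<rho>) powr (1/4) * (2 / (1 - r)) \<le> ((2 * eta) powr (1/4) * (1 - r) powr (1/4)) * (2 / (1 - r))"
          using r by (intro mult_right_mono) auto
        then show ?thesis
          by (subst ennreal_mult'[symmetric], simp) (rule ennreal_leI)
      qed
      also have "((2 * eta) powr (1/4) * (1 - r) powr (1/4)) * (2 / (1 - r)) = C * (1 - r) powr (1/4 - 1)"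
      proof -
        have "(1 - r) powr (1/4 - 1) = (1 - r) powr (1/4) / (1 - r)"
          using r by (subst powr_diff) simp
        then show ?thesis by (simp only: C_def) simp
      qed
      also have "ennreal (C * (1 - r) powr (1/4 - 1)) \<le> ennreal (4 + C * (1 - r) powr (1/4 - 1))"
        by (intro ennreal_leI) simp
      finally show ?thesis .
    qed
  qed
  have "(\<integral>\<^sup>+z. ennreal (sample_density mu eta z * ln ((1 + resid2 z) / resid2 z)) \<partial>lborel)
    = (\<integral>\<^sup>+z. (\<integral>\<^sup>+r. ennreal (f r z) * indicator {0<..<1} r \<partial>lborel) \<partial>lborel)"
  proof (intro nn_integral_cong_AE eventually_mono[OF AE_resid2_pos])
    fix z :: "'d sample" assume s: "resid2 z > 0"
    have "ennreal (sample_density mu eta z * ln ((1 + resid2 z) / resid2 z))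
        = ennreal (sample_density mu eta z) * ennreal (ln ((1 + resid2 z) / resid2 z))"
      by (rule ennreal_mult') (rule sample_nonneg)
    also have "\<dots> = ennreal (sample_density mu eta z) * (\<integral>\<^sup>+r. ennreal ((exp (- resid2 z * (r / (1 - r))) - exp (- (1 + resid2 z) * (r / (1 - r)))) / (r * (1 - r))) * indicator {0<..<1} r \<partial>lborel)"
      using s by (subst nn_integral_frullani_odds) auto
    also have "\<dots> = (\<integral>\<^sup>+r. ennreal (f r z) * indicator {0<..<1} r \<partial>lborel)"
      unfolding f_def ennreal_mult'[OF sample_nonneg(1)] mult.assoc
      by (rule nn_integral_cmult[symmetric]) measurable
    finally show "ennreal (sample_density mu eta z * ln ((1 + resid2 z) / resid2 z))
      = (\<integral>\<^sup>+r. ennreal (f r z) * indicator {0<..<1} r \<partial>lborel)" .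
  qed
  also have "\<dots> = (\<integral>\<^sup>+r. (\<integral>\<^sup>+z. ennreal (f r z) * indicator {0<..<1} r \<partial>lborel) \<partial>lborel)"
    by (rule lborel_pair.Fubini') measurable
  also have "\<dots> \<le> (\<integral>\<^sup>+r. ennreal 4 * indicator {0<..<1} r + ennreal C * (ennreal (r powr (1 - 1) * (1 - r) powr (1/4 - 1)) * indicator {0<..<1} r) \<partial>lborel)"
  proof (intro nn_integral_mono)
    fix r :: real
    show "(\<integral>\<^sup>+z. ennreal (f r z) * indicator {0<..<1} r \<partial>lborel)
      \<le> ennreal 4 * indicator {0<..<1} r + ennreal C * (ennreal (r powr (1 - 1) * (1 - r) powr (1/4 - 1)) * indicator {0<..<1} r)"
    proof (cases "0 < r \<and> r < 1")
      case True
      then show ?thesis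
        using fle[of r] C by (simp add: ennreal_mult' ennreal_plus del: ennreal_numeral)
    qed auto
  qed
  also have "\<dots> = ennreal 4 + ennreal C * ennreal (Beta 1 (1/4))"
    using nn_integral_Beta[of 1 "1/4"]
    by (subst nn_integral_add) (auto simp: nn_integral_cmult)
  also have "\<dots> < \<infinity>" by (simp add: ennreal_mult_less_top)
  finally show "(\<integral>\<^sup>+z. ennreal (sample_density mu eta z * ln ((1 + resid2 z) / resid2 z)) \<partial>lborel) < \<infinity>" .
qed measurable

lemma integrable_resid3: "integrable lborel (\<lambda>z. sample_density mu eta z * resid3 z)"
  using nn_integral_resid3_exp_sumsq3[OF eta, of 0 mu]
  by (intro integrableI_nonneg) (auto simp: sample_nonneg)

lemma integrable_dist_snd: "integrable lborel (\<lambda>z. sample_density mu eta z * (norm (snd (snd z) - mu))\<^sup>2)"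
proof (rule integrableI_nonneg)
  have "(\<integral>\<^sup>+z. ennreal (sample_density mu eta z * (norm (snd (snd z) - mu))\<^sup>2) \<partial>lborel)
    = (\<integral>\<^sup>+z. ennreal (case z of (x1, x2, y) \<Rightarrow> tilt mu eta 0 x1 * tilt mu eta 0 x2 * (tilt mu eta 0 y * (norm (y - mu))\<^sup>2)) \<partial>lborel)"
    by (intro nn_integral_cong) (auto simp: sample_density_def tilt_0 mult.assoc split: prod.splits)
  also have "\<dots> = ennreal (1 * 1 * (mgf mu eta 0 * (real CARD('d) * (1 - 0) / eta + (norm ((1 - 0) *\<^sub>R mu - mu))\<^sup>2)))"
    using nn_integral_tilt[OF eta, of 0 mu] nn_integral_tilt_moment[OF eta, of 0 mu mu]
    by (intro nn_integral_sample_prod) (auto simp: tilt_nonneg mgf_0)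
  finally show "(\<integral>\<^sup>+z. ennreal (sample_density mu eta z * (norm (snd (snd z) - mu))\<^sup>2) \<partial>lborel) < \<infinity>"
    by simp
  show "(\<lambda>z. sample_density mu eta z * (norm (snd (snd z) - mu))\<^sup>2) \<in> borel_measurable lborel"
  proof -
    have "(\<lambda>z::'d sample. snd (snd z)) \<in> borel_measurable borel"
      unfolding borel_prod[symmetric] by measurable
    then show ?thesis by measurable
  qed
qed (auto simp: sample_nonneg)

end

section \<open>The ratio of the predictive densities as a function of the sample\<close>

lemma ss2_eq_resid2: "ss2 x1 x2 = resid2 (x1, x2, y)"
proof -
  have "x1 - xbar2 x1 x2 = (1/2) *\<^sub>R (x1 - x2)" "x2 - xbar2 x1 x2 = (1/2) *\<^sub>R (x2 - x1)"
    by (simp_all add: xbar2_def algebra_simps flip: scaleR_add_left)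
  then show ?thesis
    by (simp add: ss2_def resid2_def power_divide norm_minus_commute[of x2])
qed

lemma ss2_xbar2_eq:
  fixes x1 x2 y :: "real^'d"
  shows "ss2 x1 x2 + 2 * (norm (xbar2 x1 x2))\<^sup>2 = sumsq2 (x1, x2, y)"
    and "ss2 x1 x2 + 2/3 * (norm (y - xbar2 x1 x2))\<^sup>2 = resid3 (x1, x2, y)"
  unfolding ss2_eq_resid2[of x1 x2 y] 
  by (simp_all add: resid2_def resid3_def sumsq2_def xbar2_def power2_norm_eq_inner inner_diff inner_add inner_commute algebra_simps)
     (simp_all add: field_simps)

definition pred_ratio :: "real \<Rightarrow> 'd::finite sample \<Rightarrow> real" where
  "pred_ratio nu z = (3 * sumsq2 z / (2 * sumsq3 z)) powr nu
      * enn2real (mixing_integral CARD('d) nu (resid3 z / sumsq3 z)) / Beta nu (real CARD('d))"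

lemma pred_ratio_measurable [measurable]: "(pred_ratio nu :: 'd::finite sample \<Rightarrow> real) \<in> borel_measurable borel"
proof -
  have [measurable]: "mixing_integral d nu \<in> borel_measurable borel" for d
    unfolding mixing_integral_def by measurable
  show ?thesis unfolding pred_ratio_def by measurable
qed

lemma bayes_pred_eq_p_R_pred_ratio:
  fixes x1 x2 y :: "real^'d"
  assumes nu: "nu > 0"
  shows "bayes_pred 2 (prior_GM 2 nu) y (xbar2 x1 x2) (ss2 x1 x2)
    = p_R 2 y (xbar2 x1 x2) (ss2 x1 x2) * pred_ratio nu (x1, x2, y)"
proof (cases "ss2 x1 x2 > 0")
  case True
  have "ss2 x1 x2 + 2 * (norm (xbar2 x1 x2))\<^sup>2 + (norm y)\<^sup>2 = sumsq3 (x1, x2, y)"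
    unfolding ss2_xbar2_eq(1)[of x1 x2 y] by (simp add: sumsq2_def sumsq3_def)
  then show ?thesis
    unfolding bayes_pred_GM[OF nu True] pred_ratio_def ss2_xbar2_eq(1)[of x1 x2 y] ss2_xbar2_eq(2)
    by (simp add: ss2_xbar2_eq(1)[of x1 x2 y])
next
  \<comment> \<open>For coinciding observations both sides are 0: \<open>chi2\<close> vanishes at 0,
    and in \<open>p_R\<close> the division by 0 gives 0. The identity thus holds without exceptions,
    so it also transfers measurability.\<close>
  case False
  moreover have "ss2 x1 x2 \<ge> 0" by (simp add: ss2_def)
  ultimately have "ss2 x1 x2 = 0" by linarith
  then show ?thesis
    by (simp add: bayes_pred_def chi2_def p_R_def)
qed

text \<open>The lower bound is the one that yields domination. The upper bound, a constant
  independent of the sample, is there for integrability.\<close>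

lemma pred_ratio_bounds:
  fixes z :: "'d::finite sample"
  assumes nu: "0 < nu" "nu \<le> 1/1000" and z: "resid2 z > 0"
  shows "pred_ratio nu z > 0"
    and "nu * (ln (3/2) - ln (sumsq3 z / sumsq2 z) + 71/100 / real CARD('d) * (resid3 z / sumsq3 z)) \<le> ln (pred_ratio nu z)"
    and "ln (pred_ratio nu z) \<le> nu * ln (3/2) + ln (Beta nu (real CARD('d) / 2) / Beta nu (real CARD('d)))"
proof -
  have T: "sumsq2 z > 0" "sumsq3 z > 0" "resid3 z > 0"
    using z resid2_le_sumsq2[of z] sumsq2_le_sumsq3[of z] resid2_le_resid3[of z] by auto
  define \<tau> where "\<tau> = resid3 z / sumsq3 z"
  have \<tau>: "0 < \<tau>" "\<tau> \<le> 1" using T resid3_le_sumsq3[of z] by (auto simp: \<tau>_def)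
  define M where "M = mixing_integral CARD('d) nu \<tau>"
  define b b' where "b = Beta nu (real CARD('d))" and "b' = Beta nu (real CARD('d) / 2)"
  have b: "b > 0" "b' > 0" using nu by (auto simp: b_def b'_def Beta_def)
  have le: "M \<le> ennreal b'"
    unfolding M_def b'_def using nu \<tau> by (intro mixing_integral_le) auto
  have ge: "ennreal (b * exp (nu * (71/100 / real CARD('d)) * \<tau>)) \<le> M"
    unfolding M_def b_def using nu \<tau> by (intro mixing_integral_ge) auto
  have fin: "M < top" using le by (simp add: le_less_trans)
  define m where "m = enn2real M"
  have M: "M = ennreal m" using fin by (simp add: m_def)
  have m: "b * exp (nu * (71/100 / real CARD('d)) * \<tau>) \<le> m" "m \<le> b'"
    using le ge b by (auto simp: M m_def[symmetric] ennreal_le_iff2 mult_le_0_iff)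
  have m0: "m > 0" by (rule less_le_trans[OF _ m(1)]) (simp add: b)
  have eq: "pred_ratio nu z = (3 * sumsq2 z / (2 * sumsq3 z)) powr nu * m / b"
    by (simp add: pred_ratio_def m_def M_def \<tau>_def b_def)
  show "pred_ratio nu z > 0" unfolding eq using T m0 b by simp
  have ln: "ln (pred_ratio nu z) = nu * (ln (3/2) - ln (sumsq3 z / sumsq2 z)) + (ln m - ln b)"
    unfolding eq using T m0 b by (simp add: ln_mult ln_div ln_powr algebra_simps)
  have "ln (b * exp (nu * (71/100 / real CARD('d)) * \<tau>)) \<le> ln m"
    using m b by (intro ln_mono) auto
  then have "nu * (71/100 / real CARD('d)) * \<tau> \<le> ln m - ln b"
    using b by (simp add: ln_mult)
  then show "nu * (ln (3/2) - ln (sumsq3 z / sumsq2 z) + 71/100 / real CARD('d) * (resid3 z / sumsq3 z)) \<le> ln (pred_ratio nu z)"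
    unfolding ln \<tau>_def[symmetric] by (simp add: algebra_simps)
  have "ln m \<le> ln b'" using m m0 b by simp
  moreover have "0 \<le> nu * ln (sumsq3 z / sumsq2 z)"
    using nu T sumsq2_le_sumsq3[of z] by (intro mult_nonneg_nonneg ln_ge_zero) auto
  ultimately show "ln (pred_ratio nu z) \<le> nu * ln (3/2) + ln (b' / b)"
    unfolding ln using b by (simp add: ln_div algebra_simps)
qed

section \<open>The Kullback-Leibler risks and their difference\<close>

lemma kl_integrand2_eq:
  "kl_integrand2 p mu eta z = sample_density mu eta z *
    ln (phi (snd (snd z)) mu (1 / eta) / p (snd (snd z)) (xbar2 (fst z) (fst (snd z))) (ss2 (fst z) (fst (snd z))))"
  by (auto simp: kl_integrand2_def sample_density_def split: prod.splits)

lemma p_R_sample_measurable: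
  "(\<lambda>z::'d::finite sample. p_R 2 (snd (snd z)) (xbar2 (fst z) (fst (snd z))) (ss2 (fst z) (fst (snd z)))) \<in> borel_measurable borel"
  unfolding p_R_def xbar2_def ss2_def borel_prod[symmetric] by measurable

lemma phi_sample_measurable:
  "(\<lambda>z::'d::finite sample. phi (snd (snd z)) mu (1 / eta)) \<in> borel_measurable borel"
  unfolding borel_prod[symmetric] by measurable

text \<open>The logarithm of phi/p_R is a constant plus multiples of |y - mu|^2, ln s and ln S, with
  s = resid2 and S = resid3. Since s <= S, both logarithms are bounded in absolute value by ln ((1 +
  s)/s) + S, so four functions already known to be integrable give the envelope
  \<open>U\<close>.\<close>

lemma integrable_kl_p_R:
  fixes mu :: "real^'d"
  assumes eta: "eta > 0"
  shows "integrable lborel (kl_integrand2 (p_R 2) mu eta)"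
proof -
  define d where "d = real CARD('d)"
  have d: "d > 0" by (simp add: d_def)
  define K where "K = \<bar>- (d / 2) * ln (2 * pi / eta) - ln (Gamma d / Gamma (d / 2)) - d / 2 * ln (2 / (3 * pi))\<bar>"
  define U where "U z = sample_density mu eta z * K + eta / 2 * (sample_density mu eta z * (norm (snd (snd z) - mu))\<^sup>2)
    + 2 * d * (sample_density mu eta z * ln ((1 + resid2 z) / resid2 z)) + 2 * d * (sample_density mu eta z * resid3 z)" for z
  have "integrable lborel U"
    unfolding U_def
    by (intro Bochner_Integration.integrable_add integrable_mult_right integrable_mult_left
        integrable_sample_density[OF eta] integrable_dist_snd[OF eta] integrable_ln_resid2[OF eta] integrable_resid3[OF eta])
  then show ?thesis
  proof (rule Bochner_Integration.integrable_bound)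
    show "kl_integrand2 (p_R 2) mu eta \<in> borel_measurable lborel"
      unfolding kl_integrand2_eq[abs_def] using p_R_sample_measurable phi_sample_measurable by measurable
    show "AE z in lborel. norm (kl_integrand2 (p_R 2) mu eta z) \<le> norm (U z)"
      using AE_resid2_pos
    proof (rule eventually_mono)
      fix z :: "'d sample" assume s: "resid2 z > 0"
      obtain x1 x2 y where z: "z = (x1, x2, y)" by (cases z) auto
      define s S where "s = resid2 z" and "S = resid3 z"
      have sS: "0 < s" "s \<le> S" "0 < S" using s resid2_le_resid3[of z] by (auto simp: s_def S_def)
      have pR: "p_R 2 y (xbar2 x1 x2) (ss2 x1 x2) = Gamma d / Gamma (d / 2) * ((2 / (3 * pi)) / s) powr (d / 2) * (S / s) powr (- d)"
      proof -
        have "1 + 1 / s * (2 / 3) * (norm (y - xbar2 x1 x2))\<^sup>2 = S / s"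
          using ss2_xbar2_eq(2)[of x1 x2 y] sS unfolding S_def s_def ss2_eq_resid2[of x1 x2 y] z by (simp add: field_simps)
        then show ?thesis
          unfolding ss2_eq_resid2[of x1 x2 y] z[symmetric] s_def[symmetric]
          by (simp add: p_R_def d_def mult_ac)
      qed
      have G: "Gamma d > 0" "Gamma (d / 2) > 0" using d by auto
      have "ln (phi y mu (1 / eta) / p_R 2 y (xbar2 x1 x2) (ss2 x1 x2))
         = (- (d / 2) * ln (2 * pi / eta) - ln (Gamma d / Gamma (d / 2)) - d / 2 * ln (2 / (3 * pi)))
           - eta / 2 * (norm (y - mu))\<^sup>2 - d / 2 * ln s + d * ln S"
      proof -
        have "phi y mu (1 / eta) > 0" "p_R 2 y (xbar2 x1 x2) (ss2 x1 x2) > 0"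
          using eta sS G by (auto simp: phi_def pR)
        then have "ln (phi y mu (1 / eta) / p_R 2 y (xbar2 x1 x2) (ss2 x1 x2)) = ln (phi y mu (1 / eta)) - ln (p_R 2 y (xbar2 x1 x2) (ss2 x1 x2))"
          by (simp add: ln_div)
        also have "ln (phi y mu (1 / eta)) = - (d / 2) * ln (2 * pi / eta) - eta / 2 * (norm (y - mu))\<^sup>2"
          unfolding phi_def d_def[symmetric] using eta by (simp add: ln_mult ln_powr)
        also have "ln (p_R 2 y (xbar2 x1 x2) (ss2 x1 x2)) = ln (Gamma d / Gamma (d / 2)) + d / 2 * (ln (2 / (3 * pi)) - ln s) - d * (ln S - ln s)"
        proof -
          define g h where "g = Gamma d / Gamma (d / 2)" and "h = 2 / (3 * pi)"
          have "g > 0" "h > 0" using G by (auto simp: g_def h_def)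
          then show ?thesis
            unfolding pR g_def[symmetric] h_def[symmetric] using sS
            by (simp add: ln_mult ln_powr ln_div algebra_simps)
        qed
        finally show ?thesis by (simp add: algebra_simps)
      qed
      \<comment> \<open>From above, ln s and ln S are at most S; from below, both are at least ln s,
        and -ln s <= ln ((1 + s)/s).\<close>
      moreover have "\<bar>ln s\<bar> \<le> ln ((1 + s) / s) + S" "\<bar>ln S\<bar> \<le> ln ((1 + s) / s) + S"
      proof -
        have 1: "ln ((1 + s) / s) = ln (1 + s) - ln s" using sS by (simp add: ln_div)
        have 2: "0 \<le> ln (1 + s)" "ln (1 + s) \<le> s" using sS ln_add_one_self_le_self[of s] by auto
        have 3: "ln s \<le> ln (1 + s)" "ln s \<le> ln S" "ln S \<le> S" using sS ln_le_minus_one[of S] by auto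
        show "\<bar>ln s\<bar> \<le> ln ((1 + s) / s) + S" "\<bar>ln S\<bar> \<le> ln ((1 + s) / s) + S"
          unfolding 1 using 2 3 sS by linarith+
      qed
      moreover have "0 \<le> eta / 2 * (norm (y - mu))\<^sup>2" using eta by simp
      ultimately have "\<bar>ln (phi y mu (1 / eta) / p_R 2 y (xbar2 x1 x2) (ss2 x1 x2))\<bar>
        \<le> K + eta / 2 * (norm (y - mu))\<^sup>2 + d / 2 * (ln ((1 + s) / s) + S) + d * (ln ((1 + s) / s) + S)"
      proof -
        define k where "k = - (d / 2) * ln (2 * pi / eta) - ln (Gamma d / Gamma (d / 2)) - d / 2 * ln (2 / (3 * pi))"
        assume eq: "ln (phi y mu (1 / eta) / p_R 2 y (xbar2 x1 x2) (ss2 x1 x2))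
         = (- (d / 2) * ln (2 * pi / eta) - ln (Gamma d / Gamma (d / 2)) - d / 2 * ln (2 / (3 * pi)))
           - eta / 2 * (norm (y - mu))\<^sup>2 - d / 2 * ln s + d * ln S"
        assume l: "\<bar>ln s\<bar> \<le> ln ((1 + s) / s) + S" "\<bar>ln S\<bar> \<le> ln ((1 + s) / s) + S"
        assume p: "0 \<le> eta / 2 * (norm (y - mu))\<^sup>2"
        have "d / 2 * \<bar>ln s\<bar> \<le> d / 2 * (ln ((1 + s) / s) + S)" "d * \<bar>ln S\<bar> \<le> d * (ln ((1 + s) / s) + S)"
          using d l by (auto intro!: mult_left_mono)
        moreover have "\<bar>d / 2 * ln s\<bar> = d / 2 * \<bar>ln s\<bar>" "\<bar>d * ln S\<bar> = d * \<bar>ln S\<bar>" using d by (auto simp: abs_mult)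
        ultimately show ?thesis
          unfolding eq K_def k_def[symmetric] using p by linarith
      qed
      also have "\<dots> \<le> K + eta / 2 * (norm (y - mu))\<^sup>2 + 2 * d * ln ((1 + s) / s) + 2 * d * S"
      proof -
        have "0 \<le> ln ((1 + s) / s)" using sS by (intro ln_ge_zero) auto
        then have "0 \<le> d * (ln ((1 + s) / s) + S)" using d sS by auto
        then show ?thesis by (simp add: algebra_simps)
      qed
      finally have "sample_density mu eta z * \<bar>ln (phi y mu (1 / eta) / p_R 2 y (xbar2 x1 x2) (ss2 x1 x2))\<bar>
        \<le> sample_density mu eta z * (K + eta / 2 * (norm (y - mu))\<^sup>2 + 2 * d * ln ((1 + s) / s) + 2 * d * S)"
        by (intro mult_left_mono sample_nonneg)
      also have "\<dots> = U z" by (simp add: U_def z s_def S_def algebra_simps)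
      finally show "norm (kl_integrand2 (p_R 2) mu eta z) \<le> norm (U z)"
        unfolding kl_integrand2_eq by (simp add: abs_mult sample_nonneg z)
    qed
  qed
qed

text \<open>The integrands differ by \<open>L\<close>, the density times the logarithm of
  \<open>pred_ratio\<close>, so the risk difference is the integral of \<open>L\<close>. It is
  bounded below by the integral of \<open>l\<close>, which is \<nu> times a quantity that does not
  involve \<nu>.\<close>

lemma kl_risk_GM:
  fixes mu :: "real^'d"
  assumes eta: "eta > 0" and nu: "0 < nu" "nu \<le> 1/1000"
  shows "integrable lborel (kl_integrand2 (bayes_pred 2 (prior_GM 2 nu)) mu eta)"
    and "kl_risk2 (bayes_pred 2 (prior_GM 2 nu)) mu eta < kl_risk2 (p_R 2) mu eta"
proof -
  define L where "L z = sample_density mu eta z * ln (pred_ratio nu z)" for z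
  define l where "l z = nu * (ln (3/2) * sample_density mu eta z - sample_density mu eta z * ln (sumsq3 z / sumsq2 z)
      + 71/100 / real CARD('d) * (sample_density mu eta z * (resid3 z / sumsq3 z)))" for z
  define C where "C = nu * ln (3/2) + ln (Beta nu (real CARD('d) / 2) / Beta nu (real CARD('d)))"
  have il: "integrable lborel l"
    unfolding l_def
    by (intro integrable_mult_right Bochner_Integration.integrable_add Bochner_Integration.integrable_diff
        integrable_sample_density[OF eta] integrable_ln_sumsq_ratio[OF eta] integrable_resid_ratio[OF eta])
  have lL: "AE z in lborel. l z \<le> L z \<and> L z \<le> C * sample_density mu eta z"
  proof (rule eventually_mono[OF AE_resid2_pos])
    fix z :: "'d sample" assume z: "resid2 z > 0"
    have "sample_density mu eta z * (nu * (ln (3/2) - ln (sumsq3 z / sumsq2 z) + 71/100 / real CARD('d) * (resid3 z / sumsq3 z))) \<le> L z"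
      unfolding L_def by (intro mult_left_mono pred_ratio_bounds(2)[OF nu z] sample_nonneg)
    moreover have "L z \<le> sample_density mu eta z * C"
      unfolding L_def C_def by (intro mult_left_mono pred_ratio_bounds(3)[OF nu z] sample_nonneg)
    ultimately show "l z \<le> L z \<and> L z \<le> C * sample_density mu eta z"
      unfolding l_def by (simp add: algebra_simps)
  qed
  \<comment> \<open>The lower bound alone would not give integrability; \<open>L\<close> is squeezed
    between \<open>l\<close> and a multiple of the density.\<close>
  have iL: "integrable lborel L"
  proof (rule Bochner_Integration.integrable_bound)
    show "integrable lborel (\<lambda>z. \<bar>l z\<bar> + \<bar>C * sample_density mu eta z\<bar>)"
      by (intro Bochner_Integration.integrable_add integrable_abs il integrable_mult_right integrable_sample_density[OF eta])
    show "AE z in lborel. norm (L z) \<le> norm (\<bar>l z\<bar> + \<bar>C * sample_density mu eta z\<bar>)"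
      using lL by eventually_elim (simp, linarith)
    show "L \<in> borel_measurable lborel" unfolding L_def by measurable
  qed
  have kl: "AE z in lborel. kl_integrand2 (bayes_pred 2 (prior_GM 2 nu)) mu eta z = kl_integrand2 (p_R 2) mu eta z - L z"
  proof (rule eventually_mono[OF AE_resid2_pos])
    fix z :: "'d sample" assume s: "resid2 z > 0"
    obtain x1 x2 y where z: "z = (x1, x2, y)" by (cases z) auto
    have "ss2 x1 x2 > 0" using s by (simp add: ss2_eq_resid2[of x1 x2 y] z)
    moreover from this have "1 + 2 * (norm (y - xbar2 x1 x2))\<^sup>2 / (ss2 x1 x2 * 3) > 0"
      by (intro add_pos_nonneg) auto
    ultimately have "p_R 2 y (xbar2 x1 x2) (ss2 x1 x2) > 0"
      by (auto simp: p_R_def intro!: mult_pos_pos divide_pos_pos)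
    moreover have "phi y mu (1 / eta) > 0" using eta by (simp add: phi_def)
    ultimately have "ln (phi y mu (1 / eta) / (p_R 2 y (xbar2 x1 x2) (ss2 x1 x2) * pred_ratio nu z))
      = ln (phi y mu (1 / eta) / p_R 2 y (xbar2 x1 x2) (ss2 x1 x2)) - ln (pred_ratio nu z)"
      using pred_ratio_bounds(1)[OF nu s] by (simp add: ln_div ln_mult)
    then show "kl_integrand2 (bayes_pred 2 (prior_GM 2 nu)) mu eta z = kl_integrand2 (p_R 2) mu eta z - L z"
      unfolding kl_integrand2_eq L_def by (simp add: z bayes_pred_eq_p_R_pred_ratio[OF nu(1)] right_diff_distrib)
  qed
  have meas: "kl_integrand2 (bayes_pred 2 (prior_GM 2 nu)) mu eta \<in> borel_measurable lborel"
    unfolding kl_integrand2_eq[abs_def] bayes_pred_eq_p_R_pred_ratio[OF nu(1)] prod.collapse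
    using p_R_sample_measurable phi_sample_measurable by measurable
  have iD: "integrable lborel (\<lambda>z. kl_integrand2 (p_R 2) mu eta z - L z)"
    by (intro Bochner_Integration.integrable_diff integrable_kl_p_R eta iL)
  show "integrable lborel (kl_integrand2 (bayes_pred 2 (prior_GM 2 nu)) mu eta)"
    using kl meas iD by (subst integrable_cong_AE[OF _ _ kl]) auto
  have "kl_risk2 (bayes_pred 2 (prior_GM 2 nu)) mu eta = (\<integral>z. kl_integrand2 (p_R 2) mu eta z - L z \<partial>lborel)"
    unfolding kl_risk2_def using meas iD by (intro integral_cong_AE kl) auto
  also have "\<dots> = kl_risk2 (p_R 2) mu eta - (\<integral>z. L z \<partial>lborel)"
    unfolding kl_risk2_def by (intro Bochner_Integration.integral_diff integrable_kl_p_R eta iL)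
  finally have eq: "kl_risk2 (bayes_pred 2 (prior_GM 2 nu)) mu eta = kl_risk2 (p_R 2) mu eta - (\<integral>z. L z \<partial>lborel)" .
  define J where "J = (\<integral>z. sample_density mu eta z * (resid3 z / sumsq3 z) \<partial>lborel)"
  define Q where "Q = (\<integral>z. sample_density mu eta z * ln (sumsq3 z / sumsq2 z) \<partial>lborel)"
  have J: "J > 0" unfolding J_def by (rule integral_resid_ratio_pos[OF eta])
  have Q: "Q \<le> ln (3/2) + 141/200 / real CARD('d) * J"
    unfolding J_def Q_def by (rule integral_ln_sumsq_ratio_le[OF eta])
  have "(\<integral>z. l z \<partial>lborel) = nu * (ln (3/2) * 1 - Q + 71/100 / real CARD('d) * J)"
    unfolding l_def J_def Q_def integrable_sample_density(2)[OF eta, of mu, symmetric]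
    using integrable_sample_density(1)[OF eta, of mu] integrable_ln_sumsq_ratio[OF eta, of mu] integrable_resid_ratio[OF eta, of mu]
    by (simp del: times_divide_eq_right)
  moreover have "(\<integral>z. l z \<partial>lborel) \<le> (\<integral>z. L z \<partial>lborel)"
    using lL by (intro integral_mono_AE il iL) auto
  \<comment> \<open>The coefficient 0.71 from Jensen's inequality exceeds the 0.705 = 141/200 from
    the Laplace transform inequality, and J > 0, so strictness holds at every parameter.\<close>
  moreover have "0 < nu * (ln (3/2) * 1 - Q + 71/100 / real CARD('d) * J)"
  proof -
    have "141/200 / real CARD('d) * J < 71/100 / real CARD('d) * J"
      using J by (intro mult_strict_right_mono divide_strict_right_mono) auto
    then show ?thesis using Q nu by (intro mult_pos_pos) auto
  qed
  ultimately show "kl_risk2 (bayes_pred 2 (prior_GM 2 nu)) mu eta < kl_risk2 (p_R 2) mu eta"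
    unfolding eq by linarith
qed

theorem theorem2:
  assumes "CARD('d) \<le> 4"
  shows "\<exists>nu_star > 0. \<forall>nu. 0 < nu \<and> nu \<le> nu_star \<longrightarrow>
           dominates2 (bayes_pred 2 (prior_GM 2 nu :: real^'d \<Rightarrow> real \<Rightarrow> real))
                      (p_R 2 :: real^'d \<Rightarrow> real^'d \<Rightarrow> real \<Rightarrow> real)"
proof (intro exI[of _ "1/1000"] conjI allI impI)
  fix nu :: real
  assume "0 < nu \<and> nu \<le> 1/1000"
  then show "dominates2 (bayes_pred 2 (prior_GM 2 nu :: real^'d \<Rightarrow> real \<Rightarrow> real)) (p_R 2)"
    using kl_risk_GM[of _ nu] integrable_kl_p_R
    unfolding dominates2_def by (meson less_imp_le zero_less_one)
qed simp

end
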